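(* Let $0<c<1/4$, $\omega>0$ and $p=5$. Then for any solution $\varphi\in H^1_0(\mathbb{R}^+)\setminus\{0\}$ of $\varphi''+\frac{c}{x^2}\varphi-\omega\varphi+|\varphi|^{p-1}\varphi=0$, the standing wave $e^{i\omega t}\varphi(x)$ of the equation $i u_t+u''+c\frac{u}{x^2}+|u|^{p-1}u=0$ is unstable by blow-up.
   Context: $\mathbb{R}^+=(0,\infty)$; functions are complex valued; the stationary equation is understood in $H^{-1}(\mathbb{R}^+)$. The evolution equation is known to be locally well-posed in $H^1_0(\mathbb{R}^+)$: for each $u_0\in H^1_0(\mathbb{R}^+)$ there is a unique maximal solution $u\in C((-T_{\min},T_{\max}),H^1_0(\mathbb{R}^+))$ with $u(0)=u_0$, conserving $\|u(t)\|_{L^2}$ and the energy $E(u)=\frac12\|u'\|_{L^2}^2-\frac c2\|u/x\|_{L^2}^2-\frac1{p+1}\|u\|_{L^{p+1}}^{p+1}$; if $T_{\max}<\infty$ then $\|u'(t)\|_{L^2}\to\infty$ as $t\to T_{\max}$, and in this case the solution is said to blow up in finite time. "$e^{i\omega t}\varphi$ is unstable by blow-up" means: for every $\varepsilon>0$ there is $u_0\in H^1_0(\mathbb{R}^+)$ with $\|u_0-\varphi\|_{H^1}<\varepsilon$ such that the maximal solution with initial value $u_0$ blows up in finite time. *)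

theory Defs
  imports "HOL-Analysis.Analysis"
begin

section \<open>Sobolev spaces on the half-line\<close>

text \<open>
  Elements of \<open>L\<^sup>2(0,\<infinity>)\<close> are represented by functions on all of \<^typ>\<open>real\<close>, of which only the
  restriction to \<open>(0,\<infinity>)\<close>, up to null sets, is relevant.
\<close>

abbreviation Rpos :: "real measure" where
  "Rpos \<equiv> lebesgue_on {0<..}"

definition L2 :: "(real \<Rightarrow> complex) set" where
  "L2 = {u. u \<in> borel_measurable Rpos \<and> integrable Rpos (\<lambda>x. (cmod (u x))\<^sup>2)}"

definition L2_norm :: "(real \<Rightarrow> complex) \<Rightarrow> real" where
  "L2_norm u = sqrt (LINT x|Rpos. (cmod (u x))\<^sup>2)"

definition L2_inner :: "(real \<Rightarrow> complex) \<Rightarrow> (real \<Rightarrow> complex) \<Rightarrow> complex" where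
  "L2_inner u v = (LINT x|Rpos. u x * cnj (v x))"

text \<open>\<open>C\<^sub>c\<^sup>\<infinity>(0,\<infinity>)\<close>; \<open>D n\<close> is the \<open>n\<close>-th derivative.\<close>

definition test_functions :: "(real \<Rightarrow> complex) set" where
  "test_functions = {\<psi>.
     (\<exists>D. D 0 = \<psi> \<and> (\<forall>n x. (D n has_vector_derivative D (Suc n) x) (at x))) \<and>
     (\<exists>K. compact K \<and> K \<subseteq> {0<..} \<and> (\<forall>x. x \<notin> K \<longrightarrow> \<psi> x = 0))}"

definition has_weak_deriv :: "(real \<Rightarrow> complex) \<Rightarrow> (real \<Rightarrow> complex) \<Rightarrow> bool" where
  "has_weak_deriv u v \<longleftrightarrow>
     (\<forall>\<psi>\<in>test_functions.
        (LINT x|Rpos. u x * vector_derivative \<psi> (at x)) = - (LINT x|Rpos. v x * \<psi> x))"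

definition H1 :: "(real \<Rightarrow> complex) set" where
  "H1 = {u \<in> L2. \<exists>v\<in>L2. has_weak_deriv u v}"

text \<open>The weak derivative of \<open>u \<in> H\<^sup>1\<close> is unique up to null sets, so the choice is immaterial.\<close>

definition weak_deriv :: "(real \<Rightarrow> complex) \<Rightarrow> real \<Rightarrow> complex" where
  "weak_deriv u = (SOME v. v \<in> L2 \<and> has_weak_deriv u v)"

definition H1_norm :: "(real \<Rightarrow> complex) \<Rightarrow> real" where
  "H1_norm u = sqrt ((L2_norm u)\<^sup>2 + (L2_norm (weak_deriv u))\<^sup>2)"

text \<open>The closure of the test functions in \<open>H\<^sup>1\<close>.\<close>

definition H10 :: "(real \<Rightarrow> complex) set" where
  "H10 = {u \<in> H1. \<forall>\<epsilon>>0. \<exists>\<psi>\<in>test_functions. H1_norm (\<lambda>x. u x - \<psi> x) < \<epsilon>}"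

text \<open>
  Elements of \<open>H\<^sup>-\<^sup>1\<close>, the antidual of \<open>H\<^sup>1\<^sub>0\<close>, are represented by functionals on functions, of which
  only the values on \<^const>\<open>H10\<close> matter; a function \<open>u\<close> is identified with \<open>L2_inner u\<close>. The norm is
  \<open>\<infinity>\<close> for unbounded functionals.
\<close>

definition Hm1_norm :: "((real \<Rightarrow> complex) \<Rightarrow> complex) \<Rightarrow> ennreal" where
  "Hm1_norm F = (SUP v\<in>{v \<in> H10. H1_norm v \<le> 1}. ennreal (cmod (F v)))"

section \<open>The equations\<close>

text \<open>
  The element \<open>u'' + c u / x\<^sup>2 + |u|\<^sup>p\<^sup>-\<^sup>1 u\<close> of \<open>H\<^sup>-\<^sup>1\<close>. All three integrals converge for
  \<open>u, v \<in> H\<^sup>1\<^sub>0\<close>, the second by Hardy's inequality.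
\<close>

definition nls_op :: "real \<Rightarrow> real \<Rightarrow> (real \<Rightarrow> complex) \<Rightarrow> (real \<Rightarrow> complex) \<Rightarrow> complex" where
  "nls_op c p u v =
     - L2_inner (weak_deriv u) (weak_deriv v)
     + of_real c * (LINT x|Rpos. u x * cnj (v x) / of_real (x\<^sup>2))
     + (LINT x|Rpos. of_real (cmod (u x) powr (p - 1)) * u x * cnj (v x))"

definition stationary_solution :: "real \<Rightarrow> real \<Rightarrow> real \<Rightarrow> (real \<Rightarrow> complex) \<Rightarrow> bool" where
  "stationary_solution c p \<omega> \<phi> \<longleftrightarrow>
     \<phi> \<in> H10 \<and> (\<forall>v\<in>H10. nls_op c p \<phi> v - of_real \<omega> * L2_inner \<phi> v = 0)"

definition time_interval :: "ereal \<Rightarrow> ereal \<Rightarrow> real set" where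
  "time_interval Tmin Tmax = {t. - Tmin < ereal t \<and> ereal t < Tmax}"

definition has_Hm1_derivative ::
  "(real \<Rightarrow> real \<Rightarrow> complex) \<Rightarrow> ((real \<Rightarrow> complex) \<Rightarrow> complex) \<Rightarrow> real \<Rightarrow> bool" where
  "has_Hm1_derivative u F t \<longleftrightarrow>
     ((\<lambda>s. Hm1_norm (\<lambda>v. (L2_inner (u s) v - L2_inner (u t) v) / of_real (s - t) - F v))
        \<longlongrightarrow> 0) (at t)"

text \<open>
  \<open>u \<in> C((-Tmin,Tmax), H\<^sup>1\<^sub>0)\<close> is differentiable into \<open>H\<^sup>-\<^sup>1\<close> and
  \<open>\<i> u\<^sub>t + u'' + c u / x\<^sup>2 + |u|\<^sup>p\<^sup>-\<^sup>1 u = 0\<close> in \<open>H\<^sup>-\<^sup>1\<close> at every time; by the equation, the time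
  derivative \<open>F\<close> is then automatically continuous into \<open>H\<^sup>-\<^sup>1\<close>.
\<close>

definition nls_solution ::
  "real \<Rightarrow> real \<Rightarrow> (real \<Rightarrow> real \<Rightarrow> complex) \<Rightarrow> ereal \<Rightarrow> ereal \<Rightarrow> bool" where
  "nls_solution c p u Tmin Tmax \<longleftrightarrow>
     0 < Tmin \<and> 0 < Tmax \<and>
     (\<forall>t\<in>time_interval Tmin Tmax. u t \<in> H10) \<and>
     (\<forall>t\<in>time_interval Tmin Tmax. ((\<lambda>s. H1_norm (\<lambda>x. u s x - u t x)) \<longlongrightarrow> 0) (at t)) \<and>
     (\<forall>t\<in>time_interval Tmin Tmax. \<exists>F. has_Hm1_derivative u F t \<and>
        (\<forall>v\<in>H10. \<i> * F v + nls_op c p (u t) v = 0))"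

definition maximal_nls_solution ::
  "real \<Rightarrow> real \<Rightarrow> (real \<Rightarrow> complex) \<Rightarrow> (real \<Rightarrow> real \<Rightarrow> complex) \<Rightarrow> ereal \<Rightarrow> ereal \<Rightarrow> bool" where
  "maximal_nls_solution c p u0 u Tmin Tmax \<longleftrightarrow>
     nls_solution c p u Tmin Tmax \<and>
     (AE x in Rpos. u 0 x = u0 x) \<and>
     (\<forall>w Smin Smax. nls_solution c p w Smin Smax \<longrightarrow> Tmin \<le> Smin \<longrightarrow> Tmax \<le> Smax \<longrightarrow>
        (\<forall>t\<in>time_interval Tmin Tmax. AE x in Rpos. w t x = u t x) \<longrightarrow>
        Smin = Tmin \<and> Smax = Tmax)"

section \<open>Instability by blow-up\<close>

definition blows_up_at :: "(real \<Rightarrow> real \<Rightarrow> complex) \<Rightarrow> ereal \<Rightarrow> bool" where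
  "blows_up_at u Tmax \<longleftrightarrow>
     Tmax < \<infinity> \<and>
     filterlim (\<lambda>t. L2_norm (weak_deriv (u t))) at_top (at_left (real_of_ereal Tmax))"

text \<open>
  Local well-posedness is not assumed: ``the maximal solution with initial value \<open>u0\<close> blows up''
  means that there is one and that every one blows up.
\<close>

definition unstable_by_blow_up :: "real \<Rightarrow> real \<Rightarrow> (real \<Rightarrow> real \<Rightarrow> complex) \<Rightarrow> bool" where
  "unstable_by_blow_up c p U \<longleftrightarrow>
     (\<forall>\<epsilon>>0. \<exists>u0\<in>H10. H1_norm (\<lambda>x. u0 x - U 0 x) < \<epsilon> \<and>
        (\<exists>u Tmin Tmax. maximal_nls_solution c p u0 u Tmin Tmax) \<and>
        (\<forall>u Tmin Tmax. maximal_nls_solution c p u0 u Tmin Tmax \<longrightarrow> blows_up_at u Tmax))"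

definition standing_wave :: "real \<Rightarrow> (real \<Rightarrow> complex) \<Rightarrow> real \<Rightarrow> real \<Rightarrow> complex" where
  "standing_wave \<omega> \<phi> t x = exp (\<i> * of_real (\<omega> * t)) * \<phi> x"

end

(*
  For p = 5 the equation is invariant under scaling, and the potential c / x^2 does not break the
  pseudo-conformal symmetry. Hence, with s = 1 - a t and a > 0, the standing wave is mapped to the solution
    U(t,x) = s^(-1/2) exp (i (\<omega> t / s - a x^2 / (4 s))) \<phi>(x / s),
  which exists for t < 1 / a and whose derivative blows up in L^2 at t = 1 / a. Its initial value
  exp (- i a x^2 / 4) \<phi> tends to \<phi> in H^1 as a tends to 0, because \<phi> decays exponentially. Solutions in
  H^1_0 are unique by an L^2 energy estimate in which the potential drops out, so every maximal
  solution with this initial value is U, and no existence theory is needed.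
*)

theory Submission
  imports Defs
begin

section \<open>Test functions\<close>


text \<open>Under the scaling x / s the second derivative, c / x^2 and |u|^4 all acquire the factor
  1 / s^2, the last one because the amplitude s^(-1/2) enters to the fourth power; what remains is
  an algebraic identity, checked directly in \<open>nls_identity\<close>. The analysis is shaped by
  three obstacles. The equation for \<phi> is only given in H^-1 and must first be made classical.
  With f = \<phi>, g = \<phi>' and y = x / s, the time derivative of U contains f, y^2 f and y g,
  and the x-derivative contains y f, so decay is needed for the estimates and for U to stay in
  H^1_0. Finally c / x^2 allows g to be unbounded at 0: only y g has a pointwise bound, and the part
  of the x-derivative that carries g is continuous in time because its norm is, not by domination.
  Hardy's inequality makes the potential a bounded form on H^1_0 and shows that g has positive norm
  when \<phi> is not zero, so that the x-derivative of U grows like 1 / s. In the energy estimate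
  the quadratic forms are real, and the factor i in the equation removes them from the real
  part.\<close>

definition smooth :: "(real \<Rightarrow> complex) \<Rightarrow> bool" where
  "smooth f \<longleftrightarrow> (\<exists>D. D 0 = f \<and> (\<forall>n x. (D n has_vector_derivative D (Suc n) x) (at x)))"

text \<open>All derivatives are obtained by iterating one choice function \<open>d\<close> that
  picks a derivative inside the class \<open>P\<close>, so closure of \<open>P\<close> under a
  single differentiation is enough.\<close>

lemma smooth_coinduct:
  assumes "P f" and step: "\<And>g. P g \<Longrightarrow> \<exists>g'. P g' \<and> (\<forall>x. (g has_vector_derivative g' x) (at x))"
  shows "smooth f"
proof -
  obtain d where d: "\<And>g. P g \<Longrightarrow> P (d g) \<and> (\<forall>x. (g has_vector_derivative d g x) (at x))"
    using step by metis
  have P: "P ((d ^^ n) f)" for n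
    by (induction n) (use assms(1) d in auto)
  show ?thesis
    unfolding smooth_def by (rule exI[of _ "\<lambda>n. (d ^^ n) f"]) (use d P in auto)
qed

lemma smooth_derivative:
  assumes "smooth f"
  obtains f' where "smooth f'" "\<And>x. (f has_vector_derivative f' x) (at x)"
proof -
  obtain D where D: "D 0 = f" "\<And>n x. (D n has_vector_derivative D (Suc n) x) (at x)"
    using assms unfolding smooth_def by blast
  have "smooth (D 1)"
    unfolding smooth_def by (rule exI[of _ "\<lambda>n. D (Suc n)"]) (use D in auto)
  with that D show thesis by (metis One_nat_def)
qed

lemma smooth_antiderivative:
  assumes "smooth f'" "\<And>x. (f has_vector_derivative f' x) (at x)"
  shows "smooth f"
  by (rule smooth_coinduct[of "\<lambda>g. g = f \<or> smooth g"])
     (use assms smooth_derivative in \<open>metis+\<close>)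

lemma smooth_imp_continuous: "smooth f \<Longrightarrow> continuous_on A f"
  by (meson smooth_derivative continuous_at_imp_continuous_on has_vector_derivative_continuous)

text \<open>The class to which \<open>smooth_coinduct\<close> is applied: the product rule leads out
  of a set of generators, but not out of the algebra that they generate together with the
  constants.\<close>

inductive_set func_alg :: "(real \<Rightarrow> complex) set \<Rightarrow> (real \<Rightarrow> complex) set" for B where
  base: "f \<in> B \<Longrightarrow> f \<in> func_alg B"
| const: "(\<lambda>_. c) \<in> func_alg B"
| add: "f \<in> func_alg B \<Longrightarrow> g \<in> func_alg B \<Longrightarrow> (\<lambda>x. f x + g x) \<in> func_alg B"
| mult: "f \<in> func_alg B \<Longrightarrow> g \<in> func_alg B \<Longrightarrow> (\<lambda>x. f x * g x) \<in> func_alg B"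

text \<open>Sum and product rule carry closure under differentiation from the generators to the
  algebra. The generators will be all smooth functions, the \<open>exp_bump\<close> family, and a
  Gaussian with the identity.\<close>

lemma func_alg_smooth:
  assumes B: "\<And>f. f \<in> B \<Longrightarrow> \<exists>f'\<in>func_alg B. \<forall>x. (f has_vector_derivative f' x) (at x)"
    and f: "f \<in> func_alg B"
  shows "smooth f"
proof (rule smooth_coinduct[of "\<lambda>g. g \<in> func_alg B", OF f])
  fix g assume "g \<in> func_alg B"
  then show "\<exists>g'. g' \<in> func_alg B \<and> (\<forall>x. (g has_vector_derivative g' x) (at x))"
  proof induction
    case (base f) then show ?case using B by blast
  next
    case (const c) then show ?case
      by (intro exI[of _ "\<lambda>_. 0"]) (auto intro: func_alg.const)
  next
    case (add f g)
    then obtain f' g' where *: "f' \<in> func_alg B" "g' \<in> func_alg B"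
      "\<And>x. (f has_vector_derivative f' x) (at x)" "\<And>x. (g has_vector_derivative g' x) (at x)" by blast
    then show ?case
      by (intro exI[of _ "\<lambda>x. f' x + g' x"]) (auto intro: func_alg.add has_vector_derivative_add)
  next
    case (mult f g)
    then obtain f' g' where *: "f' \<in> func_alg B" "g' \<in> func_alg B"
      "\<And>x. (f has_vector_derivative f' x) (at x)" "\<And>x. (g has_vector_derivative g' x) (at x)" by blast
    have "((\<lambda>x. f x * g x) has_vector_derivative f x * g' x + f' x * g x) (at x)" for x
      by (rule has_vector_derivative_mult) (use * in auto)
    then show ?case using * mult.hyps
      by (intro exI[of _ "\<lambda>x. f x * g' x + f' x * g x"]) (auto intro: func_alg.add func_alg.mult)
  qed
qed

lemma func_alg_smooth_closed:
  assumes "f \<in> func_alg (Collect smooth)" shows "smooth f"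
proof (rule func_alg_smooth[OF _ assms])
  fix g :: "real \<Rightarrow> complex" assume "g \<in> Collect smooth"
  then obtain g' where "smooth g'" "\<And>x. (g has_vector_derivative g' x) (at x)"
    by (auto elim: smooth_derivative)
  then show "\<exists>f'\<in>func_alg (Collect smooth). \<forall>x. (g has_vector_derivative f' x) (at x)"
    by (intro bexI[of _ g']) (auto intro: func_alg.base)
qed

lemma smooth_const [intro, simp]: "smooth (\<lambda>_. c)"
  by (rule func_alg_smooth_closed) (rule func_alg.const)

lemma smooth_add [intro]: "smooth f \<Longrightarrow> smooth g \<Longrightarrow> smooth (\<lambda>x. f x + g x)"
  by (rule func_alg_smooth_closed) (auto intro: func_alg.intros)

lemma smooth_mult [intro]: "smooth f \<Longrightarrow> smooth g \<Longrightarrow> smooth (\<lambda>x. f x * g x)"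
  by (rule func_alg_smooth_closed) (auto intro: func_alg.intros)

lemma smooth_affine:
  assumes "smooth f" shows "smooth (\<lambda>x. f (r * x + d))"
proof -
  obtain D where D: "D 0 = f" "\<And>n x. (D n has_vector_derivative D (Suc n) x) (at x)"
    using assms unfolding smooth_def by blast
  have "((\<lambda>x. r ^ n *\<^sub>R D n (r * x + d)) has_vector_derivative r ^ Suc n *\<^sub>R D (Suc n) (r * x + d)) (at x)" for n x
  proof -
    have "((\<lambda>x. r * x + d) has_real_derivative r) (at x)" by (auto intro!: derivative_eq_intros)
    then have "((D n \<circ> (\<lambda>x. r * x + d)) has_vector_derivative r *\<^sub>R D (Suc n) (r * x + d)) (at x)"
      by (intro vector_diff_chain_at D(2)) (simp add: has_real_derivative_iff_has_vector_derivative)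
    then have "((\<lambda>x. D n (r * x + d)) has_vector_derivative r *\<^sub>R D (Suc n) (r * x + d)) (at x)"
      by (simp add: o_def)
    from has_vector_derivative_scaleR[OF DERIV_const this, of "r^n"] show ?thesis
      by (simp add: mult.commute)
  qed
  then show ?thesis unfolding smooth_def
    by (intro exI[of _ "\<lambda>n x. r ^ n *\<^sub>R D n (r * x + d)"]) (use D in auto)
qed

text \<open>The classical flat function exp (-1/x), with factors 1/x added so that the family is
  closed under differentiation up to linear combinations.\<close>

definition exp_bump :: "nat \<Rightarrow> real \<Rightarrow> real" where
  "exp_bump k x = (if x > 0 then exp (- inverse x) * inverse x ^ k else 0)"

text \<open>Only the term of degree \<open>k + 2\<close> in the series of exp (1/x) is kept. The two
  surplus powers leave a factor x^2, which makes the difference quotient at 0 of order h.\<close>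

lemma exp_bump_le:
  assumes "x > 0" shows "exp_bump k x \<le> fact (k + 2) * x\<^sup>2"
proof -
  have "inverse x ^ (k+2) / fact (k+2) \<le> exp (inverse x)"
    using sum_le_suminf[OF summable_exp[of "inverse x"], of "{k+2}"] assms
    by (simp add: exp_def divide_inverse mult.commute)
  then have "inverse x ^ (k+2) \<le> fact (k+2) * exp (inverse x)"
    by (subst (asm) pos_divide_le_eq) (simp_all only: fact_gt_zero mult.commute)
  then have "exp (- inverse x) * inverse x ^ (k+2) * x\<^sup>2 \<le> exp (- inverse x) * (fact (k+2) * exp (inverse x)) * x\<^sup>2"
    by (intro mult_left_mono mult_right_mono) auto
  also have "\<dots> = fact (k+2) * x\<^sup>2"
    by (simp add: exp_minus)
  also have "exp (- inverse x) * inverse x ^ (k+2) * x\<^sup>2 = exp_bump k x"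
  proof -
    have "inverse x ^ 2 * x\<^sup>2 = 1" using assms by (simp add: power_mult_distrib[symmetric])
    then show ?thesis using assms unfolding exp_bump_def power_add mult.assoc by simp
  qed
  finally show ?thesis .
qed

lemma exp_bump_derivative:
  "(exp_bump k has_real_derivative exp_bump (k+2) x - real k * exp_bump (k+1) x) (at x)"
proof (cases x "0::real" rule: linorder_cases)
  case less
  have "((\<lambda>_. 0) has_real_derivative 0) (at x)" by simp
  then have "(exp_bump k has_real_derivative 0) (at x)"
    by (rule has_field_derivative_transform_within_open[of _ _ _ "{..<0}"])
       (use less in \<open>simp_all add: exp_bump_def\<close>)
  then show ?thesis using less by (simp add: exp_bump_def)
next
  case greater
  have "((\<lambda>x. exp (- inverse x) * inverse x ^ k) has_real_derivative exp_bump (k+2) x - real k * exp_bump (k+1) x) (at x)"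
  proof -
    have i: "((\<lambda>x. inverse x) has_real_derivative - (inverse x * inverse x)) (at x)"
      using DERIV_inverse'[OF DERIV_ident, of x] greater by simp
    have e: "((\<lambda>x. exp (- inverse x)) has_real_derivative exp (- inverse x) * (inverse x * inverse x)) (at x)"
      using DERIV_fun_exp[OF DERIV_minus[OF i]] by simp
    have p: "((\<lambda>x. inverse x ^ k) has_real_derivative
        of_nat k * (- (inverse x * inverse x) * inverse x ^ (k - Suc 0))) (at x)"
      by (rule DERIV_power[OF i])
    have k: "of_nat k * (- (inverse x * inverse x) * inverse x ^ (k - Suc 0)) = - real k * inverse x ^ (k + 1)"
      by (cases k) (auto simp: algebra_simps)
    have b: "exp_bump j x = exp (- inverse x) * inverse x ^ j" for j
      using greater by (simp only: exp_bump_def if_True)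
    have "exp (- inverse x) * (inverse x * inverse x) * inverse x ^ k
        + (- real k * inverse x ^ (k + 1)) * exp (- inverse x) = exp_bump (k+2) x - real k * exp_bump (k+1) x"
      unfolding b power_add by (simp only: power_one_right power2_eq_square) algebra
    then show ?thesis
      using DERIV_mult[OF e p[unfolded k]] by (simp only:)
  qed
  then show ?thesis
    by (rule has_field_derivative_transform_within_open[of _ _ _ "{0<..}"])
       (use greater in \<open>simp_all add: exp_bump_def\<close>)
next
  case equal
  have "(exp_bump k has_real_derivative 0) (at 0)"
  proof -
    have le: "norm ((exp_bump k (0 + h) - exp_bump k 0) / h) \<le> fact (k+2) * \<bar>h\<bar>" for h :: real
    proof (cases "h > 0")
      case True
      then have "exp_bump k h \<ge> 0" by (simp add: exp_bump_def)
      then have "norm ((exp_bump k (0 + h) - exp_bump k 0) / h) = exp_bump k h / h"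
        using True by (simp add: exp_bump_def[of k 0])
      also have "\<dots> \<le> fact (k+2) * h\<^sup>2 / h"
        by (intro divide_right_mono exp_bump_le True less_imp_le[OF True])
      also have "\<dots> = fact (k+2) * \<bar>h\<bar>"
        using True by (simp only: power2_eq_square) simp
      finally show ?thesis .
    next
      case False
      then have "norm ((exp_bump k (0 + h) - exp_bump k 0) / h) = 0" by (simp add: exp_bump_def)
      also have "0 \<le> fact (k+2) * \<bar>h\<bar>" by (intro mult_nonneg_nonneg) simp_all
      finally show ?thesis .
    qed
    have lim: "((\<lambda>h. fact (k+2) * \<bar>h\<bar>) \<longlongrightarrow> 0) (at (0::real))"
      by (rule tendsto_mult_right_zero, rule tendsto_rabs_zero, rule tendsto_ident_at)
    show ?thesis unfolding DERIV_def
      by (rule Lim_null_comparison[OF always_eventually[OF allI[OF le]] lim])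
  qed
  then show ?thesis using equal by (simp add: exp_bump_def)
qed

lemma smooth_exp_bump: "smooth (\<lambda>x. of_real (exp_bump k x))"
proof -
  define e where "e = (\<lambda>k x. complex_of_real (exp_bump k x))"
  have d: "(e k has_vector_derivative e (k+2) x + (- of_nat k) * e (k+1) x) (at x)" for k x
  proof -
    have "((\<lambda>x. complex_of_real (exp_bump k x)) has_vector_derivative
        complex_of_real (exp_bump (k+2) x - real k * exp_bump (k+1) x)) (at x)"
      by (rule has_vector_derivative_of_real[OF exp_bump_derivative])
    then show ?thesis unfolding e_def by simp
  qed
  have mem: "e k \<in> func_alg (range e)" for k
    by (rule func_alg.base) (rule rangeI)
  have mem': "(\<lambda>x. e (k+2) x + (- of_nat k) * e (k+1) x) \<in> func_alg (range e)" for k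
    by (rule func_alg.add[OF mem func_alg.mult[OF func_alg.const mem]])
  have "smooth (e k)"
  proof (rule func_alg_smooth[of "range e", OF _ mem])
    fix f assume "f \<in> range e"
    then obtain j where f: "f = e j" by blast
    show "\<exists>f'\<in>func_alg (range e). \<forall>x. (f has_vector_derivative f' x) (at x)"
      unfolding f by (rule bexI[OF _ mem'[of j]]) (intro allI d)
  qed
  then show ?thesis by (simp add: e_def)
qed

section \<open>Test functions as a vector space, and approximate indicators\<close>

lemma test_functions_iff:
  "\<psi> \<in> test_functions \<longleftrightarrow> smooth \<psi> \<and> (\<exists>a b. 0 < a \<and> a < b \<and> (\<forall>x. x \<notin> {a..b} \<longrightarrow> \<psi> x = 0))"
proof (intro iffI conjI)
  assume *: "\<psi> \<in> test_functions"
  then show "smooth \<psi>" by (simp add: test_functions_def smooth_def)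
  from * obtain K where K: "compact K" "K \<subseteq> {0<..}" "\<And>x. x \<notin> K \<Longrightarrow> \<psi> x = 0"
    by (auto simp: test_functions_def)
  show "\<exists>a b. 0 < a \<and> a < b \<and> (\<forall>x. x \<notin> {a..b} \<longrightarrow> \<psi> x = 0)"
  proof (cases "K = {}")
    case True
    then show ?thesis using K by (intro exI[of _ 1] exI[of _ 2]) auto
  next
    case False
    obtain a where a: "a \<in> K" "\<And>x. x \<in> K \<Longrightarrow> a \<le> x"
      using compact_attains_inf[OF K(1) False] by auto
    obtain b where b: "b \<in> K" "\<And>x. x \<in> K \<Longrightarrow> x \<le> b"
      using compact_attains_sup[OF K(1) False] by auto
    have "0 < a" using a K(2) by auto
    \<comment> \<open>The endpoint \<open>b+1\<close> instead of \<open>b\<close> keeps the interval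
      nondegenerate when \<open>K\<close> is a single point.\<close>
    moreover have "\<psi> x = 0" if "x \<notin> {a..b+1}" for x using that a b K(3)[of x] by fastforce
    ultimately show ?thesis using a b(2)[OF a(1)] by (intro exI[of _ a] exI[of _ "b+1"]) auto
  qed
next
  assume *: "smooth \<psi> \<and> (\<exists>a b. 0 < a \<and> a < b \<and> (\<forall>x. x \<notin> {a..b} \<longrightarrow> \<psi> x = 0))"
  then obtain a b :: real where "0 < a" "a < b" "\<And>x. x \<notin> {a..b} \<Longrightarrow> \<psi> x = 0" by auto
  then show "\<psi> \<in> test_functions" using * unfolding test_functions_def smooth_def
    by (auto intro!: exI[of _ "{a..b}"])
qed

lemma test_functionsI:
  assumes "smooth \<psi>" "0 < a" "a < b" "\<And>x. x \<notin> {a..b} \<Longrightarrow> \<psi> x = 0"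
  shows "\<psi> \<in> test_functions"
  using assms unfolding test_functions_iff by blast

lemma test_functionE:
  assumes "\<psi> \<in> test_functions"
  obtains \<psi>' a b where "0 < a" "a < b" "smooth \<psi>" "\<psi>' \<in> test_functions"
    "\<And>x. x \<notin> {a..b} \<Longrightarrow> \<psi> x = 0" "\<And>x. x \<notin> {a..b} \<Longrightarrow> \<psi>' x = 0"
    "\<And>x. (\<psi> has_vector_derivative \<psi>' x) (at x)"
    "\<And>x. vector_derivative \<psi> (at x) = \<psi>' x"
proof -
  obtain a b where ab: "smooth \<psi>" "0 < a" "a < b" "\<And>x. x \<notin> {a..b} \<Longrightarrow> \<psi> x = 0"
    using assms by (auto simp: test_functions_iff)
  obtain \<psi>' where d: "smooth \<psi>'" "\<And>x. (\<psi> has_vector_derivative \<psi>' x) (at x)"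
    using ab(1) smooth_derivative by blast
  have z: "\<psi>' x = 0" if "x \<notin> {a..b}" for x
  proof -
    have "(\<psi> has_vector_derivative 0) (at x) \<longleftrightarrow> ((\<lambda>_. 0) has_vector_derivative (0::complex)) (at x)"
      by (rule has_vector_derivative_cong_ev)
         (use ab that in \<open>auto intro!: eventually_mono[OF eventually_nhds_in_open[of "-{a..b}" x]]\<close>)
    then have "(\<psi> has_vector_derivative 0) (at x)" by simp
    then show ?thesis using d(2) vector_derivative_unique_at by blast
  qed
  have "\<psi>' \<in> test_functions" using ab d z by (auto simp: test_functions_iff)
  then show thesis using that ab d z by (metis vector_derivative_at)
qed

lemma test_functions_mult:
  "\<psi> \<in> test_functions \<Longrightarrow> smooth m \<Longrightarrow> (\<lambda>x. m x * \<psi> x) \<in> test_functions"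
  unfolding test_functions_iff using smooth_mult[of m \<psi>] by (fastforce simp del: atLeastAtMost_iff)

lemma test_functions_cmult: "\<psi> \<in> test_functions \<Longrightarrow> (\<lambda>x. c * \<psi> x) \<in> test_functions"
  by (rule test_functions_mult) auto

lemma test_functions_add:
  assumes "\<psi> \<in> test_functions" "\<eta> \<in> test_functions"
  shows "(\<lambda>x. \<psi> x + \<eta> x) \<in> test_functions"
proof -
  obtain a b where ab: "smooth \<psi>" "0 < a" "a < b" "\<And>x. x \<notin> {a..b} \<Longrightarrow> \<psi> x = 0"
    using assms by (auto simp: test_functions_iff)
  obtain c d where cd: "smooth \<eta>" "0 < c" "c < d" "\<And>x. x \<notin> {c..d} \<Longrightarrow> \<eta> x = 0"
    using assms by (auto simp: test_functions_iff)
  show ?thesis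
  proof (rule test_functionsI[of _ "min a c" "max b d"])
    show "\<psi> x + \<eta> x = 0" if "x \<notin> {min a c..max b d}" for x
      using that ab(4)[of x] cd(4)[of x] by (auto simp: min_le_iff_disj le_max_iff_disj)
  qed (use ab cd in auto)
qed

lemma test_functions_diff:
  "\<psi> \<in> test_functions \<Longrightarrow> \<eta> \<in> test_functions \<Longrightarrow> (\<lambda>x. \<psi> x - \<eta> x) \<in> test_functions"
  using test_functions_add[OF _ test_functions_cmult[of \<eta> "-1"]] by simp

lemma test_functions_zero: "(\<lambda>_. 0) \<in> test_functions"
  by (rule test_functionsI[of _ 1 2]) auto

text \<open>Since exp (-1/(n y)) increases to 1 for y > 0, these functions approximate the indicator
  of the open interval from below as n grows. The case n = 1 serves as a fixed bump.\<close>

definition interval_bump :: "real \<Rightarrow> real \<Rightarrow> real \<Rightarrow> real \<Rightarrow> real" where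
  "interval_bump a b n x = exp_bump 0 (n * (x - a)) * exp_bump 0 (n * (b - x))"

lemma interval_bump_test:
  assumes "0 < a" "a < b" "n > 0"
  shows "(\<lambda>x. of_real (interval_bump a b n x)) \<in> test_functions"
proof (rule test_functionsI[of _ a b])
  have "smooth (\<lambda>x. of_real (exp_bump 0 (n * x + (- n * a))) * of_real (exp_bump 0 ((-n) * x + n * b)))"
    using smooth_mult[OF smooth_affine[OF smooth_exp_bump[of 0], of n "- n * a"]
        smooth_affine[OF smooth_exp_bump[of 0], of "- n" "n * b"]] by simp
  then show "smooth (\<lambda>x. of_real (interval_bump a b n x))"
    by (simp add: interval_bump_def algebra_simps)
  show "complex_of_real (interval_bump a b n x) = 0" if "x \<notin> {a..b}" for x
    using assms that by (auto simp: interval_bump_def exp_bump_def zero_less_mult_iff)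
qed (use assms in auto)

lemma interval_bump_nonneg: "interval_bump a b n x \<ge> 0"
  by (simp add: interval_bump_def exp_bump_def)

lemma interval_bump_le_1: "interval_bump a b n x \<le> indicator {a..b} x" if "n > 0"
  using that by (auto simp: interval_bump_def exp_bump_def indicator_def zero_less_mult_iff intro!: mult_le_one)

lemma interval_bump_pos: "a < x \<Longrightarrow> x < b \<Longrightarrow> n > 0 \<Longrightarrow> interval_bump a b n x > 0"
  by (simp add: interval_bump_def exp_bump_def)

lemma interval_bump_tendsto:
  "(\<lambda>n. interval_bump a b (real (Suc n)) x) \<longlonglongrightarrow> indicator {a<..<b} x"
proof (cases "a < x \<and> x < b")
  case True
  have *: "(\<lambda>n. exp_bump 0 (real (Suc n) * y)) \<longlonglongrightarrow> 1" if "y > 0" for y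
  proof -
    have "(\<lambda>n. exp (- (1/y) * inverse (real (Suc n)))) \<longlonglongrightarrow> exp (- (1/y) * 0)"
      by (intro tendsto_intros LIMSEQ_inverse_real_of_nat)
    moreover have "exp (- (1/y) * inverse (real (Suc n))) = exp_bump 0 (real (Suc n) * y)" for n
    proof -
      have "0 < real (Suc n) * y" using that by simp
      then show ?thesis using that unfolding exp_bump_def
        by (simp add: divide_inverse mult.commute del: of_nat_Suc)
    qed
    ultimately show ?thesis by simp
  qed
  have "(\<lambda>n. interval_bump a b (real (Suc n)) x) \<longlonglongrightarrow> 1 * 1"
    unfolding interval_bump_def by (intro tendsto_mult *) (use True in auto)
  then show ?thesis using True by (simp add: indicator_def)
next
  case False
  then have "interval_bump a b (real (Suc n)) x = 0" for n
    by (auto simp: interval_bump_def exp_bump_def zero_less_mult_iff simp del: of_nat_Suc)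
  moreover have "indicator {a<..<b} x = (0::real)" using False by (auto simp: indicator_def)
  ultimately show ?thesis by simp
qed

section \<open>The fundamental lemma of the calculus of variations\<close>


lemma sets_Rpos: "{0::real<..} \<inter> space lebesgue \<in> sets lebesgue" by simp

lemma integrable_Rpos_iff:
  fixes f :: "real \<Rightarrow> 'a::{banach, second_countable_topology}"
  shows "integrable Rpos f \<longleftrightarrow> set_integrable lebesgue {0<..} f"
  unfolding set_integrable_def by (rule integrable_restrict_space[OF sets_Rpos])

lemma integral_Rpos_eq:
  fixes f :: "real \<Rightarrow> 'a::{banach, second_countable_topology}"
  shows "(LINT x|Rpos. f x) = (LINT x:{0<..}|lebesgue. f x)"
  unfolding set_lebesgue_integral_def by (rule integral_restrict_space[OF sets_Rpos])

lemma AE_Rpos_iff: "(AE x in Rpos. P x) \<longleftrightarrow> (AE x in lebesgue. 0 < x \<longrightarrow> P x)"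
  using AE_restrict_space_iff[OF sets_Rpos, of P] by simp

text \<open>A countable cover by Borel sets of finite measure survives completion, which does not
  change the measure of Borel sets. The property is required by \<open>density_zero\<close>.\<close>

lemma sigma_finite_lebesgue: "sigma_finite_measure (lebesgue :: real measure)"
proof
  obtain A :: "real set set" where A: "countable A" "A \<subseteq> sets lborel" "\<Union>A = space lborel"
    "\<And>a. a \<in> A \<Longrightarrow> emeasure lborel a \<noteq> \<infinity>"
    using lborel.sigma_finite_countable[where 'a=real] by blast
  show "\<exists>A::real set set. countable A \<and> A \<subseteq> sets lebesgue \<and> \<Union>A = space lebesgue \<and>
      (\<forall>a\<in>A. emeasure lebesgue a \<noteq> \<infinity>)"
  proof (intro exI[of _ A] conjI ballI)
    show "A \<subseteq> sets lebesgue" using A(2) by (meson sets_completionI_sets subset_iff)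
    show "emeasure lebesgue a \<noteq> \<infinity>" if "a \<in> A" for a
    proof -
      have a: "a \<in> sets lborel" using A(2) that by (rule subsetD)
      have "emeasure lebesgue a = emeasure lborel a"
        using a by (subst emeasure_completion) (auto simp: main_part_sets)
      then show ?thesis using A(4)[OF that] by simp
    qed
  qed (use A in auto)
qed

text \<open>Closed intervals are an intersection-stable generator of the Borel sets, so the
  vanishing of integrals extends to Borel sets by Dynkin's theorem, then to Lebesgue sets up to null
  sets; a function with zero integral over every measurable set vanishes almost everywhere.\<close>

lemma AE_zero_if_interval_integrals_zero:
  fixes f :: "real \<Rightarrow> complex"
  assumes f: "integrable lebesgue f" and z: "\<And>a b. (LINT x:{a..b}|lebesgue. f x) = 0"
  shows "AE x in lebesgue. f x = 0"
proof -
  have si: "set_integrable lebesgue A f" if "A \<in> sets lebesgue" for A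
    unfolding set_integrable_def by (rule integrable_mult_indicator[OF that f])
  \<comment> \<open>The integral over the whole line, a limit of interval integrals, is needed to
    treat complements in the Dynkin induction.\<close>
  have lim: "(\<lambda>n. LINT x:{- real n..real n}|lebesgue. f x) \<longlonglongrightarrow> (LINT x|lebesgue. f x)"
    unfolding set_lebesgue_integral_def
  proof (rule integral_dominated_convergence[where w="\<lambda>x. norm (f x)"])
    show "AE x in lebesgue. (\<lambda>n. indicat_real {- real n..real n} x *\<^sub>R f x) \<longlonglongrightarrow> f x"
    proof (rule AE_I2)
      fix x :: real
      obtain N where N: "\<bar>x\<bar> \<le> real N" using real_arch_simple by blast
      have "\<forall>\<^sub>F n in sequentially. indicat_real {- real n..real n} x *\<^sub>R f x = f x"
        using eventually_ge_at_top[of N]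
      proof eventually_elim
        case (elim n)
        then have "real N \<le> real n" by simp
        then have "x \<in> {- real n..real n}" using N by auto
        then show ?case by simp
      qed
      then show "(\<lambda>n. indicat_real {- real n..real n} x *\<^sub>R f x) \<longlonglongrightarrow> f x"
        by (rule tendsto_eventually)
    qed
    show "\<And>n. AE x in lebesgue. norm (indicat_real {- real n..real n} x *\<^sub>R f x) \<le> norm (f x)"
      by (auto simp: indicator_def)
    show "(\<lambda>x. indicat_real {- real n..real n} x *\<^sub>R f x) \<in> borel_measurable lebesgue" for n
      using si[of "{- real n..real n}"] by (simp add: set_integrable_def borel_measurable_integrable)
  qed (use f in auto)
  have f0: "(LINT x|lebesgue. f x) = 0"
    by (rule LIMSEQ_unique[OF lim]) (simp add: z)
  have borel: "(LINT x:A|lebesgue. f x) = 0" if A0: "A \<in> sets borel" for A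
  proof -
    define G where "G = range (\<lambda>(a, b). {a..b::real})"
    have st: "Int_stable G"
      by (auto simp: Int_stable_def G_def)
    have GB: "sigma_sets UNIV G = sets borel"
      unfolding G_def by (subst borel_eq_atLeastAtMost) (rule sets_measure_of[symmetric], simp)
    have A: "A \<in> sigma_sets UNIV G"
      using A0 by (simp only: GB)
    have sub: "B \<in> sets lebesgue" if "B \<in> sigma_sets UNIV G" for B
      using that unfolding GB by (intro sets_completionI_sets) simp
    show ?thesis
    proof (rule sigma_sets_induct_disjoint[OF st _ A, of "\<lambda>A. (LINT x:A|lebesgue. f x) = 0"])
      show "(LINT x:B|lebesgue. f x) = 0" if "B \<in> G" for B using that z by (auto simp: G_def)
      show "(LINT x:{}|lebesgue. f x) = 0" by (simp add: set_lebesgue_integral_def)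
      show "(LINT x:UNIV - B|lebesgue. f x) = 0"
        if "B \<in> sigma_sets UNIV G" "(LINT x:B|lebesgue. f x) = 0" for B
      proof -
        have "(LINT x:(UNIV - B) \<union> B|lebesgue. f x) = (LINT x:UNIV - B|lebesgue. f x) + (LINT x:B|lebesgue. f x)"
          by (rule set_integral_Un) (use sub[OF that(1)] in \<open>auto intro!: si sets.Diff\<close>)
        moreover have "(UNIV - B) \<union> B = UNIV" by blast
        moreover have "(LINT x:UNIV|lebesgue. f x) = 0" using f0 by (simp add: set_lebesgue_integral_def)
        ultimately show ?thesis using that by simp
      qed
      show "(LINT x:(\<Union>i. B i)|lebesgue. f x) = 0"
        if B: "disjoint_family B" "range B \<subseteq> sigma_sets UNIV G" "\<And>i::nat. (LINT x:B i|lebesgue. f x) = 0" for B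
      proof -
        have s: "B i \<in> sets lebesgue" for i using B(2) by (intro sub) blast
        have "(LINT x:(\<Union>i. B i)|lebesgue. f x) = (\<Sum>i. LINT x:B i|lebesgue. f x)"
          by (rule lebesgue_integral_countable_add)
             (use B s in \<open>auto simp: disjoint_family_on_def intro!: si sets.countable_UN\<close>)
        then show ?thesis using B by simp
      qed
    qed (auto simp: G_def)
  qed
  have leb: "(LINT x:A|lebesgue. f x) = 0" if A0: "A \<in> sets lebesgue" for A
  proof -
    obtain S N N' where A: "A = S \<union> N" "N \<subseteq> N'" "N' \<in> null_sets lborel" "S \<in> sets lborel"
      by (rule sets_completionE[OF A0])
    have N: "AE x in lebesgue. x \<notin> N'"
      using A(3) by (intro AE_not_in null_sets_completionI)
    have S: "S \<in> sets lebesgue" using A(4) by (rule sets_completionI_sets)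
    have "(LINT x:A|lebesgue. f x) = (LINT x:S|lebesgue. f x)"
      unfolding set_lebesgue_integral_def
    proof (rule integral_cong_AE)
      show "AE x in lebesgue. indicat_real A x *\<^sub>R f x = indicat_real S x *\<^sub>R f x"
        using N
      proof eventually_elim
        case (elim x)
        then have "x \<in> A \<longleftrightarrow> x \<in> S" using A(1,2) by blast
        then show ?case by (simp add: indicator_def)
      qed
    qed (use si[OF A0] si[OF S] in \<open>auto simp: set_integrable_def\<close>)
    also have "\<dots> = 0" using A by (intro borel) simp
    finally show "(LINT x:A|lebesgue. f x) = 0" .
  qed
  show ?thesis
    by (rule sigma_finite_measure.density_zero[OF sigma_finite_lebesgue f leb])
qed

text \<open>Only intervals away from 0 are tested, so any function continuous on the open half-line
  qualifies, whatever its singularity at 0.\<close>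

definition loc_integrable :: "(real \<Rightarrow> complex) \<Rightarrow> bool" where
  "loc_integrable f \<longleftrightarrow> (\<forall>a b. 0 < a \<longrightarrow> a < b \<longrightarrow> set_integrable lebesgue {a..b} f)"

lemma loc_integrableD: "loc_integrable f \<Longrightarrow> 0 < a \<Longrightarrow> set_integrable lebesgue {a..b} f"
  unfolding loc_integrable_def
  by (rule set_integrable_subset[of _ "{a..a + \<bar>b\<bar> + 1}"]) auto

lemma lebesgue_measurable_continuous:
  "continuous_on UNIV (g :: real \<Rightarrow> 'a::euclidean_space) \<Longrightarrow> g \<in> borel_measurable lebesgue"
  by (intro measurable_completion) (simp add: borel_measurable_continuous_onI)

text \<open>Continuity bounds \<open>g\<close> on the compact interval, and as this interval avoids
  0, the integrals over the half-line and over the whole line agree.\<close>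

lemma loc_integrable_mult:
  assumes f: "loc_integrable f" and g: "continuous_on UNIV g"
    and z: "\<And>x. x \<notin> {a..b} \<Longrightarrow> g x = 0" and a: "0 < a"
  shows "integrable lebesgue (\<lambda>x. f x * g x)" "integrable Rpos (\<lambda>x. f x * g x)"
    "(LINT x|Rpos. f x * g x) = (LINT x|lebesgue. f x * g x)"
proof -
  have "compact (g ` {a..b})" by (rule compact_continuous_image) (use g continuous_on_subset in auto)
  then obtain B where B: "\<And>x. x \<in> {a..b} \<Longrightarrow> norm (g x) \<le> B"
    by (metis compact_imp_bounded bounded_iff imageI)
  have fi: "integrable lebesgue (\<lambda>x. indicator {a..b} x *\<^sub>R f x)"
    using loc_integrableD[OF f a] by (simp add: set_integrable_def)
  have eq: "f x * g x = (indicator {a..b} x *\<^sub>R f x) * g x" for x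
    using z[of x] by (cases "x \<in> {a..b}") auto
  show i: "integrable lebesgue (\<lambda>x. f x * g x)"
  proof (rule Bochner_Integration.integrable_bound[of _ "\<lambda>x. B *\<^sub>R norm (indicator {a..b} x *\<^sub>R f x)"])
    show "integrable lebesgue (\<lambda>x. B *\<^sub>R norm (indicator {a..b} x *\<^sub>R f x))"
      by (intro integrable_scaleR_right integrable_norm fi)
    show "(\<lambda>x. f x * g x) \<in> borel_measurable lebesgue"
      unfolding eq by (intro borel_measurable_times borel_measurable_integrable[OF fi]
          lebesgue_measurable_continuous g)
    have "norm (f x * g x) \<le> norm (B *\<^sub>R norm (indicator {a..b} x *\<^sub>R f x))" for x
    proof (cases "x \<in> {a..b}")
      case True
      have "norm (f x * g x) \<le> norm (f x) * B" unfolding norm_mult using B[OF True] by (intro mult_left_mono) auto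
      also have "\<dots> \<le> norm (B *\<^sub>R norm (indicator {a..b} x *\<^sub>R f x))"
        using True by (simp add: abs_mult mult.commute mult_right_mono)
      finally show ?thesis .
    next
      case False then show ?thesis using z[of x] by simp
    qed
    then show "AE x in lebesgue. norm (f x * g x) \<le> norm (B *\<^sub>R norm (indicator {a..b} x *\<^sub>R f x))"
      by simp
  qed
  have eq2: "indicator {0<..} x *\<^sub>R (f x * g x) = f x * g x" for x
    using z[of x] a by (cases "x \<in> {a..b}") auto
  show "integrable Rpos (\<lambda>x. f x * g x)"
    unfolding integrable_Rpos_iff set_integrable_def eq2 by (rule i)
  show "(LINT x|Rpos. f x * g x) = (LINT x|lebesgue. f x * g x)"
    unfolding integral_Rpos_eq set_lebesgue_integral_def eq2 ..
qed

lemma loc_integrable_mult_test: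
  assumes "loc_integrable f" "\<psi> \<in> test_functions"
  shows "integrable lebesgue (\<lambda>x. f x * \<psi> x)" "integrable Rpos (\<lambda>x. f x * \<psi> x)"
    "(LINT x|Rpos. f x * \<psi> x) = (LINT x|lebesgue. f x * \<psi> x)"
proof -
  obtain a b where ab: "smooth \<psi>" "0 < a" "\<And>x. x \<notin> {a..b} \<Longrightarrow> \<psi> x = 0"
    using test_functionE[OF assms(2)] by metis
  note * = loc_integrable_mult[OF assms(1) smooth_imp_continuous[OF ab(1)] ab(3) ab(2)]
  show "integrable lebesgue (\<lambda>x. f x * \<psi> x)" by (rule *(1))
  show "integrable Rpos (\<lambda>x. f x * \<psi> x)" by (rule *(2))
  show "(LINT x|Rpos. f x * \<psi> x) = (LINT x|lebesgue. f x * \<psi> x)" by (rule *(3))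
qed

text \<open>Testing with \<open>interval_bump a b n\<close> and letting n grow gives zero integrals
  over all intervals with positive left end, by dominated convergence; then
  \<open>AE_zero_if_interval_integrals_zero\<close> applies to truncations.\<close>

lemma fundamental_lemma:
  assumes f: "loc_integrable f"
    and z: "\<And>\<psi>. \<psi> \<in> test_functions \<Longrightarrow> (LINT x|Rpos. f x * \<psi> x) = 0"
  shows "AE x in Rpos. f x = 0"
proof -
  have int0: "(LINT x:{a..b}|lebesgue. f x) = 0" if "0 < a" for a b
  proof (cases "a < b")
    case True
    note ab = that True
    have fi: "integrable lebesgue (\<lambda>x. indicator {a..b} x *\<^sub>R f x)"
      using loc_integrableD[OF f ab(1)] by (simp add: set_integrable_def)
    have lim: "(\<lambda>n. LINT x|lebesgue. f x * of_real (interval_bump a b (real (Suc n)) x))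
        \<longlonglongrightarrow> (LINT x|lebesgue. indicator {a<..<b} x *\<^sub>R f x)"
    proof (rule integral_dominated_convergence[where w="\<lambda>x. norm (indicator {a..b} x *\<^sub>R f x)"])
      show "integrable lebesgue (\<lambda>x. norm (indicat_real {a..b} x *\<^sub>R f x))" by (rule integrable_norm[OF fi])
      show "(\<lambda>x. f x * complex_of_real (interval_bump a b (real (Suc i)) x)) \<in> borel_measurable lebesgue" for i
        by (rule borel_measurable_integrable, rule loc_integrable_mult_test(1)[OF f], rule interval_bump_test[OF ab]) simp
      have "set_integrable lebesgue {a<..<b} f"
        by (rule set_integrable_subset[OF loc_integrableD[OF f ab(1), of b]]) auto
      then show "(\<lambda>x. indicat_real {a<..<b} x *\<^sub>R f x) \<in> borel_measurable lebesgue"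
        by (simp add: set_integrable_def borel_measurable_integrable)
      show "AE x in lebesgue. (\<lambda>i. f x * complex_of_real (interval_bump a b (real (Suc i)) x))
          \<longlonglongrightarrow> indicat_real {a<..<b} x *\<^sub>R f x"
      proof (rule AE_I2)
        fix x
        have "(\<lambda>i. f x * complex_of_real (interval_bump a b (real (Suc i)) x))
          \<longlonglongrightarrow> f x * complex_of_real (indicat_real {a<..<b} x)"
          by (intro tendsto_intros interval_bump_tendsto)
        then show "(\<lambda>i. f x * complex_of_real (interval_bump a b (real (Suc i)) x))
          \<longlonglongrightarrow> indicat_real {a<..<b} x *\<^sub>R f x" by (simp add: scaleR_conv_of_real mult.commute)
      qed
      show "AE x in lebesgue. norm (f x * complex_of_real (interval_bump a b (real (Suc i)) x))
          \<le> norm (indicat_real {a..b} x *\<^sub>R f x)" for i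
      proof (rule AE_I2)
        fix x
        have "norm (f x * complex_of_real (interval_bump a b (real (Suc i)) x)) =
            norm (f x) * interval_bump a b (real (Suc i)) x"
          using interval_bump_nonneg[of a b "real (Suc i)" x] by (simp add: norm_mult del: of_nat_Suc)
        also have "\<dots> \<le> norm (f x) * indicator {a..b} x"
          by (intro mult_left_mono interval_bump_le_1) auto
        finally show "norm (f x * complex_of_real (interval_bump a b (real (Suc i)) x))
          \<le> norm (indicat_real {a..b} x *\<^sub>R f x)" by (simp add: mult.commute)
      qed
    qed
    have "(LINT x|lebesgue. f x * of_real (interval_bump a b (real (Suc n)) x)) = 0" for n
      using z[OF interval_bump_test[OF ab, of "real (Suc n)"]]
        loc_integrable_mult_test(3)[OF f interval_bump_test[OF ab, of "real (Suc n)"]] by simp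
    with lim have "(LINT x|lebesgue. indicator {a<..<b} x *\<^sub>R f x) = 0"
      by (simp add: LIMSEQ_const_iff)
    moreover have "(LINT x:{a..b}|lebesgue. f x) = (LINT x:{a<..<b}|lebesgue. f x)"
    proof (rule set_integral_cong_set)
      have "AE x in lebesgue. x \<noteq> a \<and> x \<noteq> b"
        by (intro AE_conjI AE_completion AE_lborel_singleton)
      then show "AE x in lebesgue. (x \<in> {a<..<b}) = (x \<in> {a..b})" by eventually_elim auto
      show "set_borel_measurable lebesgue {a..b} f"
        using loc_integrableD[OF f ab(1), of b] unfolding set_integrable_def set_borel_measurable_def
        by (rule borel_measurable_integrable)
      have "set_integrable lebesgue {a<..<b} f"
        by (rule set_integrable_subset[OF loc_integrableD[OF f ab(1), of b]]) auto
      then show "set_borel_measurable lebesgue {a<..<b} f"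
        unfolding set_integrable_def set_borel_measurable_def by (rule borel_measurable_integrable)
    qed
    ultimately show ?thesis by (simp add: set_lebesgue_integral_def)
  next
    case False
    have "AE x in lebesgue. x \<noteq> a" by (intro AE_completion AE_lborel_singleton)
    then have "AE x in lebesgue. indicator {a..b} x *\<^sub>R f x = 0"
      by eventually_elim (use False in auto)
    then show ?thesis unfolding set_lebesgue_integral_def by (rule integral_eq_zero_AE)
  qed
  \<comment> \<open>The truncations to \<open>{1 / real (Suc n)..real (Suc n)}\<close> are
    integrable on the line and exhaust the half-line; cutting one with another interval leaves an
    interval whose left end is still positive.\<close>
  have "AE x in lebesgue. \<forall>n. indicator {1 / real (Suc n)..real (Suc n)} x *\<^sub>R f x = 0"
    unfolding AE_all_countable
  proof
    fix n
    show "AE x in lebesgue. indicator {1 / real (Suc n)..real (Suc n)} x *\<^sub>R f x = 0"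
    proof (rule AE_zero_if_interval_integrals_zero)
      show "integrable lebesgue (\<lambda>x. indicat_real {1 / real (Suc n)..real (Suc n)} x *\<^sub>R f x)"
        using loc_integrableD[OF f, of "1 / real (Suc n)" "real (Suc n)"] by (simp add: set_integrable_def)
      fix a b :: real
      have "(\<lambda>x. indicator {a..b} x *\<^sub>R (indicator {1 / real (Suc n)..real (Suc n)} x *\<^sub>R f x))
          = (\<lambda>x. indicator {max a (1 / real (Suc n))..min b (real (Suc n))} x *\<^sub>R f x)"
        by (auto simp: indicator_def fun_eq_iff)
      moreover have "0 < max a (1 / real (Suc n))" by (simp add: less_max_iff_disj)
      ultimately show "(LINT x:{a..b}|lebesgue. indicat_real {1 / real (Suc n)..real (Suc n)} x *\<^sub>R f x) = 0"
        using int0[of "max a (1 / real (Suc n))" "min b (real (Suc n))"]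
        unfolding set_lebesgue_integral_def by (simp only:)
    qed
  qed
  then have "AE x in lebesgue. 0 < x \<longrightarrow> f x = 0"
  proof eventually_elim
    case (elim x)
    show ?case
    proof
      assume "0 < x"
      obtain n where n: "x + 1 / x \<le> real n" using real_arch_simple by blast
      have "0 < 1 / x" using \<open>0 < x\<close> by simp
      have "x \<le> real (Suc n)" "1 / x \<le> real (Suc n)" using n \<open>0 < x\<close> \<open>0 < 1/x\<close> by linarith+
      then have "x \<in> {1 / real (Suc n)..real (Suc n)}"
        using \<open>0 < x\<close> by (auto simp: divide_le_eq mult.commute)
      then show "f x = 0" using elim[rule_format, of n] by simp
    qed
  qed
  then show ?thesis by (simp add: AE_Rpos_iff)
qed

section \<open>The spaces \<open>L\<^sup>2\<close> and \<open>H\<^sup>1\<close>\<close>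


lemma L2I: "u \<in> borel_measurable Rpos \<Longrightarrow> integrable Rpos (\<lambda>x. (cmod (u x))\<^sup>2) \<Longrightarrow> u \<in> L2"
  by (simp add: L2_def)

lemma L2_measurable [measurable_dest]: "u \<in> L2 \<Longrightarrow> u \<in> borel_measurable Rpos"
  by (simp add: L2_def)

lemma L2_integrable: "u \<in> L2 \<Longrightarrow> integrable Rpos (\<lambda>x. (cmod (u x))\<^sup>2)"
  by (simp add: L2_def)

lemma L2_norm_nonneg [simp]: "L2_norm u \<ge> 0"
  by (simp add: L2_norm_def)

lemma L2_norm_sq: "(L2_norm u)\<^sup>2 = (LINT x|Rpos. (cmod (u x))\<^sup>2)"
  by (simp add: L2_norm_def integral_nonneg)

lemma L2_bound:
  assumes u: "u \<in> L2" and v: "v \<in> borel_measurable Rpos" and C: "0 \<le> C"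
    and le: "AE x in Rpos. cmod (v x) \<le> C * cmod (u x)"
  shows "v \<in> L2" "L2_norm v \<le> C * L2_norm u"
proof -
  have le2: "AE x in Rpos. (cmod (v x))\<^sup>2 \<le> C\<^sup>2 * (cmod (u x))\<^sup>2"
    using le
  proof eventually_elim
    case (elim x)
    from power_mono[OF this, of 2] show ?case by (simp add: power_mult_distrib)
  qed
  have i: "integrable Rpos (\<lambda>x. C\<^sup>2 * (cmod (u x))\<^sup>2)"
    by (intro integrable_mult_right L2_integrable u)
  have j: "integrable Rpos (\<lambda>x. (cmod (v x))\<^sup>2)"
    by (rule Bochner_Integration.integrable_bound[OF i]) (use v le2 in auto)
  show "v \<in> L2" using v j by (rule L2I)
  have "(L2_norm v)\<^sup>2 \<le> C\<^sup>2 * (L2_norm u)\<^sup>2"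
    using integral_mono_AE[OF j i le2] by (simp add: L2_norm_sq)
  then show "L2_norm v \<le> C * L2_norm u"
    by (rule power2_le_imp_le[OF _ mult_nonneg_nonneg[OF C L2_norm_nonneg], of "L2_norm v", unfolded power_mult_distrib])
qed

lemma L2_add: assumes "u \<in> L2" "v \<in> L2" shows "(\<lambda>x. u x + v x) \<in> L2"
proof (rule L2I)
  show m: "(\<lambda>x. u x + v x) \<in> borel_measurable Rpos" using assms by (intro borel_measurable_add L2_measurable)
  show "integrable Rpos (\<lambda>x. (cmod (u x + v x))\<^sup>2)"
  proof (rule Bochner_Integration.integrable_bound)
    show "integrable Rpos (\<lambda>x. 2 * (cmod (u x))\<^sup>2 + 2 * (cmod (v x))\<^sup>2)"
      by (intro Bochner_Integration.integrable_add integrable_mult_right L2_integrable assms)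
    have "(cmod (a + b))\<^sup>2 \<le> 2 * (cmod a)\<^sup>2 + 2 * (cmod b)\<^sup>2" for a b
    proof -
      have "(cmod (a + b))\<^sup>2 \<le> (cmod a + cmod b)\<^sup>2" by (intro power_mono norm_triangle_ineq) auto
      also have "\<dots> \<le> 2 * (cmod a)\<^sup>2 + 2 * (cmod b)\<^sup>2"
        using sum_squares_bound[of "cmod a" "cmod b"] by (simp add: power2_sum)
      finally show ?thesis .
    qed
    then show "AE x in Rpos. norm ((cmod (u x + v x))\<^sup>2) \<le> norm (2 * (cmod (u x))\<^sup>2 + 2 * (cmod (v x))\<^sup>2)"
      by simp
  qed (use m in auto)
qed

lemma L2_cmult: assumes "u \<in> L2" shows "(\<lambda>x. c * u x) \<in> L2"
  by (rule L2_bound(1)[OF assms, of _ "cmod c"]) (use assms in \<open>auto simp: norm_mult L2_measurable\<close>)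

lemma L2_norm_cmult: "L2_norm (\<lambda>x. c * u x) = cmod c * L2_norm u"
  by (simp add: L2_norm_def norm_mult power_mult_distrib real_sqrt_mult)

lemma L2_diff: assumes "u \<in> L2" "v \<in> L2" shows "(\<lambda>x. u x - v x) \<in> L2"
  using L2_add[OF assms(1) L2_cmult[OF assms(2), of "-1"]] by simp

lemma L2_zero: "(\<lambda>_. 0) \<in> L2" by (rule L2I) auto

lemma L2_norm_zero [simp]: "L2_norm (\<lambda>_. 0) = 0" by (simp add: L2_norm_def)

lemma L2_norm_cong_AE:
  assumes "u \<in> borel_measurable Rpos" "v \<in> borel_measurable Rpos" "AE x in Rpos. u x = v x"
  shows "L2_norm u = L2_norm v"
proof -
  have "AE x in Rpos. (cmod (u x))\<^sup>2 = (cmod (v x))\<^sup>2" using assms(3) by eventually_elim simp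
  then have "(LINT x|Rpos. (cmod (u x))\<^sup>2) = (LINT x|Rpos. (cmod (v x))\<^sup>2)"
    by (intro integral_cong_AE) (use assms(1,2) in auto)
  then show ?thesis by (simp add: L2_norm_def)
qed

lemma L2_norm_minus_commute: "L2_norm (\<lambda>x. u x - v x) = L2_norm (\<lambda>x. v x - u x)"
  by (simp add: L2_norm_def norm_minus_commute)

lemma L2_prod_integrable:
  assumes "u \<in> L2" "v \<in> L2"
  shows "integrable Rpos (\<lambda>x. cmod (u x) * cmod (v x))" "integrable Rpos (\<lambda>x. u x * v x)"
    "integrable Rpos (\<lambda>x. u x * cnj (v x))"
proof -
  have m: "u \<in> borel_measurable Rpos" "v \<in> borel_measurable Rpos" using assms by (auto dest: L2_measurable)
  have i: "integrable Rpos (\<lambda>x. (cmod (u x))\<^sup>2 + (cmod (v x))\<^sup>2)"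
    by (intro Bochner_Integration.integrable_add L2_integrable assms)
  have b: "cmod a * cmod b \<le> (cmod a)\<^sup>2 + (cmod b)\<^sup>2" for a b
    using sum_squares_bound[of "cmod a" "cmod b"] mult_nonneg_nonneg[OF norm_ge_zero[of a] norm_ge_zero[of b]]
    by linarith
  show "integrable Rpos (\<lambda>x. cmod (u x) * cmod (v x))"
    by (rule Bochner_Integration.integrable_bound[OF i]) (use m b in \<open>auto\<close>)
  show "integrable Rpos (\<lambda>x. u x * v x)"
    by (rule Bochner_Integration.integrable_bound[OF i]) (use m b in \<open>auto simp: norm_mult\<close>)
  have "(\<lambda>x. cnj (v x)) \<in> borel_measurable Rpos"
    using m(2) by (rule measurable_compose) (intro borel_measurable_continuous_onI continuous_intros)
  then show "integrable Rpos (\<lambda>x. u x * cnj (v x))"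
    by (intro Bochner_Integration.integrable_bound[OF i]) (use m b in \<open>auto simp: norm_mult\<close>)
qed

text \<open>The right-hand side is smallest at e = b / a, where it equals a b. It replaces the usual
  discriminant argument for the Cauchy-Schwarz inequality.\<close>

lemma le_prod_if_le_weighted_squares:
  fixes a b I :: real
  assumes ab: "0 \<le> a" "0 \<le> b" and le: "\<And>e. 0 < e \<Longrightarrow> I \<le> (e * a\<^sup>2 + b\<^sup>2 / e) / 2"
  shows "I \<le> a * b"
proof (rule field_le_epsilon)
  fix d :: real assume "0 < d"
  \<comment> \<open>The optimal weight b / a degenerates when a or b is 0. Shifting both by
    \<open>s\<close> costs at most \<open>s * (a + b) / 2\<close>, which this \<open>s\<close> keeps
    below \<open>d\<close>.\<close>
  define s where "s = 2 * d / (a + b + 1)"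
  have s: "0 < s" "s * (a + b) / 2 \<le> d"
    using \<open>0 < d\<close> ab by (auto simp: s_def field_simps)
  define e where "e = (b + s) / (a + s)"
  have e: "0 < e" using ab s by (simp add: e_def)
  have "e * a\<^sup>2 \<le> (b + s) * a"
  proof -
    have "e * a\<^sup>2 = (b + s) * a * (a / (a + s))" by (simp add: e_def power2_eq_square)
    also have "\<dots> \<le> (b + s) * a * 1" using ab s by (intro mult_left_mono) auto
    finally show ?thesis by simp
  qed
  moreover have "b\<^sup>2 / e \<le> b * (a + s)"
  proof -
    have "b\<^sup>2 / e = b * (a + s) * (b / (b + s))" by (simp add: e_def power2_eq_square)
    also have "\<dots> \<le> b * (a + s) * 1" using ab s by (intro mult_left_mono) auto
    finally show ?thesis by simp
  qed
  ultimately have "(e * a\<^sup>2 + b\<^sup>2 / e) / 2 \<le> ((b + s) * a + b * (a + s)) / 2"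
    by (intro divide_right_mono add_mono) simp_all
  with le[OF e] have "I \<le> ((b + s) * a + b * (a + s)) / 2" by (rule order_trans)
  also have "\<dots> = a * b + s * (a + b) / 2" by (simp add: field_simps)
  finally show "I \<le> a * b + d" using s by linarith
qed

text \<open>The pointwise inequality 2 |a| |b| \<le> e |a|^2 + |b|^2 / e is integrated for each
  weight e, and the weight is optimised afterwards.\<close>

lemma L2_Cauchy_Schwarz:
  assumes "u \<in> L2" "v \<in> L2"
  shows "(LINT x|Rpos. cmod (u x) * cmod (v x)) \<le> L2_norm u * L2_norm v"
proof (rule le_prod_if_le_weighted_squares)
  fix e :: real assume e: "0 < e"
  have "cmod a * cmod b \<le> (e * (cmod a)\<^sup>2 + (1 / e) * (cmod b)\<^sup>2) / 2" for a b
  proof -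
    have "2 * (cmod a * cmod b) = 2 * (sqrt e * cmod a) * (cmod b / sqrt e)" using e by simp
    also have "\<dots> \<le> (sqrt e * cmod a)\<^sup>2 + (cmod b / sqrt e)\<^sup>2" by (rule sum_squares_bound)
    also have "\<dots> = e * (cmod a)\<^sup>2 + (1 / e) * (cmod b)\<^sup>2" using e by (simp add: power_mult_distrib power_divide)
    finally show ?thesis by simp
  qed
  then have "(LINT x|Rpos. cmod (u x) * cmod (v x)) \<le> (LINT x|Rpos. (e * (cmod (u x))\<^sup>2 + (1 / e) * (cmod (v x))\<^sup>2) / 2)"
    by (intro integral_mono L2_prod_integrable assms integrable_divide
        Bochner_Integration.integrable_add integrable_mult_right L2_integrable)
  also have "\<dots> = (e * (L2_norm u)\<^sup>2 + (1 / e) * (L2_norm v)\<^sup>2) / 2"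
  proof -
    have "integrable Rpos (\<lambda>x. e * (cmod (u x))\<^sup>2)" "integrable Rpos (\<lambda>x. (1 / e) * (cmod (v x))\<^sup>2)"
      by (intro integrable_mult_right L2_integrable assms)+
    from Bochner_Integration.integral_add[OF this] show ?thesis
      unfolding L2_norm_sq integral_divide_zero by simp
  qed
  finally show "(LINT x|Rpos. cmod (u x) * cmod (v x)) \<le> (e * (L2_norm u)\<^sup>2 + (L2_norm v)\<^sup>2 / e) / 2"
    by simp
qed auto

lemma L2_inner_bound:
  assumes "u \<in> L2" "v \<in> L2"
  shows "cmod (L2_inner u v) \<le> L2_norm u * L2_norm v"
proof -
  have "cmod (L2_inner u v) \<le> (LINT x|Rpos. cmod (u x * cnj (v x)))"
    unfolding L2_inner_def by (rule integral_norm_bound)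
  also have "\<dots> = (LINT x|Rpos. cmod (u x) * cmod (v x))" by (simp add: norm_mult)
  also have "\<dots> \<le> L2_norm u * L2_norm v" by (rule L2_Cauchy_Schwarz[OF assms])
  finally show ?thesis .
qed

lemma L2_norm_triangle:
  assumes "u \<in> L2" "v \<in> L2"
  shows "L2_norm (\<lambda>x. u x + v x) \<le> L2_norm u + L2_norm v"
proof (rule power2_le_imp_le)
  have "(L2_norm (\<lambda>x. u x + v x))\<^sup>2 \<le> (LINT x|Rpos. (cmod (u x))\<^sup>2 + (cmod (v x))\<^sup>2 + 2 * (cmod (u x) * cmod (v x)))"
    unfolding L2_norm_sq
  proof (rule integral_mono)
    show "(cmod (u x + v x))\<^sup>2 \<le> (cmod (u x))\<^sup>2 + (cmod (v x))\<^sup>2 + 2 * (cmod (u x) * cmod (v x))" for x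
    proof -
      have "(cmod (u x + v x))\<^sup>2 \<le> (cmod (u x) + cmod (v x))\<^sup>2" by (intro power_mono norm_triangle_ineq) auto
      then show ?thesis by (simp add: power2_sum)
    qed
    show "integrable Rpos (\<lambda>x. (cmod (u x + v x))\<^sup>2)" by (rule L2_integrable[OF L2_add[OF assms]])
    show "integrable Rpos (\<lambda>x. (cmod (u x))\<^sup>2 + (cmod (v x))\<^sup>2 + 2 * (cmod (u x) * cmod (v x)))"
      by (rule Bochner_Integration.integrable_add[OF Bochner_Integration.integrable_add[OF
            L2_integrable[OF assms(1)] L2_integrable[OF assms(2)]]
            integrable_mult_right[OF L2_prod_integrable(1)[OF assms]]])
  qed
  also have "\<dots> = (L2_norm u)\<^sup>2 + (L2_norm v)\<^sup>2 + 2 * (LINT x|Rpos. cmod (u x) * cmod (v x))"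
    unfolding L2_norm_sq
    by (simp add: L2_integrable L2_prod_integrable assms)
  also have "\<dots> \<le> (L2_norm u + L2_norm v)\<^sup>2"
    using L2_Cauchy_Schwarz[OF assms] by (simp add: power2_sum)
  finally show "(L2_norm (\<lambda>x. u x + v x))\<^sup>2 \<le> (L2_norm u + L2_norm v)\<^sup>2" .
qed simp

lemma L2_norm_triangle_diff:
  assumes "u \<in> L2" "v \<in> L2"
  shows "L2_norm (\<lambda>x. u x - v x) \<le> L2_norm u + L2_norm v"
  using L2_norm_triangle[OF assms(1) L2_cmult[OF assms(2), of "-1"]] L2_norm_cmult[of "-1" v] by simp

lemma L2_norm_abs_diff:
  assumes "u \<in> L2" "v \<in> L2"
  shows "\<bar>L2_norm u - L2_norm v\<bar> \<le> L2_norm (\<lambda>x. u x - v x)"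
  using L2_norm_triangle[OF L2_diff[OF assms] assms(2)] L2_norm_triangle[OF L2_diff[OF assms(2,1)] assms(1)]
    L2_norm_minus_commute[of u v] by auto

lemma L2_norm_eq_0_iff:
  assumes "u \<in> L2" shows "L2_norm u = 0 \<longleftrightarrow> (AE x in Rpos. u x = 0)"
proof -
  have "L2_norm u = 0 \<longleftrightarrow> (LINT x|Rpos. (cmod (u x))\<^sup>2) = 0" by (simp add: L2_norm_def)
  also have "\<dots> \<longleftrightarrow> (AE x in Rpos. (cmod (u x))\<^sup>2 = 0)"
    by (rule integral_nonneg_eq_0_iff_AE[OF L2_integrable[OF assms]]) simp
  finally show ?thesis by simp
qed

lemma L2_inner_diff_left:
  assumes "u \<in> L2" "v \<in> L2" "w \<in> L2"
  shows "L2_inner (\<lambda>x. u x - v x) w = L2_inner u w - L2_inner v w"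
  unfolding L2_inner_def by (simp add: left_diff_distrib L2_prod_integrable assms)

lemma L2_inner_diff_right:
  assumes "u \<in> L2" "v \<in> L2" "w \<in> L2"
  shows "L2_inner u (\<lambda>x. v x - w x) = L2_inner u v - L2_inner u w"
  unfolding L2_inner_def by (simp add: right_diff_distrib L2_prod_integrable assms)

lemma L2_inner_cmult_left: "L2_inner (\<lambda>x. c * u x) w = c * L2_inner u w"
  unfolding L2_inner_def by (simp add: mult.assoc)

lemma L2_inner_cmult_right: "L2_inner u (\<lambda>x. c * w x) = cnj c * L2_inner u w"
  unfolding L2_inner_def by (simp add: mult.left_commute)

lemma L2_inner_self: "L2_inner u u = of_real ((L2_norm u)\<^sup>2)"
  unfolding L2_inner_def L2_norm_sq complex_norm_square[symmetric] by (rule integral_complex_of_real)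

lemma L2_inner_commute: "L2_inner v u = cnj (L2_inner u v)"
  using Bochner_Integration.integral_cnj[of Rpos "\<lambda>x. u x * cnj (v x)"] by (simp add: L2_inner_def mult.commute)

lemma L2_loc_integrable:
  assumes "u \<in> L2" shows "loc_integrable u"
  unfolding loc_integrable_def
proof (intro allI impI)
  fix a b :: real assume ab: "0 < a" "a < b"
  have m: "(\<lambda>x. indicator {0<..} x *\<^sub>R u x) \<in> borel_measurable lebesgue"
    using L2_measurable[OF assms] borel_measurable_restrict_space_iff[OF sets_Rpos, of u] by simp
  have i: "integrable lebesgue (\<lambda>x. indicator {0<..} x *\<^sub>R (cmod (u x))\<^sup>2)"
    using L2_integrable[OF assms] by (simp add: integrable_Rpos_iff set_integrable_def)
  have eq: "indicator {a..b} x *\<^sub>R u x = indicator {a..b} x *\<^sub>R (indicator {0<..} x *\<^sub>R u x)" for x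
    using ab by (auto simp: indicator_def)
  have "integrable lebesgue (\<lambda>x. indicator {a..b} x *\<^sub>R u x)"
  proof (rule Bochner_Integration.integrable_bound)
    show "integrable lebesgue (\<lambda>x. indicat_real {a..b} x + indicator {0<..} x *\<^sub>R (cmod (u x))\<^sup>2)"
      by (intro Bochner_Integration.integrable_add i) (use ab in \<open>simp add: integrable_indicator_iff\<close>)
    show "(\<lambda>x. indicator {a..b} x *\<^sub>R u x) \<in> borel_measurable lebesgue"
      unfolding eq by (intro borel_measurable_scaleR m borel_measurable_indicator) simp
    have "cmod z \<le> 1 + (cmod z)\<^sup>2" for z
      using sum_squares_bound[of "cmod z" 1] norm_ge_zero[of z] unfolding power2_eq_square by linarith
    then show "AE x in lebesgue. norm (indicator {a..b} x *\<^sub>R u x)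
        \<le> norm (indicat_real {a..b} x + indicator {0<..} x *\<^sub>R (cmod (u x))\<^sup>2)"
      using ab by (intro AE_I2) (auto simp: indicator_def)
  qed
  then show "set_integrable lebesgue {a..b} u" by (simp add: set_integrable_def)
qed

section \<open>Weak derivatives and H1\<close>

lemma has_weak_deriv_unique:
  assumes "has_weak_deriv u v" "has_weak_deriv u w" "v \<in> L2" "w \<in> L2"
  shows "AE x in Rpos. v x = w x"
proof -
  have "AE x in Rpos. v x - w x = 0"
  proof (rule fundamental_lemma)
    show "loc_integrable (\<lambda>x. v x - w x)" by (intro L2_loc_integrable L2_diff assms)
    fix \<psi> assume \<psi>: "\<psi> \<in> test_functions"
    have "(LINT x|Rpos. (v x - w x) * \<psi> x) = (LINT x|Rpos. v x * \<psi> x) - (LINT x|Rpos. w x * \<psi> x)"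
      using loc_integrable_mult_test(2)[OF L2_loc_integrable \<psi>] assms(3,4)
      by (simp add: left_diff_distrib)
    also have "\<dots> = 0"
      using assms(1,2) \<psi> unfolding has_weak_deriv_def by (metis add.inverse_inverse cancel_comm_monoid_add_class.diff_cancel)
    finally show "(LINT x|Rpos. (v x - w x) * \<psi> x) = 0" .
  qed
  then show ?thesis by simp
qed

lemma weak_deriv:
  assumes "u \<in> H1" shows "weak_deriv u \<in> L2" "has_weak_deriv u (weak_deriv u)"
proof -
  have "\<exists>v. v \<in> L2 \<and> has_weak_deriv u v" using assms by (auto simp: H1_def)
  from someI_ex[OF this] show "weak_deriv u \<in> L2" "has_weak_deriv u (weak_deriv u)"
    by (auto simp: weak_deriv_def)
qed

lemma H1_L2: "u \<in> H1 \<Longrightarrow> u \<in> L2" by (simp add: H1_def)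

text \<open>\<open>weak_deriv\<close> is an arbitrary choice in a class modulo null sets. This is
  the way in which an explicit candidate is identified with it, and hence how every norm of a weak
  derivative is computed.\<close>

lemma weak_deriv_eqI:
  assumes "u \<in> L2" "v \<in> L2" "has_weak_deriv u v"
  shows "u \<in> H1" "AE x in Rpos. weak_deriv u x = v x" "L2_norm (weak_deriv u) = L2_norm v"
proof -
  show u: "u \<in> H1" using assms by (auto simp: H1_def)
  show ae: "AE x in Rpos. weak_deriv u x = v x"
    by (rule has_weak_deriv_unique[OF weak_deriv(2)[OF u] assms(3) weak_deriv(1)[OF u] assms(2)])
  show "L2_norm (weak_deriv u) = L2_norm v"
    by (rule L2_norm_cong_AE[OF L2_measurable[OF weak_deriv(1)[OF u]] L2_measurable[OF assms(2)] ae])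
qed

lemma has_weak_derivD:
  assumes "has_weak_deriv u v" "\<psi> \<in> test_functions" "\<And>x. (\<psi> has_vector_derivative \<psi>' x) (at x)"
  shows "(LINT x|Rpos. u x * \<psi>' x) = - (LINT x|Rpos. v x * \<psi> x)"
  using bspec[OF assms(1)[unfolded has_weak_deriv_def] assms(2)]
  unfolding vector_derivative_at[OF assms(3)] .

lemma has_weak_deriv_add:
  assumes "loc_integrable u" "loc_integrable u'" "loc_integrable v" "loc_integrable v'"
    "has_weak_deriv u u'" "has_weak_deriv v v'"
  shows "has_weak_deriv (\<lambda>x. u x + v x) (\<lambda>x. u' x + v' x)"
  unfolding has_weak_deriv_def
proof
  fix \<psi> assume \<psi>: "\<psi> \<in> test_functions"
  obtain \<psi>' where \<psi>': "\<psi>' \<in> test_functions" "\<And>x. (\<psi> has_vector_derivative \<psi>' x) (at x)"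
    using test_functionE[OF \<psi>] by metis
  have vd: "vector_derivative \<psi> (at x) = \<psi>' x" for x by (rule vector_derivative_at[OF \<psi>'(2)])
  note i = loc_integrable_mult_test(2)
  show "(LINT x|Rpos. (u x + v x) * vector_derivative \<psi> (at x)) = - (LINT x|Rpos. (u' x + v' x) * \<psi> x)"
    unfolding vd distrib_right
    by (simp add: i[OF assms(1) \<psi>'(1)] i[OF assms(3) \<psi>'(1)] i[OF assms(2) \<psi>] i[OF assms(4) \<psi>]
        has_weak_derivD[OF assms(5) \<psi> \<psi>'(2)] has_weak_derivD[OF assms(6) \<psi> \<psi>'(2)])
qed

lemma has_weak_deriv_cmult:
  assumes "has_weak_deriv u u'"
  shows "has_weak_deriv (\<lambda>x. c * u x) (\<lambda>x. c * u' x)"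
  using assms unfolding has_weak_deriv_def by (simp add: mult.assoc)

lemma H1_add:
  assumes "u \<in> H1" "v \<in> H1"
  shows "(\<lambda>x. u x + v x) \<in> H1" "AE x in Rpos. weak_deriv (\<lambda>x. u x + v x) x = weak_deriv u x + weak_deriv v x"
    "L2_norm (weak_deriv (\<lambda>x. u x + v x)) = L2_norm (\<lambda>x. weak_deriv u x + weak_deriv v x)"
proof -
  note w = weak_deriv[OF assms(1)] weak_deriv[OF assms(2)]
  have "has_weak_deriv (\<lambda>x. u x + v x) (\<lambda>x. weak_deriv u x + weak_deriv v x)"
    by (intro has_weak_deriv_add L2_loc_integrable H1_L2 assms w)
  note * = weak_deriv_eqI[OF L2_add[OF H1_L2[OF assms(1)] H1_L2[OF assms(2)]] L2_add[OF w(1,3)] this]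
  show "(\<lambda>x. u x + v x) \<in> H1" by (rule *)
  show "AE x in Rpos. weak_deriv (\<lambda>x. u x + v x) x = weak_deriv u x + weak_deriv v x" by (rule *)
  show "L2_norm (weak_deriv (\<lambda>x. u x + v x)) = L2_norm (\<lambda>x. weak_deriv u x + weak_deriv v x)" by (rule *)
qed

lemma H1_cmult:
  assumes "u \<in> H1"
  shows "(\<lambda>x. c * u x) \<in> H1" "AE x in Rpos. weak_deriv (\<lambda>x. c * u x) x = c * weak_deriv u x"
    "L2_norm (weak_deriv (\<lambda>x. c * u x)) = L2_norm (\<lambda>x. c * weak_deriv u x)"
proof -
  note * = weak_deriv_eqI[OF L2_cmult[OF H1_L2[OF assms], of c] L2_cmult[OF weak_deriv(1)[OF assms], of c]
      has_weak_deriv_cmult[OF weak_deriv(2)[OF assms], of c]]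
  show "(\<lambda>x. c * u x) \<in> H1" by (rule *)
  show "AE x in Rpos. weak_deriv (\<lambda>x. c * u x) x = c * weak_deriv u x" by (rule *)
  show "L2_norm (weak_deriv (\<lambda>x. c * u x)) = L2_norm (\<lambda>x. c * weak_deriv u x)" by (rule *)
qed

lemma H1_diff:
  assumes "u \<in> H1" "v \<in> H1"
  shows "(\<lambda>x. u x - v x) \<in> H1" "AE x in Rpos. weak_deriv (\<lambda>x. u x - v x) x = weak_deriv u x - weak_deriv v x"
    "L2_norm (weak_deriv (\<lambda>x. u x - v x)) = L2_norm (\<lambda>x. weak_deriv u x - weak_deriv v x)"
proof -
  have "has_weak_deriv (\<lambda>x. u x + (-1) * v x) (\<lambda>x. weak_deriv u x + (-1) * weak_deriv v x)"
    by (intro has_weak_deriv_add has_weak_deriv_cmult L2_loc_integrable L2_cmult H1_L2 assms weak_deriv)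
  then have "has_weak_deriv (\<lambda>x. u x - v x) (\<lambda>x. weak_deriv u x - weak_deriv v x)" by simp
  note * = weak_deriv_eqI[OF L2_diff[OF H1_L2[OF assms(1)] H1_L2[OF assms(2)]]
     L2_diff[OF weak_deriv(1)[OF assms(1)] weak_deriv(1)[OF assms(2)]] this]
  show "(\<lambda>x. u x - v x) \<in> H1" by (rule *)
  show "AE x in Rpos. weak_deriv (\<lambda>x. u x - v x) x = weak_deriv u x - weak_deriv v x" by (rule *)
  show "L2_norm (weak_deriv (\<lambda>x. u x - v x)) = L2_norm (\<lambda>x. weak_deriv u x - weak_deriv v x)" by (rule *)
qed

lemma H1_norm_nonneg [simp]: "H1_norm u \<ge> 0" by (simp add: H1_norm_def)

lemma L2_norm_le_H1_norm: "L2_norm u \<le> H1_norm u"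
  unfolding H1_norm_def by (rule real_le_rsqrt) simp

lemma L2_norm_weak_deriv_le: "L2_norm (weak_deriv u) \<le> H1_norm u"
  unfolding H1_norm_def by (rule real_le_rsqrt) simp

lemma H1_norm_le: "H1_norm u \<le> L2_norm u + L2_norm (weak_deriv u)"
  unfolding H1_norm_def by (rule real_le_lsqrt) (simp_all add: power2_sum)

lemma H1_norm_triangle:
  assumes "u \<in> H1" "v \<in> H1"
  shows "H1_norm (\<lambda>x. u x + v x) \<le> H1_norm u + H1_norm v"
proof -
  have "H1_norm (\<lambda>x. u x + v x) \<le> sqrt ((L2_norm u + L2_norm v)\<^sup>2 + (L2_norm (weak_deriv u) + L2_norm (weak_deriv v))\<^sup>2)"
    unfolding H1_norm_def H1_add(3)[OF assms]
    by (intro real_sqrt_le_mono add_mono power_mono L2_norm_triangle H1_L2 weak_deriv assms L2_norm_nonneg)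
  also have "\<dots> \<le> H1_norm u + H1_norm v"
    unfolding H1_norm_def by (rule real_sqrt_sum_squares_triangle_ineq)
  finally show ?thesis .
qed

lemma H1_norm_cmult:
  assumes "u \<in> H1" shows "H1_norm (\<lambda>x. c * u x) = cmod c * H1_norm u"
  unfolding H1_norm_def H1_cmult(3)[OF assms] L2_norm_cmult power_mult_distrib distrib_left[symmetric]
  by (simp add: real_sqrt_mult)

lemma H1_norm_triangle_diff:
  assumes "u \<in> H1" "v \<in> H1"
  shows "H1_norm (\<lambda>x. u x - v x) \<le> H1_norm u + H1_norm v"
  using H1_norm_triangle[OF assms(1) H1_cmult(1)[OF assms(2), of "-1"]] H1_norm_cmult[OF assms(2), of "-1"] by simp

lemma H1_norm_minus_commute:
  assumes "u \<in> H1" "v \<in> H1"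
  shows "H1_norm (\<lambda>x. u x - v x) = H1_norm (\<lambda>x. v x - u x)"
  using H1_norm_cmult[OF H1_diff(1)[OF assms], of "-1"] by simp

lemma H1_norm_abs_diff:
  assumes "u \<in> H1" "v \<in> H1"
  shows "\<bar>H1_norm u - H1_norm v\<bar> \<le> H1_norm (\<lambda>x. u x - v x)"
  using H1_norm_triangle[OF H1_diff(1)[OF assms] assms(2)] H1_norm_triangle[OF H1_diff(1)[OF assms(2,1)] assms(1)]
    H1_norm_minus_commute[OF assms] by auto

lemma H1_norm_zero [simp]: "H1_norm (\<lambda>_. 0) = 0"
proof -
  have "has_weak_deriv (\<lambda>_. 0) (\<lambda>_. 0)" by (simp add: has_weak_deriv_def)
  then have "L2_norm (weak_deriv (\<lambda>_. 0)) = 0"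
    using weak_deriv_eqI(3)[OF L2_zero L2_zero] by simp
  then show ?thesis by (simp add: H1_norm_def)
qed

section \<open>Hardy and Sobolev inequalities in \<open>H\<^sup>1\<^sub>0\<close>\<close>


lemma loc_integrable_continuous:
  assumes "continuous_on {0<..} f" shows "loc_integrable f"
  unfolding loc_integrable_def
proof (intro allI impI)
  fix a b :: real assume "0 < a" "a < b"
  then have "continuous_on {a..b} f" by (intro continuous_on_subset[OF assms]) auto
  then show "set_integrable lebesgue {a..b} f" by (rule absolutely_integrable_continuous_real)
qed

lemma continuous_measurable_Rpos:
  fixes f :: "real \<Rightarrow> 'a::euclidean_space"
  assumes "continuous_on {0<..} f" shows "f \<in> borel_measurable Rpos"
  by (rule continuous_imp_measurable_on_sets_lebesgue[OF assms]) simp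

text \<open>The fundamental theorem of calculus for a primitive that vanishes at both ends. The
  integrations by parts in \<open>classical_weak_deriv\<close> and \<open>hardy_test\<close> reduce
  to it.\<close>

lemma integral_Rpos_derivative_zero:
  fixes G g :: "real \<Rightarrow> complex"
  assumes G: "\<And>x. 0 < x \<Longrightarrow> (G has_vector_derivative g x) (at x)" and g: "continuous_on {0<..} g"
    and ab: "0 < a" "a < b" and z: "\<And>x. x \<notin> {a..b} \<Longrightarrow> G x = 0" "\<And>x. x \<notin> {a..b} \<Longrightarrow> g x = 0"
  shows "integrable Rpos g" "(LINT x|Rpos. g x) = 0"
proof -
  \<comment> \<open>\<open>G\<close> is known to vanish only off the closed interval, so the
    interval is enlarged on both sides, with the left end still positive.\<close>
  define a' b' where "a' = a / 2" and "b' = b + 1"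
  have ab': "0 < a'" "a' < a" "b < b'" using ab by (auto simp: a'_def b'_def)
  have si: "set_integrable lebesgue {a'..b'} g"
    using loc_integrable_continuous[OF g] ab ab' by (simp add: loc_integrableD)
  have eq: "indicator {0<..} x *\<^sub>R g x = indicator {a'..b'} x *\<^sub>R g x" for x
    using z(2)[of x] ab ab' by (cases "x \<in> {a..b}") (auto simp: indicator_def)
  show "integrable Rpos g"
    using si unfolding integrable_Rpos_iff set_integrable_def eq .
  have "(LINT x|Rpos. g x) = (LINT x:{a'..b'}|lebesgue. g x)"
    unfolding integral_Rpos_eq set_lebesgue_integral_def eq ..
  also have "\<dots> = integral {a'..b'} g" by (rule set_lebesgue_integral_eq_integral[OF si])
  also have "\<dots> = G b' - G a'"
    by (intro integral_unique fundamental_theorem_of_calculus)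
       (use ab ab' in \<open>auto intro!: has_vector_derivative_at_within[OF G]\<close>)
  also have "\<dots> = 0" using z(1)[of a'] z(1)[of b'] ab ab' by simp
  finally show "(LINT x|Rpos. g x) = 0" .
qed

text \<open>Test functions vanish near 0, so no control of \<open>f\<close> or \<open>f'\<close> at
  0 enters; this matters for \<phi>', which may be singular there.\<close>

lemma classical_weak_deriv:
  assumes f: "\<And>x. 0 < x \<Longrightarrow> (f has_vector_derivative f' x) (at x)" and f': "continuous_on {0<..} f'"
  shows "has_weak_deriv f f'"
  unfolding has_weak_deriv_def
proof
  fix \<psi> assume \<psi>: "\<psi> \<in> test_functions"
  obtain \<psi>' a b where t: "0 < a" "a < b" "smooth \<psi>" "\<psi>' \<in> test_functions"
    "\<And>x. x \<notin> {a..b} \<Longrightarrow> \<psi> x = 0" "\<And>x. x \<notin> {a..b} \<Longrightarrow> \<psi>' x = 0"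
    "\<And>x. (\<psi> has_vector_derivative \<psi>' x) (at x)" "\<And>x. vector_derivative \<psi> (at x) = \<psi>' x"
    using test_functionE[OF \<psi>] by metis
  have "smooth \<psi>'" using t(4) by (simp add: test_functions_iff)
  have cf: "continuous_on {0<..} f"
    by (intro continuous_at_imp_continuous_on ballI has_vector_derivative_continuous[OF f]) simp
  have "((\<lambda>x. f x * \<psi> x) has_vector_derivative f x * \<psi>' x + f' x * \<psi> x) (at x)" if "0 < x" for x
    by (rule has_vector_derivative_mult[OF f[OF that] t(7)])
  moreover have "continuous_on {0<..} (\<lambda>x. f x * \<psi>' x + f' x * \<psi> x)"
    by (intro continuous_intros cf f' smooth_imp_continuous \<open>smooth \<psi>'\<close> \<open>smooth \<psi>\<close>)
  ultimately have "(LINT x|Rpos. f x * \<psi>' x + f' x * \<psi> x) = 0"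
    by (rule integral_Rpos_derivative_zero(2)[where a=a and b=b]) (use t(1,2,5,6) in auto)
  moreover have "(LINT x|Rpos. f x * \<psi>' x + f' x * \<psi> x) = (LINT x|Rpos. f x * \<psi>' x) + (LINT x|Rpos. f' x * \<psi> x)"
    by (intro Bochner_Integration.integral_add loc_integrable_mult_test(2) loc_integrable_continuous cf f' t(4) \<psi>)
  ultimately show "(LINT x|Rpos. f x * vector_derivative \<psi> (at x)) = - (LINT x|Rpos. f' x * \<psi> x)"
    unfolding t(8) by (simp add: eq_neg_iff_add_eq_0)
qed

lemma test_L2: assumes "\<psi> \<in> test_functions" shows "\<psi> \<in> L2"
proof (rule L2I)
  have c: "continuous_on A \<psi>" for A using assms smooth_imp_continuous by (auto simp: test_functions_iff)
  show "\<psi> \<in> borel_measurable Rpos" by (rule continuous_measurable_Rpos[OF c])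
  have "loc_integrable (\<lambda>x. cnj (\<psi> x))" by (intro loc_integrable_continuous continuous_on_cnj c)
  from loc_integrable_mult_test(2)[OF this assms]
  have "integrable Rpos (\<lambda>x. complex_of_real ((cmod (\<psi> x))\<^sup>2))"
    by (simp only: complex_norm_square mult.commute)
  then show "integrable Rpos (\<lambda>x. (cmod (\<psi> x))\<^sup>2)" by (simp only: complex_of_real_integrable_eq)
qed

lemma test_H1:
  assumes "\<psi> \<in> test_functions" "\<psi>' \<in> test_functions" "\<And>x. (\<psi> has_vector_derivative \<psi>' x) (at x)"
  shows "\<psi> \<in> H1" "AE x in Rpos. weak_deriv \<psi> x = \<psi>' x" "L2_norm (weak_deriv \<psi>) = L2_norm \<psi>'"
proof -
  have "has_weak_deriv \<psi> \<psi>'"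
    using assms(2) by (intro classical_weak_deriv assms(3)) (auto simp: test_functions_iff smooth_imp_continuous)
  note * = weak_deriv_eqI[OF test_L2[OF assms(1)] test_L2[OF assms(2)] this]
  show "\<psi> \<in> H1" by (rule *)
  show "AE x in Rpos. weak_deriv \<psi> x = \<psi>' x" by (rule *)
  show "L2_norm (weak_deriv \<psi>) = L2_norm \<psi>'" by (rule *)
qed

lemma test_in_H1: "\<psi> \<in> test_functions \<Longrightarrow> \<psi> \<in> H1"
  using test_functionE test_H1(1) by metis

section \<open>The closed subspace H10, Sobolev and Hardy inequalities\<close>

lemma test_H10: assumes "\<psi> \<in> test_functions" shows "\<psi> \<in> H10"
  unfolding H10_def using test_in_H1[OF assms] by (auto intro!: bexI[OF _ assms])

lemma H10_H1: "u \<in> H10 \<Longrightarrow> u \<in> H1" by (simp add: H10_def)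

lemma H10_L2: "u \<in> H10 \<Longrightarrow> u \<in> L2" by (simp add: H10_H1 H1_L2)

lemma H10_approx:
  assumes "u \<in> H10" "0 < e" obtains \<psi> where "\<psi> \<in> test_functions" "H1_norm (\<lambda>x. u x - \<psi> x) < e"
  using assms unfolding H10_def by blast

text \<open>A closure is closed, by halving e. Approximants may then be taken from
  \<open>H10\<close> instead of the test functions, which is what multipliers and regularisations
  provide.\<close>

lemma H10_closed:
  assumes u: "u \<in> H1" and "\<And>e. 0 < e \<Longrightarrow> \<exists>w\<in>H10. H1_norm (\<lambda>x. u x - w x) < e"
  shows "u \<in> H10"
  unfolding H10_def
proof (intro CollectI conjI allI impI u)
  fix e :: real assume e: "0 < e"
  obtain w where w: "w \<in> H10" "H1_norm (\<lambda>x. u x - w x) < e / 2" using assms(2)[of "e/2"] e by auto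
  obtain \<psi> where \<psi>: "\<psi> \<in> test_functions" "H1_norm (\<lambda>x. w x - \<psi> x) < e / 2"
    using H10_approx[OF w(1), of "e/2"] e by auto
  have "H1_norm (\<lambda>x. (u x - w x) + (w x - \<psi> x)) \<le> H1_norm (\<lambda>x. u x - w x) + H1_norm (\<lambda>x. w x - \<psi> x)"
    by (intro H1_norm_triangle H1_diff(1) u H10_H1 w(1) test_in_H1 \<psi>(1))
  then show "\<exists>\<psi>\<in>test_functions. H1_norm (\<lambda>x. u x - \<psi> x) < e"
    using w(2) \<psi> by (intro bexI[OF _ \<psi>(1)]) simp
qed

lemma H10_add: assumes "u \<in> H10" "v \<in> H10" shows "(\<lambda>x. u x + v x) \<in> H10"
  unfolding H10_def
proof (intro CollectI conjI allI impI H1_add(1) H10_H1 assms)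
  fix e :: real assume e: "0 < e"
  obtain \<psi> where \<psi>: "\<psi> \<in> test_functions" "H1_norm (\<lambda>x. u x - \<psi> x) < e / 2"
    using H10_approx[OF assms(1), of "e/2"] e by auto
  obtain \<eta> where \<eta>: "\<eta> \<in> test_functions" "H1_norm (\<lambda>x. v x - \<eta> x) < e / 2"
    using H10_approx[OF assms(2), of "e/2"] e by auto
  have "H1_norm (\<lambda>x. (u x - \<psi> x) + (v x - \<eta> x)) \<le> H1_norm (\<lambda>x. u x - \<psi> x) + H1_norm (\<lambda>x. v x - \<eta> x)"
    by (intro H1_norm_triangle H1_diff(1) H10_H1 assms test_in_H1 \<psi>(1) \<eta>(1))
  moreover have "(\<lambda>x. (u x - \<psi> x) + (v x - \<eta> x)) = (\<lambda>x. u x + v x - (\<psi> x + \<eta> x))" by auto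
  ultimately show "\<exists>\<psi>\<in>test_functions. H1_norm (\<lambda>x. u x + v x - \<psi> x) < e"
    using \<psi>(2) \<eta>(2) by (intro bexI[OF _ test_functions_add[OF \<psi>(1) \<eta>(1)]]) simp
qed

lemma H10_cmult: assumes "u \<in> H10" shows "(\<lambda>x. c * u x) \<in> H10"
  unfolding H10_def
proof (intro CollectI conjI allI impI H1_cmult(1) H10_H1 assms)
  fix e :: real assume e: "0 < e"
  define d where "d = e / (cmod c + 1)"
  have "0 < cmod c + 1" using norm_ge_zero[of c] by linarith
  then have d: "0 < d" using e by (simp add: d_def)
  obtain \<psi> where \<psi>: "\<psi> \<in> test_functions" "H1_norm (\<lambda>x. u x - \<psi> x) < d"
    using H10_approx[OF assms d] by auto
  have "H1_norm (\<lambda>x. c * u x - c * \<psi> x) = cmod c * H1_norm (\<lambda>x. u x - \<psi> x)"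
    using H1_norm_cmult[OF H1_diff(1)[OF H10_H1[OF assms] test_in_H1[OF \<psi>(1)]]] by (simp add: right_diff_distrib)
  also have "\<dots> \<le> cmod c * d" using \<psi>(2) by (intro mult_left_mono) auto
  also have "\<dots> < (cmod c + 1) * d" using d by simp
  also have "\<dots> = e" using \<open>0 < cmod c + 1\<close> by (simp add: d_def)
  finally show "\<exists>\<psi>\<in>test_functions. H1_norm (\<lambda>x. c * u x - \<psi> x) < e"
    by (intro bexI[OF _ test_functions_cmult[OF \<psi>(1)]])
qed

lemma H10_diff: assumes "u \<in> H10" "v \<in> H10" shows "(\<lambda>x. u x - v x) \<in> H10"
  using H10_add[OF assms(1) H10_cmult[OF assms(2), of "-1"]] by simp

text \<open>Fatou's lemma for the squares. The bounds \<open>C n\<close> may vary with n, so that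
  the limit inherits the limiting constant instead of a uniform one.\<close>

lemma L2_Fatou:
  assumes f: "\<And>n. f n \<in> L2" and g: "g \<in> borel_measurable Rpos"
    and lim: "AE x in Rpos. (\<lambda>n. f n x) \<longlonglongrightarrow> g x"
    and le: "\<And>n::nat. (L2_norm (f n))\<^sup>2 \<le> C n" and C: "C \<longlonglongrightarrow> c"
  shows "g \<in> L2" "(L2_norm g)\<^sup>2 \<le> c"
proof -
  have c: "0 \<le> c" using C by (rule LIMSEQ_le_const) (use le in \<open>auto intro: order_trans[OF zero_le_power2]\<close>)
  have "(\<integral>\<^sup>+x. ennreal ((cmod (g x))\<^sup>2) \<partial>Rpos) = (\<integral>\<^sup>+x. liminf (\<lambda>n. ennreal ((cmod (f n x))\<^sup>2)) \<partial>Rpos)"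
  proof (rule nn_integral_cong_AE)
    show "AE x in Rpos. ennreal ((cmod (g x))\<^sup>2) = liminf (\<lambda>n. ennreal ((cmod (f n x))\<^sup>2))"
      using lim
    proof eventually_elim
      case (elim x)
      have "(\<lambda>n. ennreal ((cmod (f n x))\<^sup>2)) \<longlonglongrightarrow> ennreal ((cmod (g x))\<^sup>2)"
        by (intro tendsto_ennrealI tendsto_power tendsto_norm elim)
      then show ?case by (rule lim_imp_Liminf[symmetric, rotated]) simp
    qed
  qed
  also have "\<dots> \<le> liminf (\<lambda>n. \<integral>\<^sup>+x. ennreal ((cmod (f n x))\<^sup>2) \<partial>Rpos)"
    by (rule nn_integral_liminf) (use L2_measurable[OF f] in auto)
  also have "\<dots> = liminf (\<lambda>n. ennreal ((L2_norm (f n))\<^sup>2))"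
    unfolding L2_norm_sq by (simp add: nn_integral_eq_integral[OF L2_integrable[OF f]])
  also have "\<dots> \<le> liminf (\<lambda>n. ennreal (C n))"
    by (intro Liminf_mono always_eventually allI ennreal_leI le)
  also have "\<dots> = ennreal c"
    by (rule lim_imp_Liminf) (auto intro: tendsto_ennrealI C)
  finally have b: "(\<integral>\<^sup>+x. ennreal ((cmod (g x))\<^sup>2) \<partial>Rpos) \<le> ennreal c" .
  have i: "integrable Rpos (\<lambda>x. (cmod (g x))\<^sup>2)"
    by (rule integrableI_bounded) (use g b in \<open>auto simp: le_less_trans\<close>)
  then show "g \<in> L2" by (rule L2I[OF g])
  show "(L2_norm g)\<^sup>2 \<le> c"
    using b c unfolding L2_norm_sq by (simp add: nn_integral_eq_integral[OF i])
qed

text \<open>Convergence in L2 yields a subsequence that converges almost everywhere; along it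
  pointwise bounds and, by Fatou, norm bounds pass from test functions to
  \<open>H10\<close>.\<close>

lemma H10_AE_approx:
  assumes u: "u \<in> H10"
  obtains \<psi> where "\<And>n::nat. \<psi> n \<in> test_functions" "(\<lambda>n. H1_norm (\<lambda>x. u x - \<psi> n x)) \<longlonglongrightarrow> 0"
    "AE x in Rpos. (\<lambda>n. \<psi> n x) \<longlonglongrightarrow> u x"
proof -
  have "\<exists>\<psi>. \<psi> \<in> test_functions \<and> H1_norm (\<lambda>x. u x - \<psi> x) < inverse (real (Suc n))" for n
    using H10_approx[OF u, of "inverse (real (Suc n))"] by (metis inverse_positive_iff_positive of_nat_0_less_iff zero_less_Suc)
  then obtain \<psi> where \<psi>: "\<And>n. \<psi> n \<in> test_functions" "\<And>n. H1_norm (\<lambda>x. u x - \<psi> n x) < inverse (real (Suc n))"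
    by metis
  have lim: "(\<lambda>n. H1_norm (\<lambda>x. u x - \<psi> n x)) \<longlonglongrightarrow> 0"
    by (rule tendsto_sandwich[OF _ _ tendsto_const LIMSEQ_inverse_real_of_nat])
       (use \<psi>(2) in \<open>auto intro!: always_eventually less_imp_le\<close>)
  have d: "(\<lambda>x. u x - \<psi> n x) \<in> L2" for n by (intro L2_diff H10_L2 u test_L2 \<psi>)
  have "(\<lambda>n. (L2_norm (\<lambda>x. u x - \<psi> n x))\<^sup>2) \<longlonglongrightarrow> 0"
  proof (rule tendsto_sandwich[OF _ _ tendsto_const])
    show "(\<lambda>n. (H1_norm (\<lambda>x. u x - \<psi> n x))\<^sup>2) \<longlonglongrightarrow> 0" using tendsto_power[OF lim, of 2] by simp
  qed (auto intro!: always_eventually power_mono L2_norm_le_H1_norm)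
  then have "(\<lambda>n. LINT x|Rpos. norm ((cmod (u x - \<psi> n x))\<^sup>2)) \<longlonglongrightarrow> 0"
    by (simp add: L2_norm_sq)
  from tendsto_L1_AE_subseq[OF L2_integrable[OF d] this]
  obtain r where r: "strict_mono r" "AE x in Rpos. (\<lambda>n. (cmod (u x - \<psi> (r n) x))\<^sup>2) \<longlonglongrightarrow> 0" by auto
  show thesis
  proof (rule that[of "\<lambda>n. \<psi> (r n)"])
    show "(\<lambda>n. H1_norm (\<lambda>x. u x - \<psi> (r n) x)) \<longlonglongrightarrow> 0"
      using LIMSEQ_subseq_LIMSEQ[OF lim r(1)] by (simp add: o_def)
    show "AE x in Rpos. (\<lambda>n. \<psi> (r n) x) \<longlonglongrightarrow> u x"
      using r(2)
    proof eventually_elim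
      case (elim x)
      then have "(\<lambda>n. sqrt ((cmod (u x - \<psi> (r n) x))\<^sup>2)) \<longlonglongrightarrow> sqrt 0" by (rule tendsto_real_sqrt)
      then have "(\<lambda>n. u x - \<psi> (r n) x) \<longlonglongrightarrow> 0" by (simp add: tendsto_norm_zero_iff)
      from tendsto_diff[OF tendsto_const[of "u x"] this] show ?case by simp
    qed
  qed (rule \<psi>(1))
qed

text \<open>As \<psi> vanishes at 0, |\<psi>(y)|^2 is the integral of its derivative over [0, y], at
  most 2 ||\<psi>|| ||\<psi>'||, and 2 a b \<le> a^2 + b^2 gives the constant 1.\<close>

lemma sobolev_test:
  assumes \<psi>: "\<psi> \<in> test_functions" shows "cmod (\<psi> y) \<le> H1_norm \<psi>"
proof (cases "0 < y")
  case True
  obtain \<psi>' a b where t: "0 < a" "a < b" "smooth \<psi>" "\<psi>' \<in> test_functions"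
    "\<And>x. x \<notin> {a..b} \<Longrightarrow> \<psi> x = 0" "\<And>x. (\<psi> has_vector_derivative \<psi>' x) (at x)"
    using test_functionE[OF \<psi>] by metis
  have "smooth \<psi>'" using t(4) by (simp add: test_functions_iff)
  define q where "q = (\<lambda>x. \<psi> x * cnj (\<psi>' x) + \<psi>' x * cnj (\<psi> x))"
  have Q: "((\<lambda>x. \<psi> x * cnj (\<psi> x)) has_vector_derivative q x) (at x)" for x
    unfolding q_def by (intro has_vector_derivative_mult t(6) has_vector_derivative_cnj)
  have cq: "continuous_on A q" for A unfolding q_def
    by (intro continuous_intros smooth_imp_continuous t(3) \<open>smooth \<psi>'\<close>)
  have si: "set_integrable lebesgue {0..y} q" by (rule absolutely_integrable_continuous_real[OF cq])
  have "integral {0..y} q = \<psi> y * cnj (\<psi> y) - \<psi> 0 * cnj (\<psi> 0)"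
    by (intro integral_unique fundamental_theorem_of_calculus)
       (use True in \<open>auto intro!: has_vector_derivative_at_within[OF Q]\<close>)
  also have "\<psi> 0 = 0" using t by auto
  finally have eq: "\<psi> y * cnj (\<psi> y) = (LINT x:{0..y}|lebesgue. q x)"
    by (simp add: set_lebesgue_integral_eq_integral[OF si])
  have i: "integrable Rpos (\<lambda>x. 2 * (cmod (\<psi> x) * cmod (\<psi>' x)))"
    by (intro integrable_mult_right L2_prod_integrable test_L2 \<psi> t(4))
  have "(cmod (\<psi> y))\<^sup>2 = cmod (\<psi> y * cnj (\<psi> y))" by (simp add: norm_mult power2_eq_square)
  also have "\<dots> \<le> (LINT x|lebesgue. norm (indicator {0..y} x *\<^sub>R q x))"
    unfolding eq set_lebesgue_integral_def by (rule integral_norm_bound)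
  also have "\<dots> \<le> (LINT x|lebesgue. indicator {0<..} x *\<^sub>R (2 * (cmod (\<psi> x) * cmod (\<psi>' x))))"
  proof (rule integral_mono)
    show "integrable lebesgue (\<lambda>t. norm (indicator {0..y} t *\<^sub>R q t))"
      using si unfolding set_integrable_def by (rule integrable_norm)
    show "integrable lebesgue (\<lambda>x. indicator {0<..} x *\<^sub>R (2 * (cmod (\<psi> x) * cmod (\<psi>' x))))"
      using i unfolding integrable_Rpos_iff set_integrable_def .
    fix s
    have "cmod (q s) \<le> 2 * (cmod (\<psi> s) * cmod (\<psi>' s))"
      unfolding q_def by (rule order_trans[OF norm_triangle_ineq]) (simp add: norm_mult)
    moreover have "q s = 0" if "s \<notin> {0<..}"
    proof -
      have "\<psi> s = 0" using that t(1) by (intro t(5)) auto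
      then show ?thesis by (simp add: q_def)
    qed
    ultimately show "norm (indicat_real {0..y} s *\<^sub>R q s) \<le> indicat_real {0<..} s *\<^sub>R (2 * (cmod (\<psi> s) * cmod (\<psi>' s)))"
      by (cases "s \<in> {0<..}") (auto simp: indicator_def)
  qed
  also have "\<dots> = 2 * (LINT x|Rpos. cmod (\<psi> x) * cmod (\<psi>' x))"
    unfolding integral_mult_right_zero[symmetric] by (simp only: integral_Rpos_eq set_lebesgue_integral_def)
  also have "\<dots> \<le> 2 * (L2_norm \<psi> * L2_norm \<psi>')"
    by (intro mult_left_mono L2_Cauchy_Schwarz test_L2 \<psi> t(4)) simp
  also have "\<dots> \<le> (L2_norm \<psi>)\<^sup>2 + (L2_norm \<psi>')\<^sup>2"
    using sum_squares_bound[of "L2_norm \<psi>" "L2_norm \<psi>'"] by (simp add: mult.assoc)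
  also have "\<dots> = (H1_norm \<psi>)\<^sup>2"
    unfolding H1_norm_def test_H1(3)[OF \<psi> t(4,6)] by simp
  finally show ?thesis by (rule power2_le_imp_le) simp
next
  case False
  obtain a b where t: "0 < a" "\<And>x. x \<notin> {a..b} \<Longrightarrow> \<psi> x = 0"
    using test_functionE[OF \<psi>] by metis
  have "\<psi> y = 0" using False t(1) by (intro t(2)) auto
  then show ?thesis by simp
qed

text \<open>Sobolev's inequality passed to the limit. It makes the quintic term map
  \<open>H10\<close> into L2 and gives it a Lipschitz constant on bounded sets.\<close>

lemma H10_bounded:
  assumes u: "u \<in> H10" shows "AE x in Rpos. cmod (u x) \<le> H1_norm u"
proof -
  obtain \<psi> where \<psi>: "\<And>n::nat. \<psi> n \<in> test_functions" "(\<lambda>n. H1_norm (\<lambda>x. u x - \<psi> n x)) \<longlonglongrightarrow> 0"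
    "AE x in Rpos. (\<lambda>n. \<psi> n x) \<longlonglongrightarrow> u x" using H10_AE_approx[OF u] by blast
  show ?thesis using \<psi>(3)
  proof eventually_elim
    case (elim x)
    have "(\<lambda>n. H1_norm u + H1_norm (\<lambda>x. u x - \<psi> n x)) \<longlonglongrightarrow> H1_norm u + 0"
      by (intro tendsto_add tendsto_const \<psi>(2))
    then have lim: "(\<lambda>n. H1_norm u + H1_norm (\<lambda>x. u x - \<psi> n x)) \<longlonglongrightarrow> H1_norm u" by simp
    have le: "cmod (\<psi> n x) \<le> H1_norm u + H1_norm (\<lambda>x. u x - \<psi> n x)" for n
      using sobolev_test[OF \<psi>(1), of n x] H1_norm_abs_diff[OF H10_H1[OF u] test_in_H1[OF \<psi>(1)[of n]]] by linarith
    show ?case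
      by (rule LIMSEQ_le[OF tendsto_norm[OF elim] lim]) (use le in blast)
  qed
qed

text \<open>With h = \<psi> / x, the derivative of |\<psi>|^2 / x has integral zero, which reads
  ||h||^2 = <h, \<psi>'> + <\<psi>', h>. Cauchy-Schwarz bounds the right-hand side by 2 ||h||
  ||\<psi>'||, and one factor ||h|| cancels.\<close>

lemma hardy_test:
  assumes \<psi>: "\<psi> \<in> test_functions"
  shows "(\<lambda>x. \<psi> x / of_real x) \<in> L2" "L2_norm (\<lambda>x. \<psi> x / of_real x) \<le> 2 * L2_norm (weak_deriv \<psi>)"
proof -
  obtain \<psi>' a b where t: "0 < a" "a < b" "smooth \<psi>" "\<psi>' \<in> test_functions"
    "\<And>x. x \<notin> {a..b} \<Longrightarrow> \<psi> x = 0" "\<And>x. (\<psi> has_vector_derivative \<psi>' x) (at x)"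
    "\<And>x. x \<notin> {a..b} \<Longrightarrow> \<psi>' x = 0"
    using test_functionE[OF \<psi>] by metis
  have "smooth \<psi>'" using t(4) by (simp add: test_functions_iff)
  define h where "h = (\<lambda>x. \<psi> x / complex_of_real x)"
  have hc: "continuous_on {0<..} h" unfolding h_def
    by (intro continuous_intros smooth_imp_continuous t(3)) auto
  show h: "h \<in> L2"
  proof (rule L2_bound(1)[OF test_L2[OF \<psi>] continuous_measurable_Rpos[OF hc], of "1 / a"])
    show "AE x in Rpos. cmod (h x) \<le> 1 / a * cmod (\<psi> x)"
    proof (rule AE_I2)
      fix x assume "x \<in> space Rpos"
      show "cmod (h x) \<le> 1 / a * cmod (\<psi> x)"
      proof (cases "x \<in> {a..b}")
        case True
        then show ?thesis using t(1) by (auto simp: h_def norm_divide frac_le intro!: divide_left_mono mult_pos_pos)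
      next
        case False then show ?thesis using t(5)[of x] by (simp add: h_def)
      qed
    qed
  qed (use t(1) in simp)
  define q where "q = (\<lambda>x. \<psi> x * cnj (\<psi>' x) + \<psi>' x * cnj (\<psi> x))"
  define g where "g = (\<lambda>x. q x / complex_of_real x - h x * cnj (h x))"
  have G: "((\<lambda>x. \<psi> x * cnj (\<psi> x) / complex_of_real x) has_vector_derivative g x) (at x)" if "0 < x" for x
  proof -
    have i: "((\<lambda>x. complex_of_real (inverse x)) has_vector_derivative complex_of_real (- (inverse x * inverse x))) (at x)"
    proof (rule has_vector_derivative_of_real)
      show "(inverse has_real_derivative - (inverse x * inverse x)) (at x)"
        using DERIV_inverse'[OF DERIV_ident, of x] that by simp
    qed
    have "((\<lambda>x. \<psi> x * cnj (\<psi> x)) has_vector_derivative q x) (at x)"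
      unfolding q_def by (intro has_vector_derivative_mult t(6) has_vector_derivative_cnj)
    from has_vector_derivative_mult[OF this i]
    show ?thesis unfolding g_def h_def divide_inverse of_real_inverse[symmetric]
      by (rule has_vector_derivative_eq_rhs) (simp add: algebra_simps)
  qed
  have cg: "continuous_on {0<..} g" unfolding g_def q_def h_def
    by (intro continuous_intros smooth_imp_continuous t(3) \<open>smooth \<psi>'\<close>) auto
  have z: "(LINT x|Rpos. g x) = 0"
    by (rule integral_Rpos_derivative_zero(2)[OF G cg t(1,2)]) (use t(5,7) in \<open>auto simp: g_def q_def h_def\<close>)
  have eqq: "q x / complex_of_real x = h x * cnj (\<psi>' x) + \<psi>' x * cnj (h x)" for x
    by (simp add: q_def h_def add_divide_distrib)
  have i1: "integrable Rpos (\<lambda>x. h x * cnj (\<psi>' x))" "integrable Rpos (\<lambda>x. \<psi>' x * cnj (h x))"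
    "integrable Rpos (\<lambda>x. h x * cnj (h x))"
    by (intro L2_prod_integrable(3) h test_L2 t(4))+
  have "L2_inner h \<psi>' + L2_inner \<psi>' h - L2_inner h h = 0"
    using z unfolding g_def eqq L2_inner_def by (simp add: i1)
  then have "complex_of_real ((L2_norm h)\<^sup>2) = L2_inner h \<psi>' + L2_inner \<psi>' h" by (simp add: L2_inner_self)
  then have "(L2_norm h)\<^sup>2 = cmod (L2_inner h \<psi>' + L2_inner \<psi>' h)"
    by (metis abs_of_nonneg norm_of_real zero_le_power2)
  also have "\<dots> \<le> L2_norm h * L2_norm \<psi>' + L2_norm \<psi>' * L2_norm h"
    by (rule order_trans[OF norm_triangle_ineq]) (intro add_mono L2_inner_bound h test_L2 t(4))
  finally have "L2_norm h * L2_norm h \<le> L2_norm h * (2 * L2_norm \<psi>')" by (simp add: power2_eq_square mult_ac)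
  then have "L2_norm h \<le> 2 * L2_norm \<psi>'"
    by (cases "L2_norm h = 0") (auto simp: mult_le_cancel_left order_less_le)
  then show "L2_norm h \<le> 2 * L2_norm (weak_deriv \<psi>)"
    unfolding test_H1(3)[OF \<psi> t(4,6)] .
qed

text \<open>The inequality for test functions passes to the limit by Fatou; membership of u / x in
  L2 is part of what Fatou yields.\<close>

lemma hardy:
  assumes u: "u \<in> H10"
  shows "(\<lambda>x. u x / of_real x) \<in> L2" "L2_norm (\<lambda>x. u x / of_real x) \<le> 2 * L2_norm (weak_deriv u)"
proof -
  obtain \<psi> where \<psi>: "\<And>n::nat. \<psi> n \<in> test_functions" "(\<lambda>n. H1_norm (\<lambda>x. u x - \<psi> n x)) \<longlonglongrightarrow> 0"
    "AE x in Rpos. (\<lambda>n. \<psi> n x) \<longlonglongrightarrow> u x" using H10_AE_approx[OF u] by blast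
  define C where "C = (\<lambda>n. (2 * (L2_norm (weak_deriv u) + H1_norm (\<lambda>x. u x - \<psi> n x)))\<^sup>2)"
  have C: "C \<longlonglongrightarrow> (2 * (L2_norm (weak_deriv u) + 0))\<^sup>2"
    unfolding C_def by (intro tendsto_intros \<psi>(2))
  have le: "(L2_norm (\<lambda>x. \<psi> n x / of_real x))\<^sup>2 \<le> C n" for n
  proof -
    have "L2_norm (weak_deriv (\<psi> n)) - L2_norm (weak_deriv u) \<le> L2_norm (\<lambda>x. weak_deriv u x - weak_deriv (\<psi> n) x)"
      using L2_norm_abs_diff[OF weak_deriv(1)[OF H10_H1[OF u]] weak_deriv(1)[OF test_in_H1[OF \<psi>(1)[of n]]]] by linarith
    also have "\<dots> \<le> H1_norm (\<lambda>x. u x - \<psi> n x)"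
      using L2_norm_weak_deriv_le[of "\<lambda>x. u x - \<psi> n x"] unfolding H1_diff(3)[OF H10_H1[OF u] test_in_H1[OF \<psi>(1)[of n]]] .
    finally show ?thesis unfolding C_def
      using order_trans[OF hardy_test(2)[OF \<psi>(1)], of n "2 * (L2_norm (weak_deriv u) + H1_norm (\<lambda>x. u x - \<psi> n x))"]
      by (intro power_mono) auto
  qed
  have m: "(\<lambda>x. u x / of_real x) \<in> borel_measurable Rpos"
    by (intro borel_measurable_divide L2_measurable[OF H10_L2[OF u]] continuous_measurable_Rpos continuous_intros)
  have "AE x in Rpos. (\<lambda>n. \<psi> n x / of_real x) \<longlonglongrightarrow> u x / of_real x"
    using \<psi>(3)
  proof eventually_elim
    case (elim x)
    then have "(\<lambda>n. \<psi> n x * inverse (of_real x)) \<longlonglongrightarrow> u x * inverse (of_real x)" by (intro tendsto_intros)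
    then show ?case by (simp add: divide_inverse)
  qed
  note * = L2_Fatou[OF hardy_test(1)[OF \<psi>(1)] m this le C]
  show "(\<lambda>x. u x / of_real x) \<in> L2" by (rule *)
  show "L2_norm (\<lambda>x. u x / of_real x) \<le> 2 * L2_norm (weak_deriv u)"
    by (rule power2_le_imp_le) (use *(2) in simp_all)
qed

section \<open>Multipliers, dilations and strong limits\<close>


text \<open>Since m \<psi> is again a test function, u can be tested with it; writing m \<psi>' = (m
  \<psi>)' - m' \<psi> moves the multiplier from the test function to u.\<close>

lemma H1_mult_smooth:
  assumes u: "u \<in> H1" and m: "smooth m" "smooth m'" "\<And>x. (m has_vector_derivative m' x) (at x)"
    and A: "\<And>x. 0 < x \<Longrightarrow> cmod (m x) \<le> A" and B: "\<And>x. 0 < x \<Longrightarrow> cmod (m' x) \<le> B"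
  shows "(\<lambda>x. m x * u x) \<in> H1" "AE x in Rpos. weak_deriv (\<lambda>x. m x * u x) x = m' x * u x + m x * weak_deriv u x"
    "H1_norm (\<lambda>x. m x * u x) \<le> (2 * A + B) * H1_norm u"
proof -
  have A0: "0 \<le> A" and B0: "0 \<le> B"
    using order_trans[OF norm_ge_zero A[of 1]] order_trans[OF norm_ge_zero B[of 1]] by simp_all
  have mm: "m \<in> borel_measurable Rpos" "m' \<in> borel_measurable Rpos"
    by (intro continuous_measurable_Rpos smooth_imp_continuous m)+
  note u2 = H1_L2[OF u] weak_deriv[OF u]
  have bd: "(\<lambda>x. m x * v x) \<in> L2" "L2_norm (\<lambda>x. m x * v x) \<le> A * L2_norm v"
     "(\<lambda>x. m' x * v x) \<in> L2" "L2_norm (\<lambda>x. m' x * v x) \<le> B * L2_norm v" if v: "v \<in> L2" for v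
  proof -
    have "AE x in Rpos. cmod (m x * v x) \<le> A * cmod (v x)"
      by (intro AE_I2) (auto simp: norm_mult intro!: mult_right_mono A)
    note a = L2_bound[OF v borel_measurable_times[OF mm(1) L2_measurable[OF v]] A0 this]
    have "AE x in Rpos. cmod (m' x * v x) \<le> B * cmod (v x)"
      by (intro AE_I2) (auto simp: norm_mult intro!: mult_right_mono B)
    note b = L2_bound[OF v borel_measurable_times[OF mm(2) L2_measurable[OF v]] B0 this]
    show "(\<lambda>x. m x * v x) \<in> L2" "L2_norm (\<lambda>x. m x * v x) \<le> A * L2_norm v"
     "(\<lambda>x. m' x * v x) \<in> L2" "L2_norm (\<lambda>x. m' x * v x) \<le> B * L2_norm v"
      using a b by blast+
  qed
  have w: "has_weak_deriv (\<lambda>x. m x * u x) (\<lambda>x. m' x * u x + m x * weak_deriv u x)"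
    unfolding has_weak_deriv_def
  proof
    fix \<psi> assume \<psi>: "\<psi> \<in> test_functions"
    obtain \<psi>' where t: "\<psi>' \<in> test_functions" "\<And>x. (\<psi> has_vector_derivative \<psi>' x) (at x)"
      "\<And>x. vector_derivative \<psi> (at x) = \<psi>' x"
      using test_functionE[OF \<psi>] by metis
    have d: "((\<lambda>x. m x * \<psi> x) has_vector_derivative m x * \<psi>' x + m' x * \<psi> x) (at x)" for x
      by (rule has_vector_derivative_mult[OF m(3) t(2)])
    note l = L2_loc_integrable[OF u2(1)] L2_loc_integrable[OF u2(2)]
    note mt = test_functions_mult[OF t(1) m(1)] test_functions_mult[OF \<psi> m(2)] test_functions_mult[OF \<psi> m(1)]
    note i = loc_integrable_mult_test(2)[OF l(1) mt(1)] loc_integrable_mult_test(2)[OF l(1) mt(2)]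
      loc_integrable_mult_test(2)[OF l(2) mt(3)]
    have e1: "(LINT x|Rpos. u x * (m x * \<psi>' x + m' x * \<psi> x)) = - (LINT x|Rpos. weak_deriv u x * (m x * \<psi> x))"
      by (rule has_weak_derivD[OF u2(3) mt(3) d])
    have e2: "(LINT x|Rpos. u x * (m x * \<psi>' x + m' x * \<psi> x)) = (LINT x|Rpos. u x * (m x * \<psi>' x)) + (LINT x|Rpos. u x * (m' x * \<psi> x))"
      unfolding distrib_left by (rule Bochner_Integration.integral_add[OF i(1,2)])
    have e3: "(LINT x|Rpos. u x * (m' x * \<psi> x) + weak_deriv u x * (m x * \<psi> x)) =
      (LINT x|Rpos. u x * (m' x * \<psi> x)) + (LINT x|Rpos. weak_deriv u x * (m x * \<psi> x))"
      by (rule Bochner_Integration.integral_add[OF i(2,3)])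
    have "(LINT x|Rpos. u x * (m x * \<psi>' x)) = - (LINT x|Rpos. u x * (m' x * \<psi> x) + weak_deriv u x * (m x * \<psi> x))"
    proof -
      have "a = - (b + c)" if "a + b = - c" for a b c :: complex
        using that by (metis add.assoc eq_neg_iff_add_eq_0)
      from this[OF e1[unfolded e2]] show ?thesis unfolding e3 .
    qed
    then show "(LINT x|Rpos. m x * u x * vector_derivative \<psi> (at x)) = - (LINT x|Rpos. (m' x * u x + m x * weak_deriv u x) * \<psi> x)"
      unfolding t(3) by (simp add: algebra_simps)
  qed
  note * = weak_deriv_eqI[OF bd(1)[OF u2(1)] L2_add[OF bd(3)[OF u2(1)] bd(1)[OF u2(2)]] w]
  show "(\<lambda>x. m x * u x) \<in> H1" "AE x in Rpos. weak_deriv (\<lambda>x. m x * u x) x = m' x * u x + m x * weak_deriv u x"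
    using *(1,2) by blast+
  have "H1_norm (\<lambda>x. m x * u x) \<le> L2_norm (\<lambda>x. m x * u x) + L2_norm (\<lambda>x. m' x * u x + m x * weak_deriv u x)"
    using H1_norm_le[of "\<lambda>x. m x * u x"] unfolding *(3) .
  also have "\<dots> \<le> A * L2_norm u + (B * L2_norm u + A * L2_norm (weak_deriv u))"
    using bd(2)[OF u2(1)] bd(4)[OF u2(1)] bd(2)[OF u2(2)]
      L2_norm_triangle[OF bd(3)[OF u2(1)] bd(1)[OF u2(2)]] by linarith
  also have "\<dots> \<le> A * H1_norm u + (B * H1_norm u + A * H1_norm u)"
    by (intro add_mono mult_left_mono L2_norm_le_H1_norm L2_norm_weak_deriv_le A0 B0)
  finally show "H1_norm (\<lambda>x. m x * u x) \<le> (2 * A + B) * H1_norm u" by (simp add: algebra_simps)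
qed

text \<open>Multiplication by \<open>m\<close> is bounded on H1 and maps test functions to test
  functions, so it preserves their closure.\<close>

lemma H10_mult_smooth:
  assumes u: "u \<in> H10" and m: "smooth m" "smooth m'" "\<And>x. (m has_vector_derivative m' x) (at x)"
    and A: "\<And>x. 0 < x \<Longrightarrow> cmod (m x) \<le> A" and B: "\<And>x. 0 < x \<Longrightarrow> cmod (m' x) \<le> B"
  shows "(\<lambda>x. m x * u x) \<in> H10"
proof (rule H10_closed)
  note ms = H1_mult_smooth[OF _ m A B]
  show "(\<lambda>x. m x * u x) \<in> H1" by (rule ms(1)[OF H10_H1[OF u]])
  fix e :: real assume e: "0 < e"
  have AB: "0 \<le> 2 * A + B"
    using order_trans[OF norm_ge_zero A[of 1]] order_trans[OF norm_ge_zero B[of 1]] by simp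
  obtain \<psi> where \<psi>: "\<psi> \<in> test_functions" "H1_norm (\<lambda>x. u x - \<psi> x) < e / (2 * A + B + 1)"
    using H10_approx[OF u, of "e / (2 * A + B + 1)"] e AB by auto
  have "H1_norm (\<lambda>x. m x * (u x - \<psi> x)) \<le> (2 * A + B) * H1_norm (\<lambda>x. u x - \<psi> x)"
    by (rule ms(3)[OF H1_diff(1)[OF H10_H1[OF u] test_in_H1[OF \<psi>(1)]]])
  also have "\<dots> \<le> (2 * A + B) * (e / (2 * A + B + 1))"
    using \<psi>(2) AB by (intro mult_left_mono) auto
  also have "\<dots> < e" using e AB by (simp add: field_simps)
  finally show "\<exists>w\<in>H10. H1_norm (\<lambda>x. m x * u x - w x) < e"
    by (intro bexI[OF _ test_H10[OF test_functions_mult[OF \<psi>(1) m(1)]]]) (simp add: right_diff_distrib)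
qed

lemma L2_norm_lim_dominated:
  assumes f: "\<And>n::nat. f n \<in> borel_measurable Rpos" and g: "g \<in> borel_measurable Rpos"
    and w: "integrable Rpos (\<lambda>x. (w x)\<^sup>2)"
    and le: "\<And>n x. 0 < x \<Longrightarrow> cmod (f n x) \<le> w x"
    and lim: "\<And>x. 0 < x \<Longrightarrow> (\<lambda>n. f n x) \<longlonglongrightarrow> g x"
  shows "(\<lambda>n. L2_norm (\<lambda>x. f n x - g x)) \<longlonglongrightarrow> 0"
proof -
  have le': "cmod (g x) \<le> w x" if "0 < x" for x
    by (rule LIMSEQ_le_const2[OF tendsto_norm[OF lim[OF that]]]) (use le[OF that] in blast)
  \<comment> \<open>The majorant is \<open>4 * (w x)\<^sup>2\<close> because the limit
    \<open>g\<close> inherits the bound \<open>w\<close>, so the difference is at most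
    \<open>2 * w x\<close>.\<close>
  have "(\<lambda>n. LINT x|Rpos. (cmod (f n x - g x))\<^sup>2) \<longlonglongrightarrow> (LINT x|Rpos. 0::real)"
  proof (rule integral_dominated_convergence[where w = "\<lambda>x. 4 * (w x)\<^sup>2"])
    show "integrable Rpos (\<lambda>x. 4 * (w x)\<^sup>2)" by (intro integrable_mult_right w)
    show "(\<lambda>x. (cmod (f n x - g x))\<^sup>2) \<in> borel_measurable Rpos" for n using f g by auto
    show "AE x in Rpos. (\<lambda>n. (cmod (f n x - g x))\<^sup>2) \<longlonglongrightarrow> 0"
    proof (rule AE_I2)
      fix x assume "x \<in> space Rpos"
      then have "(\<lambda>n. (cmod (f n x - g x))\<^sup>2) \<longlonglongrightarrow> (cmod (g x - g x))\<^sup>2"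
        by (intro tendsto_intros lim) simp
      then show "(\<lambda>n. (cmod (f n x - g x))\<^sup>2) \<longlonglongrightarrow> 0" by simp
    qed
    show "AE x in Rpos. norm ((cmod (f n x - g x))\<^sup>2) \<le> 4 * (w x)\<^sup>2" for n
    proof (rule AE_I2)
      fix x assume "x \<in> space Rpos"
      then have x: "0 < x" by simp
      have "cmod (f n x - g x) \<le> 2 * w x"
        using norm_triangle_ineq4[of "f n x" "g x"] le[OF x, of n] le'[OF x] by linarith
      from power_mono[OF this norm_ge_zero, of 2] show "norm ((cmod (f n x - g x))\<^sup>2) \<le> 4 * (w x)\<^sup>2"
        by (simp add: power_mult_distrib)
    qed
  qed simp
  then have "(\<lambda>n. sqrt (LINT x|Rpos. (cmod (f n x - g x))\<^sup>2)) \<longlonglongrightarrow> sqrt 0"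
    by (intro tendsto_real_sqrt) simp
  then show ?thesis by (simp add: L2_norm_def)
qed

lemma L2_parallelogram:
  assumes "u \<in> L2" "v \<in> L2"
  shows "(L2_norm (\<lambda>x. u x + v x))\<^sup>2 + (L2_norm (\<lambda>x. u x - v x))\<^sup>2 = 2 * (L2_norm u)\<^sup>2 + 2 * (L2_norm v)\<^sup>2"
proof -
  have p: "(cmod (a + b))\<^sup>2 + (cmod (a - b))\<^sup>2 = 2 * (cmod a)\<^sup>2 + 2 * (cmod b)\<^sup>2" for a b
    unfolding cmod_power2 by (simp add: power2_eq_square algebra_simps)
  have "(L2_norm (\<lambda>x. u x + v x))\<^sup>2 + (L2_norm (\<lambda>x. u x - v x))\<^sup>2
      = (LINT x|Rpos. (cmod (u x + v x))\<^sup>2 + (cmod (u x - v x))\<^sup>2)"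
    unfolding L2_norm_sq
    by (rule Bochner_Integration.integral_add[symmetric, OF L2_integrable[OF L2_add[OF assms]] L2_integrable[OF L2_diff[OF assms]]])
  also have "\<dots> = 2 * (L2_norm u)\<^sup>2 + 2 * (L2_norm v)\<^sup>2"
    unfolding p L2_norm_sq
    by (subst Bochner_Integration.integral_add) (simp_all add: L2_integrable assms)
  finally show ?thesis .
qed

text \<open>By the parallelogram law, \<open>\<parallel>f\<^sub>n - g\<parallel>\<close> stays away from zero only if \<open>\<parallel>f\<^sub>n + g\<parallel>\<close> stays below
  \<open>2 \<parallel>g\<parallel>\<close>, which Fatou's lemma excludes.\<close>

lemma L2_norm_lim_norms:
  assumes f: "\<And>n::nat. f n \<in> L2" and g: "g \<in> L2"
    and lim: "\<And>x. 0 < x \<Longrightarrow> (\<lambda>n. f n x) \<longlonglongrightarrow> g x"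
    and norms: "(\<lambda>n. L2_norm (f n)) \<longlonglongrightarrow> L2_norm g"
  shows "(\<lambda>n. L2_norm (\<lambda>x. f n x - g x)) \<longlonglongrightarrow> 0"
proof (rule ccontr)
  assume "\<not> ?thesis"
  then obtain d where d: "0 < d" "\<And>N. \<exists>n\<ge>N. d \<le> L2_norm (\<lambda>x. f n x - g x)"
    unfolding LIMSEQ_iff by (auto simp: not_less)
  have "\<exists>r::nat \<Rightarrow> nat. strict_mono r \<and> (\<forall>k. d \<le> L2_norm (\<lambda>x. f (r k) x - g x))"
  proof -
    have inf: "infinite {n. d \<le> L2_norm (\<lambda>x. f n x - g x)}"
      unfolding infinite_nat_iff_unbounded_le using d(2) by auto
    show ?thesis
      by (rule exI[of _ "enumerate {n. d \<le> L2_norm (\<lambda>x. f n x - g x)}"])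
         (use strict_mono_enumerate[OF inf] enumerate_in_set[OF inf] in auto)
  qed
  then obtain r :: "nat \<Rightarrow> nat" where r: "strict_mono r" "\<And>k. d \<le> L2_norm (\<lambda>x. f (r k) x - g x)" by blast
  define C where "C = (\<lambda>k. 2 * (L2_norm (f (r k)))\<^sup>2 + 2 * (L2_norm g)\<^sup>2 - d\<^sup>2)"
  have Clim: "C \<longlonglongrightarrow> 2 * (L2_norm g)\<^sup>2 + 2 * (L2_norm g)\<^sup>2 - d\<^sup>2"
    unfolding C_def using LIMSEQ_subseq_LIMSEQ[OF norms r(1)] by (intro tendsto_intros) (simp add: o_def)

  have le: "(L2_norm (\<lambda>x. f (r k) x + g x))\<^sup>2 \<le> C k" for k
  proof -
    have "d\<^sup>2 \<le> (L2_norm (\<lambda>x. f (r k) x - g x))\<^sup>2"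
      using r(2)[of k] d(1) by (intro power_mono) auto
    then show ?thesis using L2_parallelogram[OF f[of "r k"] g] unfolding C_def by linarith
  qed
  have ae: "AE x in Rpos. (\<lambda>k. f (r k) x + g x) \<longlonglongrightarrow> 2 * g x"
  proof (rule AE_I2)
    fix x assume "x \<in> space Rpos"
    then have "(\<lambda>k. f (r k) x + g x) \<longlonglongrightarrow> g x + g x"
      using LIMSEQ_subseq_LIMSEQ[OF lim r(1), of x] by (intro tendsto_intros) (simp add: o_def)
    then show "(\<lambda>k. f (r k) x + g x) \<longlonglongrightarrow> 2 * g x" by simp
  qed
  \<comment> \<open>Fatou applied to the sums \<open>f (r k) + g\<close>, whose squared norms the
    parallelogram law bounds by \<open>C k\<close>; the outcome 4 ||g||^2 \<le> 4 ||g||^2 - d^2 is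
    absurd.\<close>
  have "(L2_norm (\<lambda>x. 2 * g x))\<^sup>2 \<le> 2 * (L2_norm g)\<^sup>2 + 2 * (L2_norm g)\<^sup>2 - d\<^sup>2"
    by (rule L2_Fatou(2)[OF L2_add[OF f g] L2_measurable[OF L2_cmult[OF g]] ae le Clim])
  then have "d\<^sup>2 \<le> 0" by (simp add: L2_norm_cmult power_mult_distrib)
  then show False using d(1) by simp
qed

section \<open>Dilations\<close>

lemma integral_Rpos_dilate:
  fixes f :: "real \<Rightarrow> 'a::euclidean_space"
  assumes s: "0 < s"
  shows "integrable Rpos (\<lambda>x. f (x / s)) \<longleftrightarrow> integrable Rpos f"
    "(LINT x|Rpos. f (x / s)) = s *\<^sub>R (LINT x|Rpos. f x)"
proof -
  have eq: "(\<lambda>x. indicator {0<..} x *\<^sub>R f (x / s)) = (\<lambda>x. (\<lambda>y. indicat_real {0<..} y *\<^sub>R f y) (0 + (1 / s) * x))"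
    using s by (auto simp: indicator_def fun_eq_iff zero_less_divide_iff)
  show "integrable Rpos (\<lambda>x. f (x / s)) \<longleftrightarrow> integrable Rpos f"
    unfolding integrable_Rpos_iff set_integrable_def eq
    using lebesgue_integrable_real_affine_iff[of "1/s" "\<lambda>y. indicat_real {0<..} y *\<^sub>R f y" 0] s by simp
  show "(LINT x|Rpos. f (x / s)) = s *\<^sub>R (LINT x|Rpos. f x)"
    unfolding integral_Rpos_eq set_lebesgue_integral_def eq
    using lebesgue_integral_real_affine[of "1/s" "\<lambda>y. indicat_real {0<..} y *\<^sub>R f y" 0] s by simp
qed

lemma L2_dilate:
  assumes u: "u \<in> L2" and s: "0 < s"
  shows "(\<lambda>x. u (x / s)) \<in> L2" "L2_norm (\<lambda>x. u (x / s)) = sqrt s * L2_norm u"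
proof -
  have m: "(\<lambda>x. indicator {0<..} x *\<^sub>R u x) \<in> borel_measurable lebesgue"
    using L2_measurable[OF u] borel_measurable_restrict_space_iff[OF sets_Rpos, of u] by simp
  have "(\<lambda>x. x / s) \<in> lebesgue \<rightarrow>\<^sub>M lebesgue"
  proof -
    have "(\<lambda>x. x / s) = (*\<^sub>R) (1 / s)" by auto
    then show ?thesis using lebesgue_measurable_scaling[of "1/s", where 'a=real] by (simp only:)
  qed
  from measurable_compose[OF this m]
  have "(\<lambda>x. indicator {0<..} (x / s) *\<^sub>R u (x / s)) \<in> borel_measurable lebesgue" .
  moreover have "(\<lambda>x. indicator {0<..} (x / s) *\<^sub>R u (x / s)) = (\<lambda>x. indicator {0<..} x *\<^sub>R u (x / s))"
    using s by (auto simp: indicator_def fun_eq_iff zero_less_divide_iff)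
  ultimately have "(\<lambda>x. u (x / s)) \<in> borel_measurable Rpos"
    using borel_measurable_restrict_space_iff[OF sets_Rpos, of "\<lambda>x. u (x / s)"] by simp
  moreover have "integrable Rpos (\<lambda>x. (cmod (u (x / s)))\<^sup>2)"
    using integral_Rpos_dilate(1)[OF s, of "\<lambda>x. (cmod (u x))\<^sup>2"] L2_integrable[OF u] by simp
  ultimately show "(\<lambda>x. u (x / s)) \<in> L2" by (rule L2I)
  show "L2_norm (\<lambda>x. u (x / s)) = sqrt s * L2_norm u"
    using integral_Rpos_dilate(2)[OF s, of "\<lambda>x. (cmod (u x))\<^sup>2"] by (simp add: L2_norm_def real_sqrt_mult)
qed

lemma test_dilate:
  assumes "\<psi> \<in> test_functions" and s: "0 < s"
  shows "(\<lambda>x. \<psi> (x / s)) \<in> test_functions"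
proof -
  obtain a b where ab: "0 < a" "a < b" "smooth \<psi>" "\<And>x. x \<notin> {a..b} \<Longrightarrow> \<psi> x = 0"
    using test_functionE[OF assms(1)] by metis
  show ?thesis
  proof (rule test_functionsI[of _ "s * a" "s * b"])
    show "smooth (\<lambda>x. \<psi> (x / s))" using smooth_affine[OF ab(3), of "1/s" 0] by simp
    show "\<psi> (x / s) = 0" if "x \<notin> {s * a..s * b}" for x
      using that s by (intro ab(4)) (auto simp: field_simps)
  qed (use ab s in auto)
qed

text \<open>A change of variables moves the dilation onto the test function, where the chain rule is
  classical, and a second one moves it back.\<close>

lemma H1_dilate:
  assumes u: "u \<in> H1" and s: "0 < s"
  shows "(\<lambda>x. u (x / s)) \<in> H1" "L2_norm (weak_deriv (\<lambda>x. u (x / s))) = sqrt s / s * L2_norm (weak_deriv u)"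
proof -
  have w: "has_weak_deriv (\<lambda>x. u (x / s)) (\<lambda>x. of_real (1 / s) * weak_deriv u (x / s))"
    unfolding has_weak_deriv_def
  proof
    fix \<psi> assume \<psi>: "\<psi> \<in> test_functions"
    obtain \<psi>' where t: "\<psi>' \<in> test_functions" "\<And>x. (\<psi> has_vector_derivative \<psi>' x) (at x)"
      "\<And>x. vector_derivative \<psi> (at x) = \<psi>' x"
      using test_functionE[OF \<psi>] by metis
    have td: "(\<lambda>x. \<psi> (s * x)) \<in> test_functions"
      using test_dilate[OF \<psi>, of "1/s"] s by (simp add: mult.commute)
    have d: "((\<lambda>x. \<psi> (s * x)) has_vector_derivative of_real s * \<psi>' (s * x)) (at x)" for x
    proof -
      have "((\<lambda>x. s * x) has_vector_derivative s) (at x)"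
        by (auto intro!: derivative_eq_intros simp: has_real_derivative_iff_has_vector_derivative[symmetric])
      from vector_diff_chain_at[OF this t(2)] show ?thesis by (simp add: o_def scaleR_conv_of_real)
    qed
    have "(LINT x|Rpos. u (x / s) * \<psi>' x) = s *\<^sub>R (LINT x|Rpos. u x * \<psi>' (s * x))"
      using integral_Rpos_dilate(2)[OF s, of "\<lambda>x. u x * \<psi>' (s * x)"] s by simp
    also have "\<dots> = (LINT x|Rpos. u x * (of_real s * \<psi>' (s * x)))"
      by (simp add: scaleR_conv_of_real mult.left_commute)
    also have "\<dots> = - (LINT x|Rpos. weak_deriv u x * \<psi> (s * x))"
      by (rule has_weak_derivD[OF weak_deriv(2)[OF u] td d])
    also have "(LINT x|Rpos. weak_deriv u x * \<psi> (s * x)) = (1 / s) *\<^sub>R (LINT x|Rpos. weak_deriv u (x / s) * \<psi> x)"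
      using integral_Rpos_dilate(2)[OF s, of "\<lambda>x. weak_deriv u x * \<psi> (s * x)"] s by simp
    also have "\<dots> = (LINT x|Rpos. of_real (1 / s) * weak_deriv u (x / s) * \<psi> x)"
      by (simp add: scaleR_conv_of_real mult.assoc)
    finally show "(LINT x|Rpos. u (x / s) * vector_derivative \<psi> (at x)) =
       - (LINT x|Rpos. of_real (1 / s) * weak_deriv u (x / s) * \<psi> x)" unfolding t(3) .
  qed
  note * = weak_deriv_eqI[OF L2_dilate(1)[OF H1_L2[OF u] s] L2_cmult[OF L2_dilate(1)[OF weak_deriv(1)[OF u] s]] w]
  show "(\<lambda>x. u (x / s)) \<in> H1" by (rule *)
  show "L2_norm (weak_deriv (\<lambda>x. u (x / s))) = sqrt s / s * L2_norm (weak_deriv u)"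
    unfolding *(3) L2_norm_cmult L2_dilate(2)[OF weak_deriv(1)[OF u] s] using s by (simp add: norm_divide)
qed

lemma H10_dilate:
  assumes u: "u \<in> H10" and s: "0 < s"
  shows "(\<lambda>x. u (x / s)) \<in> H10"
proof (rule H10_closed[OF H1_dilate(1)[OF H10_H1[OF u] s]])
  fix e :: real assume e: "0 < e"
  define C where "C = sqrt s + sqrt s / s"
  have C: "0 < C" using s by (simp add: C_def add_pos_pos)
  obtain \<psi> where \<psi>: "\<psi> \<in> test_functions" "H1_norm (\<lambda>x. u x - \<psi> x) < e / C"
    using H10_approx[OF u, of "e / C"] e C by auto
  have d: "(\<lambda>x. u x - \<psi> x) \<in> H1" by (intro H1_diff(1) H10_H1 u test_in_H1 \<psi>)
  have "H1_norm (\<lambda>x. u (x / s) - \<psi> (x / s)) \<le> sqrt s * L2_norm (\<lambda>x. u x - \<psi> x) + sqrt s / s * L2_norm (weak_deriv (\<lambda>x. u x - \<psi> x))"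
    using H1_norm_le[of "\<lambda>x. u (x / s) - \<psi> (x / s)"] L2_dilate(2)[OF H1_L2[OF d] s] H1_dilate(2)[OF d s] by simp
  also have "\<dots> \<le> sqrt s * H1_norm (\<lambda>x. u x - \<psi> x) + sqrt s / s * H1_norm (\<lambda>x. u x - \<psi> x)"
    using s by (intro add_mono mult_left_mono L2_norm_le_H1_norm L2_norm_weak_deriv_le) auto
  also have "\<dots> = C * H1_norm (\<lambda>x. u x - \<psi> x)" by (simp add: C_def algebra_simps)
  also have "\<dots> < C * (e / C)" using \<psi>(2) C by (intro mult_strict_left_mono) auto
  also have "\<dots> = e" using C by simp
  finally show "\<exists>w\<in>H10. H1_norm (\<lambda>x. u (x / s) - w x) < e"
    by (intro bexI[OF _ test_H10[OF test_dilate[OF \<psi>(1) s]]])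
qed

section \<open>Uniqueness of solutions\<close>


text \<open>The nonlinearity |u|^(p-1) u for p = 5, with an integer exponent in place of
  \<open>powr\<close>; \<open>nls_op_eq\<close> makes the passage.\<close>

definition nls_power :: "complex \<Rightarrow> complex" where
  "nls_power z = of_real (cmod z ^ 4) * z"

text \<open>The difference splits as |a|^4 (a - b) + (|a|^4 - |b|^4) b. The first part contributes
  M^4, the second 4 M^4 through |a|^4 - |b|^4 = (|a| - |b|) (|a| + |b|) (|a|^2 + |b|^2).\<close>

lemma nls_power_lipschitz:
  assumes "cmod a \<le> M" "cmod b \<le> M"
  shows "cmod (nls_power a - nls_power b) \<le> 5 * M ^ 4 * cmod (a - b)"
proof -
  have M: "0 \<le> M" using assms(1) norm_ge_zero order_trans by blast
  have eq: "nls_power a - nls_power b = of_real (cmod a ^ 4) * (a - b) + of_real (cmod a ^ 4 - cmod b ^ 4) * b"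
    by (simp add: nls_power_def algebra_simps)
  have d: "cmod a ^ 4 - cmod b ^ 4 = (cmod a - cmod b) * ((cmod a + cmod b) * (cmod a ^ 2 + cmod b ^ 2))"
    by algebra
  have "\<bar>cmod a ^ 4 - cmod b ^ 4\<bar> = \<bar>cmod a - cmod b\<bar> * ((cmod a + cmod b) * (cmod a ^ 2 + cmod b ^ 2))"
    unfolding d abs_mult by simp
  also have "\<dots> \<le> cmod (a - b) * ((M + M) * (M ^ 2 + M ^ 2))"
    by (intro mult_mono add_mono power_mono norm_triangle_ineq3 assms) (use M in auto)
  finally have 1: "\<bar>cmod a ^ 4 - cmod b ^ 4\<bar> \<le> cmod (a - b) * (4 * M ^ 3)"
    by (simp add: power2_eq_square power3_eq_cube algebra_simps)
  have "cmod (nls_power a - nls_power b) \<le> cmod a ^ 4 * cmod (a - b) + \<bar>cmod a ^ 4 - cmod b ^ 4\<bar> * cmod b"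
    unfolding eq
    by (rule order_trans[OF norm_triangle_ineq]) (simp add: norm_mult norm_power del: of_real_diff of_real_power)
  also have "\<dots> \<le> M ^ 4 * cmod (a - b) + (cmod (a - b) * (4 * M ^ 3)) * M"
    by (intro add_mono mult_mono power_mono 1 assms) (use M in auto)
  also have "\<dots> = 5 * M ^ 4 * cmod (a - b)"
    by (simp add: power4_eq_xxxx power3_eq_cube algebra_simps)
  finally show ?thesis .
qed

lemma continuous_on_nls_power: "continuous_on A f \<Longrightarrow> continuous_on A (\<lambda>x. nls_power (f x))"
  unfolding nls_power_def by (intro continuous_intros)

lemma nls_power_measurable:
  assumes "u \<in> borel_measurable Rpos" shows "(\<lambda>x. nls_power (u x)) \<in> borel_measurable Rpos"
  by (rule measurable_compose[OF assms]) (intro borel_measurable_continuous_onI continuous_on_nls_power continuous_on_id)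

lemma nls_power_L2_diff:
  assumes u: "u \<in> L2" and v: "v \<in> L2" and M: "0 \<le> M"
    and b: "AE x in Rpos. cmod (u x) \<le> M" "AE x in Rpos. cmod (v x) \<le> M"
  shows "(\<lambda>x. nls_power (u x) - nls_power (v x)) \<in> L2"
    "L2_norm (\<lambda>x. nls_power (u x) - nls_power (v x)) \<le> 5 * M ^ 4 * L2_norm (\<lambda>x. u x - v x)"
proof -
  have m: "(\<lambda>x. nls_power (u x) - nls_power (v x)) \<in> borel_measurable Rpos"
    by (intro borel_measurable_diff nls_power_measurable L2_measurable u v)
  have ae: "AE x in Rpos. cmod (nls_power (u x) - nls_power (v x)) \<le> 5 * M ^ 4 * cmod (u x - v x)"
    using b by eventually_elim (rule nls_power_lipschitz)
  have M4: "0 \<le> 5 * M ^ 4" by simp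
  show "(\<lambda>x. nls_power (u x) - nls_power (v x)) \<in> L2"
    by (rule L2_bound(1)[OF L2_diff[OF u v] m M4 ae])
  show "L2_norm (\<lambda>x. nls_power (u x) - nls_power (v x)) \<le> 5 * M ^ 4 * L2_norm (\<lambda>x. u x - v x)"
    by (rule L2_bound(2)[OF L2_diff[OF u v] m M4 ae])
qed

lemma nls_power_L2:
  assumes u: "u \<in> H10" shows "(\<lambda>x. nls_power (u x)) \<in> L2"
  using nls_power_L2_diff(1)[OF H10_L2[OF u] L2_zero H1_norm_nonneg[of u] H10_bounded[OF u]]
  by (simp add: nls_power_def)

text \<open>Splitting 1 / x^2 into two factors 1 / x turns the potential term into an inner product
  of functions that lie in L2 by Hardy, so that all three terms obey Cauchy-Schwarz.\<close>

lemma nls_op_eq: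
  "nls_op c 5 u v = - L2_inner (weak_deriv u) (weak_deriv v)
     + of_real c * L2_inner (\<lambda>x. u x / of_real x) (\<lambda>x. v x / of_real x) + L2_inner (\<lambda>x. nls_power (u x)) v"
  unfolding nls_op_def L2_inner_def nls_power_def by (simp add: power2_eq_square)

lemma L2_inner_cong_AE:
  assumes "u \<in> L2" "u' \<in> L2" "v \<in> L2" "v' \<in> L2" "AE x in Rpos. u x = u' x" "AE x in Rpos. v x = v' x"
  shows "L2_inner u v = L2_inner u' v'"
  unfolding L2_inner_def
proof (rule integral_cong_AE)
  show "AE x in Rpos. u x * cnj (v x) = u' x * cnj (v' x)" using assms(5,6) by eventually_elim simp
qed (use L2_prod_integrable(3)[OF assms(1,3)] L2_prod_integrable(3)[OF assms(2,4)] in auto)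

lemma nls_op_diff_right:
  assumes "u \<in> H10" "v \<in> H10" "w \<in> H10"
  shows "nls_op c 5 u (\<lambda>x. v x - w x) = nls_op c 5 u v - nls_op c 5 u w"
proof -
  note h = assms[THEN H10_H1]
  have "L2_inner (weak_deriv u) (weak_deriv (\<lambda>x. v x - w x)) = L2_inner (weak_deriv u) (\<lambda>x. weak_deriv v x - weak_deriv w x)"
    by (rule L2_inner_cong_AE[OF weak_deriv(1) weak_deriv(1) weak_deriv(1) L2_diff _ H1_diff(2)])
       (use h in \<open>auto intro: H1_diff weak_deriv\<close>)
  also have "\<dots> = L2_inner (weak_deriv u) (weak_deriv v) - L2_inner (weak_deriv u) (weak_deriv w)"
    by (rule L2_inner_diff_right[OF h[THEN weak_deriv(1)]])
  finally have 1: "L2_inner (weak_deriv u) (weak_deriv (\<lambda>x. v x - w x)) = \<dots>" .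
  have 2: "L2_inner (\<lambda>x. u x / of_real x) (\<lambda>x. (v x - w x) / of_real x) =
    L2_inner (\<lambda>x. u x / of_real x) (\<lambda>x. v x / of_real x) - L2_inner (\<lambda>x. u x / of_real x) (\<lambda>x. w x / of_real x)"
    unfolding diff_divide_distrib by (rule L2_inner_diff_right[OF assms[THEN hardy(1)]])
  have 3: "L2_inner (\<lambda>x. nls_power (u x)) (\<lambda>x. v x - w x) =
    L2_inner (\<lambda>x. nls_power (u x)) v - L2_inner (\<lambda>x. nls_power (u x)) w"
    by (rule L2_inner_diff_right[OF nls_power_L2[OF assms(1)] assms(2,3)[THEN H10_L2]])
  show ?thesis unfolding nls_op_eq 1 2 3 by (simp add: algebra_simps)
qed

lemma nls_op_cmult_right:
  assumes "u \<in> H10" "v \<in> H10"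
  shows "nls_op c 5 u (\<lambda>x. z * v x) = cnj z * nls_op c 5 u v"
proof -
  note h = assms[THEN H10_H1]
  have "L2_inner (weak_deriv u) (weak_deriv (\<lambda>x. z * v x)) = L2_inner (weak_deriv u) (\<lambda>x. z * weak_deriv v x)"
    by (rule L2_inner_cong_AE[OF weak_deriv(1) weak_deriv(1) weak_deriv(1) L2_cmult _ H1_cmult(2)])
       (use h in \<open>auto intro: H1_cmult weak_deriv\<close>)
  also have "\<dots> = cnj z * L2_inner (weak_deriv u) (weak_deriv v)"
    by (rule L2_inner_cmult_right)
  finally have 1: "L2_inner (weak_deriv u) (weak_deriv (\<lambda>x. z * v x)) = \<dots>" .
  show ?thesis
    unfolding nls_op_eq 1 times_divide_eq_right[symmetric] L2_inner_cmult_right by (simp add: algebra_simps)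
qed

lemma nls_op_bounded:
  assumes u: "u \<in> H10"
  obtains K where "0 \<le> K" "\<And>v. v \<in> H10 \<Longrightarrow> cmod (nls_op c 5 u v) \<le> K * H1_norm v"
proof
  let ?K = "L2_norm (weak_deriv u) + \<bar>c\<bar> * (L2_norm (\<lambda>x. u x / of_real x) * 2) + L2_norm (\<lambda>x. nls_power (u x))"
  show "0 \<le> ?K" by simp
  fix v assume v: "v \<in> H10"
  have "cmod (nls_op c 5 u v) \<le> cmod (L2_inner (weak_deriv u) (weak_deriv v))
     + \<bar>c\<bar> * cmod (L2_inner (\<lambda>x. u x / of_real x) (\<lambda>x. v x / of_real x)) + cmod (L2_inner (\<lambda>x. nls_power (u x)) v)"
    unfolding nls_op_eq by (intro norm_triangle_le add_mono) (auto simp: norm_mult)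
  also have "\<dots> \<le> L2_norm (weak_deriv u) * L2_norm (weak_deriv v)
     + \<bar>c\<bar> * (L2_norm (\<lambda>x. u x / of_real x) * L2_norm (\<lambda>x. v x / of_real x)) + L2_norm (\<lambda>x. nls_power (u x)) * L2_norm v"
    by (intro add_mono mult_left_mono L2_inner_bound weak_deriv H10_H1 u v hardy(1) nls_power_L2 H10_L2) simp
  also have "\<dots> \<le> L2_norm (weak_deriv u) * H1_norm v
     + \<bar>c\<bar> * (L2_norm (\<lambda>x. u x / of_real x) * (2 * H1_norm v)) + L2_norm (\<lambda>x. nls_power (u x)) * H1_norm v"
    using order_trans[OF hardy(2)[OF v] mult_left_mono[OF L2_norm_weak_deriv_le, of 2]]
    by (intro add_mono mult_left_mono L2_norm_weak_deriv_le L2_norm_le_H1_norm) auto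
  finally show "cmod (nls_op c 5 u v) \<le> ?K * H1_norm v" by (simp add: algebra_simps)
qed

text \<open>\<open>Hm1_norm\<close> only sees the unit ball, and \<open>F\<close> is an arbitrary
  functional rather than a linear one; homogeneity at the single vector \<open>v\<close> is what
  scaling into the ball requires.\<close>

lemma Hm1_norm_bound:
  assumes v: "v \<in> H10" and r: "0 < r" "H1_norm v \<le> r"
    and hom: "F (\<lambda>x. of_real (1 / r) * v x) = of_real (1 / r) * F v"
  shows "ennreal (cmod (F v)) \<le> ennreal r * Hm1_norm F"
proof -
  let ?v = "\<lambda>x. of_real (1 / r) * v x"
  have "H1_norm ?v = cmod (of_real (1 / r)) * H1_norm v" by (rule H1_norm_cmult[OF H10_H1[OF v]])
  also have "\<dots> \<le> 1" using r by (simp add: norm_divide)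
  finally have "ennreal (cmod (F ?v)) \<le> Hm1_norm F"
    unfolding Hm1_norm_def using H10_cmult[OF v, of "of_real (1 / r)"] by (intro SUP_upper) simp
  then have "ennreal r * ennreal (cmod (F ?v)) \<le> ennreal r * Hm1_norm F"
    by (rule mult_left_mono) simp
  moreover have "ennreal r * ennreal (cmod (F ?v)) = ennreal (cmod (F v))"
    unfolding hom using r by (simp add: ennreal_mult[symmetric] norm_mult norm_divide)
  ultimately show ?thesis by simp
qed

text \<open>Convergence in the H^-1 norm is uniform over bounded sets of test vectors, so the vector
  may move with s. The energy estimate needs this for the difference of two solutions at time
  s.\<close>

lemma Hm1_derivative_limit:
  assumes d: "has_Hm1_derivative u F t"
    and hom: "\<And>v z. v \<in> H10 \<Longrightarrow> F (\<lambda>x. of_real z * v x) = of_real z * F v"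
    and v: "\<forall>\<^sub>F s in at t. v s \<in> H10 \<and> H1_norm (v s) \<le> R"
  shows "((\<lambda>s. (L2_inner (u s) (v s) - L2_inner (u t) (v s)) / of_real (s - t) - F (v s)) \<longlongrightarrow> 0) (at t)"
proof -
  define r where "r = \<bar>R\<bar> + 1"
  define G where "G = (\<lambda>s v. (L2_inner (u s) v - L2_inner (u t) v) / of_real (s - t) - F v)"
  have r: "0 < r" by (simp add: r_def)
  have lim: "((\<lambda>s. Hm1_norm (G s)) \<longlongrightarrow> 0) (at t)"
    using d unfolding has_Hm1_derivative_def G_def .
  have "((\<lambda>s. ennreal r * Hm1_norm (G s)) \<longlongrightarrow> ennreal r * 0) (at t)"
    by (rule ennreal_tendsto_cmult[OF _ lim]) simp
  then have lim': "((\<lambda>s. ennreal r * Hm1_norm (G s)) \<longlongrightarrow> 0) (at t)" by simp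
  have "((\<lambda>s. ennreal (cmod (G s (v s)))) \<longlongrightarrow> 0) (at t)"
  proof (rule tendsto_sandwich[OF _ _ tendsto_const lim'])
    show "\<forall>\<^sub>F s in at t. ennreal (cmod (G s (v s))) \<le> ennreal r * Hm1_norm (G s)"
      using v
    proof eventually_elim
      case (elim s)
      show ?case
      proof (rule Hm1_norm_bound)
        show "G s (\<lambda>x. of_real (1 / r) * v s x) = of_real (1 / r) * G s (v s)"
          unfolding G_def hom[OF conjunct1[OF elim]] L2_inner_cmult_right complex_cnj_complex_of_real
          by (simp add: algebra_simps diff_divide_distrib)
      qed (use elim r in \<open>auto simp: r_def\<close>)
    qed
  qed simp
  then have "((\<lambda>s. ennreal (cmod (G s (v s)))) \<longlongrightarrow> ennreal 0) (at t)" by simp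
  then have "((\<lambda>s. cmod (G s (v s))) \<longlongrightarrow> 0) (at t)"
    by (subst (asm) tendsto_ennreal_iff) auto
  then show ?thesis unfolding G_def tendsto_norm_zero_iff .
qed

section \<open>The energy estimate for the difference of two solutions\<close>

lemma time_interval_eq: "time_interval Tmin Tmax = einterval (- Tmin) Tmax"
  by (auto simp: time_interval_def einterval_def)

lemma eventually_time_interval:
  "t \<in> time_interval Tmin Tmax \<Longrightarrow> \<forall>\<^sub>F s in at t. s \<in> time_interval Tmin Tmax"
  unfolding time_interval_eq by (rule eventually_at_in_open') auto

text \<open>With w = u1 - u2 the derivative of ||w||^2 is 2 Re D, where D is the value at w(t) of
  the difference of the two H^-1 time derivatives. By the equation D is i times (a real number from
  the derivative and potential terms, plus the nonlinear term Z). Hence Re D = - Im Z, which the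
  Lipschitz bound controls by 5 M^4 ||w||^2.\<close>

lemma L2_norm_sq_has_derivative:
  assumes sol: "nls_solution c 5 u1 S1 T1" "nls_solution c 5 u2 S2 T2"
    and t: "t \<in> time_interval S1 T1" "t \<in> time_interval S2 T2"
  obtains D where "((\<lambda>s. (L2_norm (\<lambda>x. u1 s x - u2 s x))\<^sup>2) has_real_derivative D) (at t)"
    "\<bar>D\<bar> \<le> 10 * (max (H1_norm (u1 t)) (H1_norm (u2 t))) ^ 4 * (L2_norm (\<lambda>x. u1 t x - u2 t x))\<^sup>2"
proof -
  define w where "w = (\<lambda>s x. u1 s x - u2 s x)"
  have h1: "u1 s \<in> H10" if "s \<in> time_interval S1 T1" for s using sol(1) that by (auto simp: nls_solution_def)
  have h2: "u2 s \<in> H10" if "s \<in> time_interval S2 T2" for s using sol(2) that by (auto simp: nls_solution_def)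
  obtain F1 where F1: "has_Hm1_derivative u1 F1 t" "\<And>v. v \<in> H10 \<Longrightarrow> \<i> * F1 v + nls_op c 5 (u1 t) v = 0"
    using sol(1) t(1) unfolding nls_solution_def by blast
  obtain F2 where F2: "has_Hm1_derivative u2 F2 t" "\<And>v. v \<in> H10 \<Longrightarrow> \<i> * F2 v + nls_op c 5 (u2 t) v = 0"
    using sol(2) t(2) unfolding nls_solution_def by blast
  have sv: "a = \<i> * b" if "\<i> * a + b = 0" for a b
  proof -
    have "\<i> * (\<i> * a + b) = 0" using that by simp
    then show ?thesis by (simp add: algebra_simps)
  qed
  have F1': "F1 v = \<i> * nls_op c 5 (u1 t) v" if "v \<in> H10" for v by (rule sv[OF F1(2)[OF that]])
  have F2': "F2 v = \<i> * nls_op c 5 (u2 t) v" if "v \<in> H10" for v by (rule sv[OF F2(2)[OF that]])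
  \<comment> \<open>\<open>F1\<close> is known only through the equation, and only on
    \<open>H10\<close>; its homogeneity is inherited from \<open>nls_op\<close>.\<close>
  have hom1: "F1 (\<lambda>x. of_real z * v x) = of_real z * F1 v" if "v \<in> H10" for v z
    using F1'[OF that] F1'[OF H10_cmult[OF that]] nls_op_cmult_right[OF h1[OF t(1)] that] by simp
  have hom2: "F2 (\<lambda>x. of_real z * v x) = of_real z * F2 v" if "v \<in> H10" for v z
    using F2'[OF that] F2'[OF H10_cmult[OF that]] nls_op_cmult_right[OF h2[OF t(2)] that] by simp
  have ev: "\<forall>\<^sub>F s in at t. u1 s \<in> H10 \<and> u2 s \<in> H10"
    using eventually_time_interval[OF t(1)] eventually_time_interval[OF t(2)]
    by eventually_elim (use h1 h2 in blast)
  have wt: "w t \<in> H10" unfolding w_def by (rule H10_diff[OF h1[OF t(1)] h2[OF t(2)]])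
  have evw: "\<forall>\<^sub>F s in at t. w s \<in> H10" using ev unfolding w_def by eventually_elim (rule H10_diff, auto)
  have c1: "((\<lambda>s. H1_norm (\<lambda>x. u1 s x - u1 t x)) \<longlongrightarrow> 0) (at t)"
    using sol(1) t(1) by (auto simp: nls_solution_def)
  have c2: "((\<lambda>s. H1_norm (\<lambda>x. u2 s x - u2 t x)) \<longlongrightarrow> 0) (at t)"
    using sol(2) t(2) by (auto simp: nls_solution_def)
  have cw: "((\<lambda>s. H1_norm (\<lambda>x. w s x - w t x)) \<longlongrightarrow> 0) (at t)"
  proof (rule tendsto_sandwich[OF _ _ tendsto_const])
    show "((\<lambda>s. H1_norm (\<lambda>x. u1 s x - u1 t x) + H1_norm (\<lambda>x. u2 s x - u2 t x)) \<longlongrightarrow> 0) (at t)"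
      using tendsto_add[OF c1 c2] by simp
    show "\<forall>\<^sub>F s in at t. H1_norm (\<lambda>x. w s x - w t x) \<le> H1_norm (\<lambda>x. u1 s x - u1 t x) + H1_norm (\<lambda>x. u2 s x - u2 t x)"
      using ev
    proof eventually_elim
      case (elim s)
      have "(\<lambda>x. w s x - w t x) = (\<lambda>x. (u1 s x - u1 t x) - (u2 s x - u2 t x))" by (auto simp: w_def)
      then show ?case
        using H1_norm_triangle_diff[OF H1_diff(1)[OF H10_H1 H10_H1] H1_diff(1)[OF H10_H1 H10_H1],
            OF conjunct1[OF elim] h1[OF t(1)] conjunct2[OF elim] h2[OF t(2)]] by simp
    qed
  qed simp
  have evb: "\<forall>\<^sub>F s in at t. w s \<in> H10 \<and> H1_norm (w s) \<le> H1_norm (w t) + 1"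
    using evw order_tendstoD(2)[OF cw zero_less_one]
  proof eventually_elim
    case (elim s)
    then show ?case using H1_norm_abs_diff[OF H10_H1[OF elim(1)] H10_H1[OF wt]] by auto
  qed
  have evc: "\<forall>\<^sub>F s in at t. w t \<in> H10 \<and> H1_norm (w t) \<le> H1_norm (w t)" using wt by simp
  define D where "D = F1 (w t) - F2 (w t)"
  \<comment> \<open>Stated for a moving test vector, because it is applied to both
    \<open>w s\<close> and the fixed \<open>w t\<close>.\<close>
  have lw: "((\<lambda>s. L2_inner (\<lambda>x. w s x - w t x) (v s) / of_real (s - t) - (F1 (v s) - F2 (v s))) \<longlongrightarrow> 0) (at t)"
    if v: "\<forall>\<^sub>F s in at t. v s \<in> H10 \<and> H1_norm (v s) \<le> R" for v R
  proof -
    note l = tendsto_diff[OF Hm1_derivative_limit[OF F1(1) hom1 v] Hm1_derivative_limit[OF F2(1) hom2 v]]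
    have "\<forall>\<^sub>F s in at t. (L2_inner (u1 s) (v s) - L2_inner (u1 t) (v s)) / of_real (s - t) - F1 (v s)
       - ((L2_inner (u2 s) (v s) - L2_inner (u2 t) (v s)) / of_real (s - t) - F2 (v s))
       = L2_inner (\<lambda>x. w s x - w t x) (v s) / of_real (s - t) - (F1 (v s) - F2 (v s))"
      using ev evw v
    proof eventually_elim
      case (elim s)

      have vs: "v s \<in> L2" and us: "u1 s \<in> L2" "u2 s \<in> L2" using elim H10_L2 by blast+
      have "L2_inner (\<lambda>x. w s x - w t x) (v s) = (L2_inner (u1 s) (v s) - L2_inner (u2 s) (v s)) - (L2_inner (u1 t) (v s) - L2_inner (u2 t) (v s))"
        unfolding w_def
        by (subst L2_inner_diff_left) (use us vs h1[OF t(1), THEN H10_L2] h2[OF t(2), THEN H10_L2] in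
           \<open>auto intro: L2_diff simp: L2_inner_diff_left\<close>)
      then show ?case by (simp only: diff_divide_distrib) (simp add: algebra_simps)
    qed
    from Lim_transform_eventually[OF l this] show ?thesis by simp
  qed
  \<comment> \<open>\<open>F1\<close> and \<open>F2\<close> are bounded on \<open>H10\<close> by the
    equation, and \<open>w s\<close> tends to \<open>w t\<close> in H1; hence testing with
    \<open>w s\<close> or with \<open>w t\<close> leads to the same limit \<open>D\<close>.\<close>
  have Fcont: "((\<lambda>s. F1 (w s) - F2 (w s)) \<longlongrightarrow> D) (at t)"
  proof -
    obtain K1 where K1: "0 \<le> K1" "\<And>v. v \<in> H10 \<Longrightarrow> cmod (nls_op c 5 (u1 t) v) \<le> K1 * H1_norm v"
      using nls_op_bounded[OF h1[OF t(1)]] by blast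
    obtain K2 where K2: "0 \<le> K2" "\<And>v. v \<in> H10 \<Longrightarrow> cmod (nls_op c 5 (u2 t) v) \<le> K2 * H1_norm v"
      using nls_op_bounded[OF h2[OF t(2)]] by blast
    have "((\<lambda>s. (F1 (w s) - F2 (w s)) - D) \<longlongrightarrow> 0) (at t)"
    proof (rule Lim_null_comparison)
      show "((\<lambda>s. (K1 + K2) * H1_norm (\<lambda>x. w s x - w t x)) \<longlongrightarrow> 0) (at t)"
        by (rule tendsto_mult_right_zero[OF cw])
      show "\<forall>\<^sub>F s in at t. norm ((F1 (w s) - F2 (w s)) - D) \<le> (K1 + K2) * H1_norm (\<lambda>x. w s x - w t x)"
        using evw
      proof eventually_elim
        case (elim s)
        have wd: "(\<lambda>x. w s x - w t x) \<in> H10" by (rule H10_diff[OF elim wt])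
        have "(F1 (w s) - F2 (w s)) - D = \<i> * (nls_op c 5 (u1 t) (\<lambda>x. w s x - w t x) - nls_op c 5 (u2 t) (\<lambda>x. w s x - w t x))"
          unfolding D_def F1'[OF elim] F1'[OF wt] F2'[OF elim] F2'[OF wt]
            nls_op_diff_right[OF h1[OF t(1)] elim wt] nls_op_diff_right[OF h2[OF t(2)] elim wt]
          by (simp add: algebra_simps)
        then have "norm ((F1 (w s) - F2 (w s)) - D) \<le> cmod (nls_op c 5 (u1 t) (\<lambda>x. w s x - w t x)) + cmod (nls_op c 5 (u2 t) (\<lambda>x. w s x - w t x))"
          by (simp add: norm_mult norm_triangle_ineq4)
        also have "\<dots> \<le> (K1 + K2) * H1_norm (\<lambda>x. w s x - w t x)"
          using K1(2)[OF wd] K2(2)[OF wd] by (simp add: distrib_right)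
        finally show ?case .
      qed
    qed
    then show ?thesis by (simp add: LIM_zero_iff)
  qed
  have l1: "((\<lambda>s. L2_inner (\<lambda>x. w s x - w t x) (w s) / of_real (s - t)) \<longlongrightarrow> D) (at t)"
    using tendsto_add[OF lw[OF evb] Fcont] by simp
  have l2: "((\<lambda>s. L2_inner (\<lambda>x. w s x - w t x) (w t) / of_real (s - t)) \<longlongrightarrow> D) (at t)"
    using tendsto_add[OF lw[OF evc] tendsto_const[of D]] by (simp add: D_def)
  \<comment> \<open>The mixed terms cancel in <w(s) - w(t), w(s)> + cnj <w(s) - w(t), w(t)>, leaving
    ||w(s)||^2 - ||w(t)||^2.\<close>
  have l3: "((\<lambda>s. L2_inner (\<lambda>x. w s x - w t x) (w s) / of_real (s - t)
      + cnj (L2_inner (\<lambda>x. w s x - w t x) (w t) / of_real (s - t))) \<longlongrightarrow> D + cnj D) (at t)"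
    by (intro tendsto_add l1 tendsto_cnj l2)
  have "((\<lambda>s. Re (L2_inner (\<lambda>x. w s x - w t x) (w s) / of_real (s - t)
      + cnj (L2_inner (\<lambda>x. w s x - w t x) (w t) / of_real (s - t)))) \<longlongrightarrow> Re (D + cnj D)) (at t)"
    by (rule tendsto_Re[OF l3])
  moreover have "\<forall>\<^sub>F s in at t. Re (L2_inner (\<lambda>x. w s x - w t x) (w s) / of_real (s - t)
      + cnj (L2_inner (\<lambda>x. w s x - w t x) (w t) / of_real (s - t))) = ((L2_norm (w s))\<^sup>2 - (L2_norm (w t))\<^sup>2) / (s - t)"
    using evw
  proof eventually_elim
    case (elim s)
    note m = elim[THEN H10_L2] wt[THEN H10_L2]
    have "L2_inner (\<lambda>x. w s x - w t x) (w s) + cnj (L2_inner (\<lambda>x. w s x - w t x) (w t))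
        = of_real ((L2_norm (w s))\<^sup>2 - (L2_norm (w t))\<^sup>2)"
      unfolding L2_inner_diff_left[OF m m(1)] L2_inner_diff_left[OF m m(2)] L2_inner_self
        L2_inner_commute[of "w t" "w s"] by simp
    then have "(L2_inner (\<lambda>x. w s x - w t x) (w s) + cnj (L2_inner (\<lambda>x. w s x - w t x) (w t))) / of_real (s - t)
        = of_real (((L2_norm (w s))\<^sup>2 - (L2_norm (w t))\<^sup>2) / (s - t))" by simp
    then show ?case by (simp only: complex_cnj_divide complex_cnj_complex_of_real add_divide_distrib[symmetric] Re_complex_of_real)
  qed
  ultimately have "((\<lambda>s. ((L2_norm (w s))\<^sup>2 - (L2_norm (w t))\<^sup>2) / (s - t)) \<longlongrightarrow> 2 * Re D) (at t)"
    by (subst (asm) tendsto_cong) auto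
  then have der: "((\<lambda>s. (L2_norm (w s))\<^sup>2) has_real_derivative 2 * Re D) (at t)"
    by (simp add: has_field_derivative_iff)
  define M where "M = max (H1_norm (u1 t)) (H1_norm (u2 t))"
  have M: "0 \<le> M" by (simp add: M_def le_max_iff_disj)
  note a1 = h1[OF t(1)] and a2 = h2[OF t(2)]
  have b1: "AE x in Rpos. cmod (u1 t x) \<le> M" using H10_bounded[OF a1] by eventually_elim (simp add: M_def)
  have b2: "AE x in Rpos. cmod (u2 t x) \<le> M" using H10_bounded[OF a2] by eventually_elim (simp add: M_def)
  define Z where "Z = L2_inner (\<lambda>x. nls_power (u1 t x) - nls_power (u2 t x)) (w t)"
  have Z: "cmod Z \<le> 5 * M ^ 4 * L2_norm (w t) * L2_norm (w t)"
    unfolding Z_def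
    by (rule order_trans[OF L2_inner_bound[OF nls_power_L2_diff(1)[OF H10_L2[OF a1] H10_L2[OF a2] M b1 b2] H10_L2[OF wt]]])
       (use nls_power_L2_diff(2)[OF H10_L2[OF a1] H10_L2[OF a2] M b1 b2] in
         \<open>auto intro!: mult_right_mono simp: w_def\<close>)
  have e1: "L2_inner (weak_deriv (u1 t)) (weak_deriv (w t)) - L2_inner (weak_deriv (u2 t)) (weak_deriv (w t))
      = of_real ((L2_norm (weak_deriv (w t)))\<^sup>2)"
  proof -
    note d = a1[THEN H10_H1, THEN weak_deriv(1)] a2[THEN H10_H1, THEN weak_deriv(1)] wt[THEN H10_H1, THEN weak_deriv(1)]
    have "L2_inner (weak_deriv (w t)) (weak_deriv (w t)) = L2_inner (\<lambda>x. weak_deriv (u1 t) x - weak_deriv (u2 t) x) (weak_deriv (w t))"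
      by (rule L2_inner_cong_AE[OF d(3) L2_diff[OF d(1,2)] d(3) d(3)])
         (use H1_diff(2)[OF a1[THEN H10_H1] a2[THEN H10_H1]] in \<open>simp_all add: w_def\<close>)
    then show ?thesis unfolding L2_inner_self L2_inner_diff_left[OF d] by simp
  qed
  have e2: "L2_inner (\<lambda>x. u1 t x / of_real x) (\<lambda>x. w t x / of_real x) - L2_inner (\<lambda>x. u2 t x / of_real x) (\<lambda>x. w t x / of_real x)
      = of_real ((L2_norm (\<lambda>x. w t x / of_real x))\<^sup>2)"
    unfolding L2_inner_self[symmetric] L2_inner_diff_left[OF hardy(1)[OF a1] hardy(1)[OF a2] hardy(1)[OF wt], symmetric]
    by (simp add: w_def diff_divide_distrib)
  have e3: "L2_inner (\<lambda>x. nls_power (u1 t x)) (w t) - L2_inner (\<lambda>x. nls_power (u2 t x)) (w t) = Z"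
    unfolding Z_def by (rule L2_inner_diff_left[symmetric, OF nls_power_L2[OF a1] nls_power_L2[OF a2] H10_L2[OF wt]])
  have "nls_op c 5 (u1 t) (w t) - nls_op c 5 (u2 t) (w t) =
      - of_real ((L2_norm (weak_deriv (w t)))\<^sup>2) + of_real c * of_real ((L2_norm (\<lambda>x. w t x / of_real x))\<^sup>2) + Z"
    unfolding e1[symmetric] e2[symmetric] e3[symmetric] nls_op_eq by (simp add: algebra_simps)
  then have "D = \<i> * (of_real (- (L2_norm (weak_deriv (w t)))\<^sup>2 + c * (L2_norm (\<lambda>x. w t x / of_real x))\<^sup>2) + Z)"
    unfolding D_def F1'[OF wt] F2'[OF wt] right_diff_distrib[symmetric] by simp
  \<comment> \<open>Here the potential drops out together with the derivative term: both are real
    and are multiplied by i.\<close>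
  then have "Re D = - Im Z" by (simp del: of_real_add of_real_power of_real_mult of_real_minus of_real_diff)
  then have "\<bar>2 * Re D\<bar> \<le> 2 * cmod Z" using abs_Im_le_cmod[of Z] by simp
  also have "\<dots> \<le> 10 * M ^ 4 * (L2_norm (w t))\<^sup>2" using Z by (simp add: power2_eq_square mult_ac)
  finally show thesis using that[OF der[unfolded w_def]] unfolding M_def w_def by simp
qed

text \<open>The function exp (- K t) f(t) is nonincreasing and starts at 0.\<close>

lemma gronwall_zero:
  fixes f f' :: "real \<Rightarrow> real"
  assumes T: "0 \<le> T" and f: "\<And>t. 0 \<le> t \<Longrightarrow> t \<le> T \<Longrightarrow> (f has_real_derivative f' t) (at t)"
    and le: "\<And>t. 0 \<le> t \<Longrightarrow> t \<le> T \<Longrightarrow> f' t \<le> K * f t" and "f 0 = 0"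
  shows "f T \<le> 0"
proof -
  have "exp (- K * T) * f T \<le> exp (- K * 0) * f 0"
  proof (rule DERIV_nonpos_imp_nonincreasing[OF T])
    fix t assume t: "0 \<le> t" "t \<le> T"
    have "((\<lambda>t. exp (- K * t) * f t) has_real_derivative exp (- K * t) * (f' t - K * f t)) (at t)"
      by (rule derivative_eq_intros f t refl | simp)+ (simp add: algebra_simps)
    moreover have "exp (- K * t) * (f' t - K * f t) \<le> 0"
      using le[OF t] by (intro mult_nonneg_nonpos) auto
    ultimately show "\<exists>y. ((\<lambda>t. exp (- K * t) * f t) has_real_derivative y) (at t) \<and> y \<le> 0" by blast
  qed
  then show ?thesis using \<open>f 0 = 0\<close> by (simp add: mult_le_0_iff)
qed

lemma H1_norm_continuous_on:
  assumes sol: "nls_solution c 5 u S T" and A: "A \<subseteq> time_interval S T"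
  shows "continuous_on A (\<lambda>t. H1_norm (u t))"
proof (intro continuous_at_imp_continuous_on ballI)
  fix t assume "t \<in> A"
  then have t: "t \<in> time_interval S T" using A by blast
  have h: "u s \<in> H10" if "s \<in> time_interval S T" for s using sol that by (auto simp: nls_solution_def)
  have "((\<lambda>s. H1_norm (u s) - H1_norm (u t)) \<longlongrightarrow> 0) (at t)"
  proof (rule Lim_null_comparison)
    show "((\<lambda>s. H1_norm (\<lambda>x. u s x - u t x)) \<longlongrightarrow> 0) (at t)" using sol t by (auto simp: nls_solution_def)
    show "\<forall>\<^sub>F s in at t. norm (H1_norm (u s) - H1_norm (u t)) \<le> H1_norm (\<lambda>x. u s x - u t x)"
      using eventually_time_interval[OF t]
      by eventually_elim (use H1_norm_abs_diff[OF H10_H1[OF h] H10_H1[OF h[OF t]]] in simp)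
  qed
  then show "isCont (\<lambda>t. H1_norm (u t)) t" unfolding isCont_def by (simp add: LIM_zero_iff)
qed

text \<open>Between 0 and t both H1 norms are bounded, being continuous on a compact interval; this
  makes the factor in the energy estimate a constant \<open>K\<close>, and Gronwall's argument
  forces the L2 distance to stay 0.\<close>

lemma nls_unique:
  assumes sol: "nls_solution c 5 u1 S1 T1" "nls_solution c 5 u2 S2 T2"
    and t: "t \<in> time_interval S1 T1" "t \<in> time_interval S2 T2"
    and init: "AE x in Rpos. u1 0 x = u2 0 x"
  shows "AE x in Rpos. u1 t x = u2 t x"
proof -
  define A where "A = {min 0 t..max 0 t}"
  have pos: "0 < S1" "0 < T1" "0 < S2" "0 < T2" using sol by (auto simp: nls_solution_def)
  have A: "s \<in> time_interval S T" if "s \<in> A" "0 < S" "0 < T" "t \<in> time_interval S T" for s S T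
  proof -
    have n: "- S < ereal 0" using that(2) by (simp add: ereal_uminus_less_reorder zero_ereal_def[symmetric])
    have p: "ereal 0 < T" using that(3) by (simp add: zero_ereal_def[symmetric])
    have "- S < ereal (min 0 t)" using n that(4) by (simp add: time_interval_def min_def)
    also have "\<dots> \<le> ereal s" using that(1) unfolding A_def ereal_less_eq by simp
    finally have 1: "- S < ereal s" .
    have "ereal s \<le> ereal (max 0 t)" using that(1) unfolding A_def ereal_less_eq by simp
    also have "\<dots> < T" using p that(4) by (simp add: time_interval_def max_def)
    finally show ?thesis using 1 by (simp add: time_interval_def)
  qed
  have A1: "A \<subseteq> time_interval S1 T1" and A2: "A \<subseteq> time_interval S2 T2"
    using A pos t by blast+
  have cA: "compact A" by (simp add: A_def)
  obtain M1 where M1: "\<And>s. s \<in> A \<Longrightarrow> H1_norm (u1 s) \<le> M1"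
    using compact_continuous_image[OF H1_norm_continuous_on[OF sol(1) A1] cA, THEN compact_imp_bounded]
    unfolding bounded_real by (metis abs_le_D1 imageI)
  obtain M2 where M2: "\<And>s. s \<in> A \<Longrightarrow> H1_norm (u2 s) \<le> M2"
    using compact_continuous_image[OF H1_norm_continuous_on[OF sol(2) A2] cA, THEN compact_imp_bounded]
    unfolding bounded_real by (metis abs_le_D1 imageI)
  define K where "K = 10 * (max M1 M2) ^ 4"
  define f where "f = (\<lambda>s. (L2_norm (\<lambda>x. u1 s x - u2 s x))\<^sup>2)"
  have "\<exists>D. (f has_real_derivative D) (at s) \<and> \<bar>D\<bar> \<le> K * f s" if "s \<in> A" for s
  proof -
    obtain D where D: "(f has_real_derivative D) (at s)"
      "\<bar>D\<bar> \<le> 10 * (max (H1_norm (u1 s)) (H1_norm (u2 s))) ^ 4 * f s"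
      using L2_norm_sq_has_derivative[OF sol] A1 A2 \<open>s \<in> A\<close> unfolding f_def by blast
    have "10 * (max (H1_norm (u1 s)) (H1_norm (u2 s))) ^ 4 * f s \<le> K * f s"
      unfolding K_def using M1[OF that] M2[OF that]
      by (intro mult_right_mono mult_left_mono power_mono max.mono) (auto simp: f_def le_max_iff_disj)
    with D show ?thesis by (intro exI[of _ D]) auto
  qed
  then obtain D where D: "\<And>s. s \<in> A \<Longrightarrow> (f has_real_derivative D s) (at s)" "\<And>s. s \<in> A \<Longrightarrow> \<bar>D s\<bar> \<le> K * f s"
    by metis
  have h: "u1 s \<in> H10" "u2 s \<in> H10" if "s \<in> A" for s
    using sol A1 A2 that by (auto simp: nls_solution_def)
  have zA: "0 \<in> A" "t \<in> A" by (auto simp: A_def)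
  have L2d: "(\<lambda>x. u1 s x - u2 s x) \<in> L2" if "s \<in> A" for s by (intro L2_diff H10_L2 h that)
  have f0: "f 0 = 0" using L2_norm_eq_0_iff[OF L2d[OF zA(1)]] init by (simp add: f_def)
  have "f t \<le> 0"
  proof (cases "0 \<le> t")
    case True
    show ?thesis
    proof (rule gronwall_zero[where f = f and f' = D and K = K, OF True _ _ f0])
      fix s assume "0 \<le> s" "s \<le> t"
      then have "s \<in> A" by (simp add: A_def le_max_iff_disj)
      then show "(f has_real_derivative D s) (at s)" "D s \<le> K * f s" using D[of s] by auto
    qed
  next
    case False
    \<comment> \<open>Time is reflected. The estimate bounds the absolute value of the derivative,
      so it works in both directions.\<close>
    have "f (- (- t)) \<le> 0"
    proof (rule gronwall_zero[where T = "- t" and f = "\<lambda>s. f (- s)" and f' = "\<lambda>s. - D (- s)" and K = K])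
      fix s assume "0 \<le> s" "s \<le> - t"
      then have s: "- s \<in> A" by (simp add: A_def min_le_iff_disj le_max_iff_disj)
      show "((\<lambda>s. f (- s)) has_real_derivative - D (- s)) (at s)"
        using DERIV_chain2[OF D(1)[OF s] DERIV_minus[OF DERIV_ident]] by simp
      show "- D (- s) \<le> K * f (- s)" using D(2)[OF s] by auto
    qed (use False f0 in auto)
    then show ?thesis by simp
  qed
  then have "L2_norm (\<lambda>x. u1 t x - u2 t x) = 0" by (simp add: f_def)
  then show ?thesis using L2_norm_eq_0_iff[OF L2d[OF zA(2)]] by simp
qed

section \<open>Regularity and decay of stationary solutions\<close>


lemma smooth_cnj: assumes "smooth f" shows "smooth (\<lambda>x. cnj (f x))"
proof -
  obtain D where D: "D 0 = f" "\<And>n x. (D n has_vector_derivative D (Suc n) x) (at x)"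
    using assms unfolding smooth_def by blast
  show ?thesis unfolding smooth_def
    by (intro exI[of _ "\<lambda>n x. cnj (D n x)"] conjI allI has_vector_derivative_cnj D(2)) (simp add: D(1))
qed

lemma test_cnj: "\<psi> \<in> test_functions \<Longrightarrow> (\<lambda>x. cnj (\<psi> x)) \<in> test_functions"
  unfolding test_functions_iff using smooth_cnj by force

lemma test_integrable: "\<psi> \<in> test_functions \<Longrightarrow> integrable Rpos \<psi>"
  using loc_integrable_mult_test(2)[of "\<lambda>_. 1" \<psi>] loc_integrable_continuous[of "\<lambda>_. 1"] by simp

text \<open>A primitive that starts at 0 to the left of the support is constant to its right, and
  the constant is the integral; zero mean is therefore what compact support of the primitive
  requires.\<close>

lemma test_antiderivative:
  assumes \<theta>: "\<theta> \<in> test_functions" and z: "(LINT x|Rpos. \<theta> x) = 0"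
  obtains \<Theta> where "\<Theta> \<in> test_functions" "\<And>x. (\<Theta> has_vector_derivative \<theta> x) (at x)"
proof -
  obtain a b where ab: "0 < a" "a < b" "smooth \<theta>" "\<And>x. x \<notin> {a..b} \<Longrightarrow> \<theta> x = 0"
    using test_functionE[OF \<theta>] by metis
  have cont: "continuous_on A \<theta>" for A by (rule smooth_imp_continuous[OF ab(3)])
  have "isCont \<theta> x" for x using cont[of UNIV] by (simp add: continuous_on_eq_continuous_at)
  then obtain F where F: "\<And>x. (F has_vector_derivative \<theta> x) (at x)"
    using einterval_antiderivative[of "-\<infinity>" \<infinity> \<theta>] by auto
  have FTC: "(\<theta> has_integral F q - F p) {p..q}" if "p \<le> q" for p q
    by (rule fundamental_theorem_of_calculus[OF that]) (rule has_vector_derivative_at_within[OF F])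
  \<comment> \<open>The base point of the primitive lies to the left of the support and is still
    positive.\<close>
  define a' where "a' = a / 2"
  have a': "0 < a'" "a' < a" using ab by (auto simp: a'_def)
  define \<Theta> where "\<Theta> = (\<lambda>x. F x - F a')"
  have d: "(\<Theta> has_vector_derivative \<theta> x) (at x)" for x
    unfolding \<Theta>_def using has_vector_derivative_diff[OF F has_vector_derivative_const] by simp
  have z0: "F q = F p" if "p \<le> q" "q < a" for p q
  proof -
    have "(\<theta> has_integral 0) {p..q}"
      by (rule has_integral_is_0) (use that ab(4) in auto)
    from has_integral_unique[OF this FTC[OF that(1)]] show ?thesis by simp
  qed
  have z1: "F x = F a'" if "b < x" for x
  proof -
    have si: "set_integrable lebesgue {a'..x} \<theta>" by (rule absolutely_integrable_continuous_real[OF cont])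
    have eq: "indicator {0<..} y *\<^sub>R \<theta> y = indicator {a'..x} y *\<^sub>R \<theta> y" for y
      using ab(4)[of y] a' that ab(1) by (cases "y \<in> {a..b}") (auto simp: indicator_def)
    have "(LINT y|Rpos. \<theta> y) = (LINT y:{a'..x}|lebesgue. \<theta> y)"
      unfolding integral_Rpos_eq set_lebesgue_integral_def eq ..
    also have "\<dots> = integral {a'..x} \<theta>" by (rule set_lebesgue_integral_eq_integral[OF si])
    also have "\<dots> = F x - F a'" using a' ab that by (intro integral_unique FTC) simp
    finally show ?thesis using z by simp
  qed
  have "\<Theta> \<in> test_functions"
  proof (rule test_functionsI[OF smooth_antiderivative[OF ab(3) d] ab(1,2)])
    show "\<Theta> x = 0" if "x \<notin> {a..b}" for x
    proof (cases "b < x")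
      case True then show ?thesis using z1 by (simp add: \<Theta>_def)
    next
      case False
      then have "x < a" using that by auto
      then show ?thesis using z0[of x a'] z0[of a' x] a' by (cases "x \<le> a'") (auto simp: \<Theta>_def)
    qed
  qed
  then show thesis using that d by blast
qed

lemma interval_bump_integral_pos:
  assumes "0 < a" "a < b"
  shows "(LINT x|Rpos. complex_of_real (interval_bump a b 1 x)) \<noteq> 0"
proof
  assume z: "(LINT x|Rpos. complex_of_real (interval_bump a b 1 x)) = 0"
  have i: "integrable Rpos (\<lambda>x. interval_bump a b 1 x)"
    using test_integrable[OF interval_bump_test[OF assms, of 1]] by (simp only: complex_of_real_integrable_eq zero_less_one simp_thms)
  have "(LINT x|Rpos. interval_bump a b 1 x) = 0" using z by simp
  then have "AE x in Rpos. interval_bump a b 1 x = 0"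
    by (subst (asm) integral_nonneg_eq_0_iff_AE[OF i]) (simp_all add: interval_bump_nonneg)
  then have "AE x in lebesgue. x \<notin> {a<..<b}"
    unfolding AE_Rpos_iff
  proof eventually_elim
    case (elim x)
    then show ?case using interval_bump_pos[of a x b 1] assms by force
  qed
  then have "{a<..<b} \<in> null_sets lebesgue"
    by (subst (asm) AE_iff_null_sets[symmetric]) auto
  then have "emeasure lebesgue {a<..<b} = 0" by (rule null_setsD1)
  then show False using assms by simp
qed

text \<open>Subtracting a multiple of a fixed bump \<open>e\<close> gives any test function zero
  mean, hence makes it the derivative of a test function. Testing \<open>K\<close> with it shows
  that \<open>K - k\<close> annihilates all test functions, where \<open>k\<close> is the mean of
  \<open>K\<close> weighted by \<open>e\<close>.\<close>

lemma du_Bois_Reymond: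
  assumes K: "loc_integrable K"
    and z: "\<And>\<psi> \<psi>'. \<psi> \<in> test_functions \<Longrightarrow> \<psi>' \<in> test_functions \<Longrightarrow>
      (\<And>x. (\<psi> has_vector_derivative \<psi>' x) (at x)) \<Longrightarrow> (LINT x|Rpos. K x * \<psi>' x) = 0"
  obtains k where "AE x in Rpos. K x = k"
proof -
  define e where "e = (\<lambda>x. complex_of_real (interval_bump 1 2 1 x))"
  define I where "I = (LINT x|Rpos. e x)"
  have I: "I \<noteq> 0" unfolding I_def e_def by (rule interval_bump_integral_pos) auto
  have e: "e \<in> test_functions" unfolding e_def by (rule interval_bump_test) auto
  define k where "k = (LINT x|Rpos. K x * e x) / I"
  have Kk: "loc_integrable (\<lambda>x. K x - k)"
    unfolding loc_integrable_def
  proof (intro allI impI)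
    fix a b :: real assume "0 < a" "a < b"
    show "set_integrable lebesgue {a..b} (\<lambda>x. K x - k)"
      by (rule set_integral_diff(1)[OF loc_integrableD[OF K \<open>0 < a\<close>]])
         (rule absolutely_integrable_continuous_real, rule continuous_on_const)
  qed
  have "AE x in Rpos. K x - k = 0"
  proof (rule fundamental_lemma[OF Kk])
    fix \<eta> assume \<eta>: "\<eta> \<in> test_functions"
    define m where "m = (LINT x|Rpos. \<eta> x) / I"
    define \<theta> where "\<theta> = (\<lambda>x. \<eta> x - m * e x)"
    have \<theta>: "\<theta> \<in> test_functions" unfolding \<theta>_def by (intro test_functions_diff test_functions_cmult e \<eta>)
    have "(LINT x|Rpos. \<theta> x) = (LINT x|Rpos. \<eta> x) - m * I"
      unfolding \<theta>_def I_def using test_integrable[OF \<eta>] test_integrable[OF e] by simp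
    then have "(LINT x|Rpos. \<theta> x) = 0" using I by (simp add: m_def)
    then obtain \<Theta> where "\<Theta> \<in> test_functions" "\<And>x. (\<Theta> has_vector_derivative \<theta> x) (at x)"
      using test_antiderivative[OF \<theta>] by blast
    from z[OF this(1) \<theta> this(2)] have "(LINT x|Rpos. K x * \<theta> x) = 0" .
    moreover have "(LINT x|Rpos. K x * \<theta> x) = (LINT x|Rpos. K x * \<eta> x) - m * (LINT x|Rpos. K x * e x)"
      unfolding \<theta>_def right_diff_distrib mult.left_commute[of _ m]
      using loc_integrable_mult_test(2)[OF K \<eta>] loc_integrable_mult_test(2)[OF K e] by simp
    moreover have "m * (LINT x|Rpos. K x * e x) = k * (LINT x|Rpos. \<eta> x)"
      by (simp add: m_def k_def)
    ultimately have "(LINT x|Rpos. K x * \<eta> x) - k * (LINT x|Rpos. \<eta> x) = 0" by simp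
    then show "(LINT x|Rpos. (K x - k) * \<eta> x) = 0"
      unfolding left_diff_distrib using loc_integrable_mult_test(2)[OF K \<eta>] test_integrable[OF \<eta>] by simp
  qed
  then show thesis using that[of k] by simp
qed

text \<open>\<open>f\<close> and a primitive \<open>H\<close> of the continuous function
  \<open>h\<close> have the same weak derivative, so they differ by a constant.\<close>

lemma weak_deriv_classical:
  assumes f: "loc_integrable f" and w: "has_weak_deriv f f'" and ae: "AE x in Rpos. f' x = h x"
    and h: "continuous_on {0<..} h" and f': "f' \<in> borel_measurable Rpos"
  obtains g where "\<And>x. 0 < x \<Longrightarrow> (g has_vector_derivative h x) (at x)" "AE x in Rpos. f x = g x"
proof -
  have "isCont h x" if "0 < x" for x
    using h that by (simp add: continuous_on_eq_continuous_at open_greaterThan)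
  then obtain H where H: "\<And>x. 0 < x \<Longrightarrow> (H has_vector_derivative h x) (at x)"
    using einterval_antiderivative[of 0 \<infinity> h] by (auto simp: zero_ereal_def)
  have cH: "continuous_on {0<..} H"
    by (intro continuous_at_imp_continuous_on ballI has_vector_derivative_continuous[OF H]) simp
  have lH: "loc_integrable H" by (rule loc_integrable_continuous[OF cH])
  have d: "loc_integrable (\<lambda>x. f x - H x)"
    unfolding loc_integrable_def
    by (intro allI impI set_integral_diff(1) loc_integrableD f lH) auto
  obtain k where k: "AE x in Rpos. f x - H x = k"
  proof (rule du_Bois_Reymond[OF d])
    fix \<psi> \<psi>' assume \<psi>: "\<psi> \<in> test_functions" "\<psi>' \<in> test_functions" "\<And>x. (\<psi> has_vector_derivative \<psi>' x) (at x)"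
    have "(LINT x|Rpos. f x * \<psi>' x) = - (LINT x|Rpos. f' x * \<psi> x)" by (rule has_weak_derivD[OF w \<psi>(1,3)])
    moreover have "(LINT x|Rpos. H x * \<psi>' x) = - (LINT x|Rpos. h x * \<psi> x)"
      by (rule has_weak_derivD[OF classical_weak_deriv[OF H h] \<psi>(1,3)])
    moreover have "(LINT x|Rpos. f' x * \<psi> x) = (LINT x|Rpos. h x * \<psi> x)"
    proof (rule integral_cong_AE)
      have m: "\<psi> \<in> borel_measurable Rpos" by (rule L2_measurable[OF test_L2[OF \<psi>(1)]])
      show "(\<lambda>x. f' x * \<psi> x) \<in> borel_measurable Rpos" by (intro borel_measurable_times f' m)
      show "(\<lambda>x. h x * \<psi> x) \<in> borel_measurable Rpos"
        by (intro borel_measurable_times continuous_measurable_Rpos h m)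
      show "AE x in Rpos. f' x * \<psi> x = h x * \<psi> x" using ae by eventually_elim simp
    qed
    ultimately show "(LINT x|Rpos. (f x - H x) * \<psi>' x) = 0"
      unfolding left_diff_distrib
      using loc_integrable_mult_test(2)[OF f \<psi>(2)] loc_integrable_mult_test(2)[OF lH \<psi>(2)] by simp
  qed
  show thesis
  proof (rule that[of "\<lambda>x. H x + k"])
    show "((\<lambda>x. H x + k) has_vector_derivative h x) (at x)" if "0 < x" for x
      using has_vector_derivative_add[OF H[OF that] has_vector_derivative_const] by simp
    show "AE x in Rpos. f x = H x + k" using k by eventually_elim (simp add: algebra_simps)
  qed
qed

section \<open>Continuous representatives and the classical stationary equation\<close>

lemma AE_eq_continuous_imp_eq:
  fixes f g :: "real \<Rightarrow> complex"
  assumes f: "continuous_on {0<..} f" and g: "continuous_on {0<..} g"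
    and ae: "AE x in Rpos. f x = g x" and x: "0 < x"
  shows "f x = g x"
proof (rule ccontr)
  assume "f x \<noteq> g x"
  define S where "S = {y \<in> {0<..}. f y - g y \<noteq> 0}"
  have "open ({0<..} \<inter> (\<lambda>y. f y - g y) -` (- {0}))"
    by (rule continuous_open_preimage) (auto intro: continuous_intros f g)
  moreover have "{0<..} \<inter> (\<lambda>y. f y - g y) -` (- {0}) = S" by (auto simp: S_def)
  ultimately have o: "open S" by simp
  have "x \<in> S" using \<open>f x \<noteq> g x\<close> x by (simp add: S_def)
  then have "\<not> negligible S" using open_not_negligible[OF o] by blast
  have "AE y in lebesgue. y \<notin> S" using ae unfolding AE_Rpos_iff by eventually_elim (simp add: S_def)
  then have "S \<in> null_sets lebesgue"
    using o by (subst (asm) AE_iff_null_sets[symmetric]) auto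
  then have "negligible S" by (simp add: negligible_iff_null_sets)
  with \<open>\<not> negligible S\<close> show False ..
qed

text \<open>By Sobolev's inequality the approximating test functions are uniformly Cauchy. Their
  uniform limit inherits continuity and the bound, and it tends to 0 at infinity because each
  approximant has compact support.\<close>

lemma H10_continuous_rep:
  assumes u: "u \<in> H10"
  obtains v where "continuous_on UNIV v" "AE x in Rpos. u x = v x" "\<And>x. cmod (v x) \<le> H1_norm u"
    "(v \<longlongrightarrow> 0) at_top"
proof -
  obtain \<psi> where \<psi>: "\<And>n::nat. \<psi> n \<in> test_functions" "(\<lambda>n. H1_norm (\<lambda>x. u x - \<psi> n x)) \<longlonglongrightarrow> 0"
    "AE x in Rpos. (\<lambda>n. \<psi> n x) \<longlonglongrightarrow> u x" using H10_AE_approx[OF u] by blast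
  have cauchy: "cmod (\<psi> n x - \<psi> m x) \<le> H1_norm (\<lambda>x. u x - \<psi> n x) + H1_norm (\<lambda>x. u x - \<psi> m x)" for n m x
  proof -
    have "cmod (\<psi> n x - \<psi> m x) \<le> H1_norm (\<lambda>x. \<psi> n x - \<psi> m x)"
      by (rule sobolev_test[OF test_functions_diff[OF \<psi>(1) \<psi>(1)]])
    also have "(\<lambda>x. \<psi> n x - \<psi> m x) = (\<lambda>x. (u x - \<psi> m x) - (u x - \<psi> n x))" by auto
    also have "H1_norm \<dots> \<le> H1_norm (\<lambda>x. u x - \<psi> m x) + H1_norm (\<lambda>x. u x - \<psi> n x)"
      by (intro H1_norm_triangle_diff H1_diff(1) H10_H1[OF u] test_in_H1 \<psi>(1))
    finally show ?thesis by simp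
  qed
  have "Cauchy (\<lambda>n. \<psi> n x)" for x
  proof (rule CauchyI)
    fix e :: real assume e: "0 < e"
    have "\<forall>\<^sub>F n in sequentially. H1_norm (\<lambda>x. u x - \<psi> n x) < e / 2"
      using order_tendstoD(2)[OF \<psi>(2), of "e/2"] e by simp
    then obtain N where N: "\<And>n. N \<le> n \<Longrightarrow> H1_norm (\<lambda>x. u x - \<psi> n x) < e / 2"
      by (auto simp: eventually_sequentially)
    show "\<exists>M. \<forall>m\<ge>M. \<forall>n\<ge>M. norm (\<psi> m x - \<psi> n x) < e"
    proof (intro exI[of _ N] allI impI)
      fix m n assume "N \<le> m" "N \<le> n"
      then show "norm (\<psi> m x - \<psi> n x) < e" using cauchy[of m x n] N[of m] N[of n] by linarith
    qed
  qed
  then have "convergent (\<lambda>n. \<psi> n x)" for x by (simp add: Cauchy_convergent_iff)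
  then obtain v where v: "\<And>x. (\<lambda>n. \<psi> n x) \<longlonglongrightarrow> v x" unfolding convergent_def by metis
  have vb: "cmod (\<psi> n x - v x) \<le> H1_norm (\<lambda>x. u x - \<psi> n x)" for n x
  proof (rule LIMSEQ_le)
    show "(\<lambda>m. cmod (\<psi> n x - \<psi> m x)) \<longlonglongrightarrow> cmod (\<psi> n x - v x)" by (intro tendsto_intros v)
    show "(\<lambda>m. H1_norm (\<lambda>x. u x - \<psi> n x) + H1_norm (\<lambda>x. u x - \<psi> m x)) \<longlonglongrightarrow> H1_norm (\<lambda>x. u x - \<psi> n x)"
      using tendsto_add[OF tendsto_const \<psi>(2), of "H1_norm (\<lambda>x. u x - \<psi> n x)"] by simp
  qed (use cauchy in blast)
  show thesis
  proof (rule that)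
    show "continuous_on UNIV v"
    proof (rule uniform_limit_theorem)
      show "\<forall>\<^sub>F n in sequentially. continuous_on UNIV (\<psi> n)"
        using \<psi>(1) by (auto simp: test_functions_iff smooth_imp_continuous)
      show "uniform_limit UNIV \<psi> v sequentially"
      proof (rule uniform_limitI)
        fix e :: real assume "0 < e"
        from order_tendstoD(2)[OF \<psi>(2) this]
        show "\<forall>\<^sub>F n in sequentially. \<forall>x\<in>UNIV. dist (\<psi> n x) (v x) < e"
        proof eventually_elim
          case (elim n)
          then show ?case using vb[of n] by (auto simp: dist_norm intro: le_less_trans)
        qed
      qed
    qed simp
    show "AE x in Rpos. u x = v x" using \<psi>(3) by eventually_elim (rule LIMSEQ_unique[OF _ v])
    show "cmod (v x) \<le> H1_norm u" for x
    proof (rule LIMSEQ_le)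
      show "(\<lambda>n. cmod (\<psi> n x)) \<longlonglongrightarrow> cmod (v x)" by (intro tendsto_norm v)
      show "(\<lambda>n. H1_norm u + H1_norm (\<lambda>x. u x - \<psi> n x)) \<longlonglongrightarrow> H1_norm u"
        using tendsto_add[OF tendsto_const \<psi>(2), of "H1_norm u"] by simp
      have "cmod (\<psi> n x) \<le> H1_norm u + H1_norm (\<lambda>x. u x - \<psi> n x)" for n
        using sobolev_test[OF \<psi>(1), of n x] H1_norm_abs_diff[OF H10_H1[OF u] test_in_H1[OF \<psi>(1)[of n]]] by linarith
      then show "\<exists>N. \<forall>n\<ge>N. cmod (\<psi> n x) \<le> H1_norm u + H1_norm (\<lambda>x. u x - \<psi> n x)" by blast
    qed
    show "(v \<longlongrightarrow> 0) at_top"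
    proof (rule tendstoI)
      fix e :: real assume "0 < e"
      obtain n where n: "H1_norm (\<lambda>x. u x - \<psi> n x) < e"
        using eventually_happens[OF order_tendstoD(2)[OF \<psi>(2) \<open>0 < e\<close>]] by auto
      obtain a b where ab: "0 < a" "a < b" "\<And>x. x \<notin> {a..b} \<Longrightarrow> \<psi> n x = 0"
        using test_functionE[OF \<psi>(1)[of n]] by metis
      have "dist (v x) 0 < e" if "b < x" for x
      proof -
        have "\<psi> n x = 0" using that by (intro ab(3)) auto
        then show ?thesis using vb[of n x] n by simp
      qed
      then show "\<forall>\<^sub>F x in at_top. dist (v x) 0 < e"
        by (rule eventually_mono[OF eventually_gt_at_top[of b]])
    qed
  qed
qed


text \<open>A bootstrap in two steps: the equation identifies the weak derivative of \<phi>' with a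
  continuous function, so \<phi>' has a C^1 version \<open>g\<close>; then \<phi> itself has a
  version with classical derivative \<open>g\<close>.\<close>

lemma stationary_classical:
  assumes st: "stationary_solution c 5 \<omega> \<phi>"
  obtains f g where "continuous_on UNIV f" "AE x in Rpos. \<phi> x = f x" "AE x in Rpos. weak_deriv \<phi> x = g x"
    "\<And>x. 0 < x \<Longrightarrow> (f has_vector_derivative g x) (at x)"
    "\<And>x. 0 < x \<Longrightarrow> (g has_vector_derivative (\<omega> - c / x\<^sup>2 - cmod (f x) ^ 4) *\<^sub>R f x) (at x)"
    "\<And>x. cmod (f x) \<le> H1_norm \<phi>" "(f \<longlongrightarrow> 0) at_top"
proof -
  have \<phi>: "\<phi> \<in> H10" and eq: "\<And>v. v \<in> H10 \<Longrightarrow> nls_op c 5 \<phi> v - of_real \<omega> * L2_inner \<phi> v = 0"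
    using st by (auto simp: stationary_solution_def)
  note w = weak_deriv[OF H10_H1[OF \<phi>]]
  obtain f where f: "continuous_on UNIV f" "AE x in Rpos. \<phi> x = f x" "\<And>x. cmod (f x) \<le> H1_norm \<phi>" "(f \<longlongrightarrow> 0) at_top"
    using H10_continuous_rep[OF \<phi>] by blast
  have cf: "continuous_on {0<..} f" using f(1) by (rule continuous_on_subset) simp
  define h where "h = (\<lambda>x. (\<omega> - c / x\<^sup>2 - cmod (f x) ^ 4) *\<^sub>R f x)"
  have ch: "continuous_on {0<..} h" unfolding h_def by (intro continuous_intros cf) auto
  \<comment> \<open>The equation yields \<open>h0\<close>, built from the class \<phi>; its
    continuous version \<open>h\<close> is built from the representative \<open>f\<close>.\<close>
  define h0 where "h0 = (\<lambda>x. of_real \<omega> * \<phi> x - of_real c * (\<phi> x / of_real (x\<^sup>2)) - nls_power (\<phi> x))"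
  have m: "\<phi> \<in> borel_measurable Rpos" by (rule L2_measurable[OF H10_L2[OF \<phi>]])
  have mx: "(\<lambda>x. complex_of_real (x\<^sup>2)) \<in> borel_measurable Rpos"
    by (intro continuous_measurable_Rpos continuous_intros)
  have mh0: "h0 \<in> borel_measurable Rpos"
    unfolding h0_def
    by (intro borel_measurable_diff borel_measurable_times borel_measurable_divide borel_measurable_const nls_power_measurable m mx)
  have h0: "AE x in Rpos. h0 x = h x"
    using f(2) by eventually_elim
      (simp add: h0_def h_def nls_power_def scaleR_conv_of_real left_diff_distrib)
  have wd: "has_weak_deriv (weak_deriv \<phi>) h0"
    unfolding has_weak_deriv_def
  proof
    fix \<psi> assume \<psi>: "\<psi> \<in> test_functions"
    obtain \<psi>' where t: "\<psi>' \<in> test_functions" "\<And>x. (\<psi> has_vector_derivative \<psi>' x) (at x)"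
      "\<And>x. vector_derivative \<psi> (at x) = \<psi>' x"
      using test_functionE[OF \<psi>] by metis
    \<comment> \<open>The equation is tested with the conjugate of \<psi>, because
      \<open>L2_inner\<close> conjugates its second argument whereas weak derivatives are tested
      without conjugation.\<close>
    note c1 = test_cnj[OF \<psi>] and c2 = test_cnj[OF t(1)]
    have L1: "L2_inner (weak_deriv \<phi>) (weak_deriv (\<lambda>x. cnj (\<psi> x))) = (LINT x|Rpos. weak_deriv \<phi> x * \<psi>' x)"
    proof -
      have "L2_inner (weak_deriv \<phi>) (weak_deriv (\<lambda>x. cnj (\<psi> x))) = L2_inner (weak_deriv \<phi>) (\<lambda>x. cnj (\<psi>' x))"
      proof (rule L2_inner_cong_AE[OF w(1) w(1) _ test_L2[OF c2]])
        show "weak_deriv (\<lambda>x. cnj (\<psi> x)) \<in> L2" by (rule weak_deriv(1)[OF test_in_H1[OF c1]])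
        show "AE x in Rpos. weak_deriv (\<lambda>x. cnj (\<psi> x)) x = cnj (\<psi>' x)"
          by (rule test_H1(2)[OF c1 c2 has_vector_derivative_cnj[OF t(2)]])
      qed simp
      then show ?thesis by (simp add: L2_inner_def)
    qed
    have L2: "L2_inner (\<lambda>x. \<phi> x / of_real x) (\<lambda>x. cnj (\<psi> x) / of_real x) = (LINT x|Rpos. \<phi> x / of_real (x\<^sup>2) * \<psi> x)"
      by (simp add: L2_inner_def power2_eq_square)
    have L3: "L2_inner (\<lambda>x. nls_power (\<phi> x)) (\<lambda>x. cnj (\<psi> x)) = (LINT x|Rpos. nls_power (\<phi> x) * \<psi> x)"
      "L2_inner \<phi> (\<lambda>x. cnj (\<psi> x)) = (LINT x|Rpos. \<phi> x * \<psi> x)"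
      by (simp_all add: L2_inner_def)
    have i1: "integrable Rpos (\<lambda>x. \<phi> x * \<psi> x)" "integrable Rpos (\<lambda>x. nls_power (\<phi> x) * \<psi> x)"
      by (intro L2_prod_integrable(2) H10_L2[OF \<phi>] nls_power_L2[OF \<phi>] test_L2[OF \<psi>])+
    have i2: "integrable Rpos (\<lambda>x. \<phi> x / of_real (x\<^sup>2) * \<psi> x)"
      using L2_prod_integrable(2)[OF hardy(1)[OF \<phi>] hardy(1)[OF test_H10[OF \<psi>]]] by (simp add: power2_eq_square)
    have "(LINT x|Rpos. h0 x * \<psi> x) = of_real \<omega> * (LINT x|Rpos. \<phi> x * \<psi> x)
       - of_real c * (LINT x|Rpos. \<phi> x / of_real (x\<^sup>2) * \<psi> x) - (LINT x|Rpos. nls_power (\<phi> x) * \<psi> x)"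
    proof -
      have "(LINT x|Rpos. h0 x * \<psi> x) = (LINT x|Rpos. of_real \<omega> * (\<phi> x * \<psi> x)
          - of_real c * (\<phi> x / of_real (x\<^sup>2) * \<psi> x) - nls_power (\<phi> x) * \<psi> x)"
        by (simp only: h0_def left_diff_distrib mult.assoc)
      also have "\<dots> = (LINT x|Rpos. of_real \<omega> * (\<phi> x * \<psi> x))
          - (LINT x|Rpos. of_real c * (\<phi> x / of_real (x\<^sup>2) * \<psi> x)) - (LINT x|Rpos. nls_power (\<phi> x) * \<psi> x)"
      proof -
        note a = integrable_mult_right[OF i1(1), of "of_real \<omega>"] and b = integrable_mult_right[OF i2, of "of_real c"]
        show ?thesis
          unfolding Bochner_Integration.integral_diff[OF Bochner_Integration.integrable_diff[OF a b] i1(2)]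
            Bochner_Integration.integral_diff[OF a b] ..
      qed
      finally show ?thesis by (simp only: integral_mult_right_zero)
    qed
    also have "\<dots> = - (LINT x|Rpos. weak_deriv \<phi> x * \<psi>' x)"
      using eq[OF test_H10[OF c1]] unfolding nls_op_eq L1 L2 L3 by (simp add: algebra_simps)
    finally show "(LINT x|Rpos. weak_deriv \<phi> x * vector_derivative \<psi> (at x)) = - (LINT x|Rpos. h0 x * \<psi> x)"
      unfolding t(3) by simp
  qed
  obtain g where g: "\<And>x. 0 < x \<Longrightarrow> (g has_vector_derivative h x) (at x)" "AE x in Rpos. weak_deriv \<phi> x = g x"
    using weak_deriv_classical[OF L2_loc_integrable[OF w(1)] wd h0 ch mh0] by blast
  have cg: "continuous_on {0<..} g"
    by (intro continuous_at_imp_continuous_on ballI has_vector_derivative_continuous[OF g(1)]) simp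
  obtain F where F: "\<And>x. 0 < x \<Longrightarrow> (F has_vector_derivative g x) (at x)" "AE x in Rpos. \<phi> x = F x"
    using weak_deriv_classical[OF L2_loc_integrable[OF H10_L2[OF \<phi>]] w(2) g(2) cg L2_measurable[OF w(1)]] by blast
  have cF: "continuous_on {0<..} F"
    by (intro continuous_at_imp_continuous_on ballI has_vector_derivative_continuous[OF F(1)]) simp
  have "AE x in Rpos. F x = f x" using F(2) f(2) by eventually_elim simp
  \<comment> \<open>The limit of test functions \<open>f\<close> carries boundedness and the limit
    at infinity, the bootstrapped \<open>F\<close> carries differentiability; both are continuous,
    so they coincide.\<close>
  then have Ff: "F x = f x" if "0 < x" for x by (rule AE_eq_continuous_imp_eq[OF cF cf _ that])
  have "(f has_vector_derivative g x) (at x)" if "0 < x" for x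
    by (rule has_vector_derivative_transform_within_open[OF F(1)[OF that], of "{0<..}"]) (use that Ff in auto)
  then show thesis using that[OF f(1,2) g(2) _ g(1)[unfolded h_def] f(3,4)] by blast
qed

text \<open>Otherwise the integral would exceed n d for every n. An integrable function need not
  tend to 0, but small values at arbitrarily large points are all that the decay argument
  needs.\<close>

lemma integrable_Rpos_small_value:
  fixes J :: "real \<Rightarrow> real"
  assumes J: "integrable Rpos J" and J0: "\<And>x. 0 \<le> J x" and d: "0 < d" and x0: "0 < x0"
  obtains x where "x0 \<le> x" "J x < d"
proof (rule ccontr)
  assume "\<not> thesis"
  then have ge: "d \<le> J x" if "x0 \<le> x" for x using that \<open>\<And>x. x0 \<le> x \<Longrightarrow> J x < d \<Longrightarrow> thesis\<close> not_less by blast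
  have i: "integrable lebesgue (\<lambda>x. indicator {0<..} x *\<^sub>R J x)"
    using J by (simp add: integrable_Rpos_iff set_integrable_def)
  have "real n * d \<le> (LINT x|lebesgue. indicator {0<..} x *\<^sub>R J x)" for n
  proof -
    have "real n * d = (LINT x|lebesgue. d * indicator {x0..x0 + real n} x)" by simp
    also have "\<dots> \<le> (LINT x|lebesgue. indicator {0<..} x *\<^sub>R J x)"
    proof (rule integral_mono[OF _ i])
      show "integrable lebesgue (\<lambda>x. d * indicat_real {x0..x0 + real n} x)"
        by (intro integrable_mult_right) (simp add: integrable_indicator_iff)
      show "d * indicat_real {x0..x0 + real n} x \<le> indicat_real {0<..} x *\<^sub>R J x" for x
        using ge[of x] J0[of x] x0 by (auto simp: indicator_def)
    qed
    finally show ?thesis .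
  qed
  moreover obtain n :: nat where "(LINT x|lebesgue. indicator {0<..} x *\<^sub>R J x) < real n * d"
    using ex_less_of_nat_mult[OF d] by blast
  ultimately show False by (meson not_less)
qed

text \<open>The mean value inequality with an explicit primitive \<open>p\<close> of the majorant.
  It bounds increments of \<open>g\<close> in space and of the solution in time.\<close>

lemma vector_derivative_dominated:
  fixes g :: "real \<Rightarrow> complex"
  assumes "x \<le> y" and g: "\<And>t. x \<le> t \<Longrightarrow> t \<le> y \<Longrightarrow> (g has_vector_derivative h t) (at t)"
    and p: "\<And>t. x \<le> t \<Longrightarrow> t \<le> y \<Longrightarrow> (p has_real_derivative p' t) (at t)"
    and le: "\<And>t. x \<le> t \<Longrightarrow> t \<le> y \<Longrightarrow> cmod (h t) \<le> p' t"
  shows "cmod (g y - g x) \<le> p y - p x"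
proof (cases "x = y")
  case False
  then have "x < y" using assms(1) by simp
  then show ?thesis
  proof (rule differentiable_bound_general[where f' = h and \<phi>' = p'])
    show "continuous_on {x..y} g"
      by (intro continuous_at_imp_continuous_on ballI has_vector_derivative_continuous[OF g]) auto
    show "continuous_on {x..y} p"
      by (intro continuous_at_imp_continuous_on ballI DERIV_isCont[OF p]) auto
    fix t assume t: "x < t" "t < y"
    show "(g has_vector_derivative h t) (at t)" using t by (intro g) auto
    show "(p has_vector_derivative p' t) (at t)"
      unfolding has_real_derivative_iff_has_vector_derivative[symmetric] using t by (intro p) auto
    show "cmod (h t) \<le> p' t" using t by (intro le) auto
  qed
qed simp

text \<open>
  Beyond some \<open>R\<close> the function \<open>Q = |f|\<^sup>2\<close> satisfies \<open>Q'' \<ge> k\<^sup>2 Q\<close> with \<open>k\<^sup>2 = \<omega>\<close>, so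
  \<open>(Q' + k Q) exp (- k x)\<close> is nondecreasing; were it ever positive, \<open>Q' + k Q\<close> would not be integrable.
  Hence \<open>Q exp (k x)\<close> is nonincreasing.
\<close>

lemma stationary_decay:
  fixes f g :: "real \<Rightarrow> complex"
  assumes \<omega>: "0 < \<omega>" and c: "0 \<le> c"
    and f: "\<And>x. 0 < x \<Longrightarrow> (f has_vector_derivative g x) (at x)"
    and g: "\<And>x. 0 < x \<Longrightarrow> (g has_vector_derivative (\<omega> - c / x\<^sup>2 - cmod (f x) ^ 4) *\<^sub>R f x) (at x)"
    and M: "\<And>x. cmod (f x) \<le> M" and lim: "(f \<longlongrightarrow> 0) at_top"
    and L2: "f \<in> L2" "g \<in> L2"
  shows "\<exists>C k. 0 < k \<and> 0 \<le> C \<and> (\<forall>x>0. cmod (f x) \<le> C * exp (- k * x)) \<and>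
    (\<forall>x>0. cmod (of_real x * g x) \<le> C * exp (- k * x))"
proof -
  have M0: "0 \<le> M" using M[of 0] norm_ge_zero order_trans by blast
  define r where "r = (\<lambda>x. \<omega> - c / x\<^sup>2 - cmod (f x) ^ 4)"
  \<comment> \<open>Beyond \<open>R\<close> the coefficient \<open>r\<close> exceeds \<omega> / 2,
    so Q'' \<ge> 2 r Q \<ge> \<omega> Q. Settling for half the limit of \<open>r\<close> still
    leaves the rate \<open>sqrt \<omega>\<close>.\<close>
  define k where "k = sqrt \<omega>"
  have k: "0 < k" "k * k = \<omega>" using \<omega> by (auto simp: k_def)
  have "((\<lambda>x. \<omega> - c / x\<^sup>2 - cmod (f x) ^ 4) \<longlongrightarrow> \<omega> - 0 - 0 ^ 4) at_top"
  proof (intro tendsto_diff tendsto_const tendsto_power tendsto_norm_zero lim)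
    show "((\<lambda>x. c / x\<^sup>2) \<longlongrightarrow> 0) at_top"
      by (rule tendsto_divide_0[OF tendsto_const])
         (rule filterlim_at_top_imp_at_infinity, rule filterlim_pow_at_top, auto intro: filterlim_ident)
  qed
  then have "(r \<longlongrightarrow> \<omega>) at_top" by (simp add: r_def)
  then have "\<forall>\<^sub>F x in at_top. \<omega> / 2 < r x" by (rule order_tendstoD(1)) (use \<omega> in simp)
  then obtain R0 where R0: "\<And>x. R0 \<le> x \<Longrightarrow> \<omega> / 2 < r x" by (auto simp: eventually_at_top_linorder)
  define R where "R = max 1 R0"
  have R: "0 < R" "\<And>x. R \<le> x \<Longrightarrow> \<omega> / 2 < r x" using R0 by (auto simp: R_def)
  define Q where "Q = (\<lambda>x. f x \<bullet> f x)"
  define P where "P = (\<lambda>x. 2 * (f x \<bullet> g x))"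
  define W where "W = (\<lambda>x. P x + k * Q x)"
  have Qn: "Q x = (cmod (f x))\<^sup>2" for x by (simp add: Q_def power2_norm_eq_inner)
  have dQ: "(Q has_real_derivative P x) (at x)" if "0 < x" for x
    using bounded_bilinear.has_vector_derivative[OF bounded_bilinear_inner f[OF that] f[OF that]]
    unfolding Q_def P_def has_real_derivative_iff_has_vector_derivative by (simp add: inner_commute)
  have dP: "(P has_real_derivative 2 * (r x * Q x + g x \<bullet> g x)) (at x)" if "0 < x" for x
  proof -
    have "((\<lambda>x. f x \<bullet> g x) has_real_derivative r x * Q x + g x \<bullet> g x) (at x)"
      using bounded_bilinear.has_vector_derivative[OF bounded_bilinear_inner f[OF that] g[OF that]]
      unfolding Q_def r_def has_real_derivative_iff_has_vector_derivative by simp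
    then show ?thesis unfolding P_def by (rule DERIV_cmult)
  qed
  have mono: "exp (- k * x) * W x \<le> exp (- k * y) * W y" if "R \<le> x" "x \<le> y" for x y
  proof (rule DERIV_nonneg_imp_nondecreasing[OF that(2)])
    fix t assume "x \<le> t" "t \<le> y"
    then have t: "0 < t" "R \<le> t" using R(1) that by auto
    have dW: "(W has_real_derivative 2 * (r t * Q t + g t \<bullet> g t) + k * P t) (at t)"
      unfolding W_def by (intro DERIV_add dP DERIV_cmult dQ t)
    have dE: "((\<lambda>x. exp (- k * x)) has_real_derivative - k * exp (- k * t)) (at t)"
      by (auto intro!: derivative_eq_intros)
    have "((\<lambda>x. exp (- k * x) * W x) has_real_derivative exp (- k * t) * (2 * (r t * Q t + g t \<bullet> g t) - k * k * Q t)) (at t)"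
      using DERIV_mult[OF dE dW] by (simp add: W_def algebra_simps)
    moreover have "0 \<le> exp (- k * t) * (2 * (r t * Q t + g t \<bullet> g t) - k * k * Q t)"
    proof -
      have "\<omega> / 2 * Q t \<le> r t * Q t" using R(2)[OF t(2)] by (intro mult_right_mono) (auto simp: Qn)
      moreover have "0 \<le> g t \<bullet> g t" by simp
      moreover have "0 \<le> 2 * (a + b) - w * d" if "w / 2 * d \<le> a" "0 \<le> b" for a b w d :: real
        using that by (simp add: field_simps)
      ultimately have "0 \<le> 2 * (r t * Q t + g t \<bullet> g t) - \<omega> * Q t" by blast
      then show ?thesis unfolding k(2) by simp
    qed
    ultimately show "\<exists>y. ((\<lambda>x. exp (- k * x) * W x) has_real_derivative y) (at t) \<and> 0 \<le> y" by blast
  qed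
  have Wneg: "W x \<le> 0" if x: "R \<le> x" for x
  proof (rule ccontr)
    assume W: "\<not> W x \<le> 0"
    \<comment> \<open>\<open>J\<close> is integrable and dominates \<open>W\<close>, as 2 |f| |g|
      \<le> |f|^2 + |g|^2; a positive value of \<open>W\<close> would persist from then on,
      contradicting small values of \<open>J\<close>.\<close>
    define J where "J = (\<lambda>y. (1 + k) * (cmod (f y))\<^sup>2 + (cmod (g y))\<^sup>2)"
    have iJ: "integrable Rpos J" unfolding J_def
      by (intro Bochner_Integration.integrable_add integrable_mult_right L2_integrable L2)
    have J0: "0 \<le> J y" for y using k by (simp add: J_def)
    have "0 < W x" "0 < x" using W x R(1) by auto
    then obtain y where y: "x \<le> y" "J y < W x"
      using integrable_Rpos_small_value[OF iJ J0] by blast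
    have "W x = exp (k * x) * (exp (- k * x) * W x)" by (simp add: exp_minus)
    also have "\<dots> \<le> exp (k * x) * (exp (- k * y) * W y)" by (intro mult_left_mono mono x y) simp
    also have "\<dots> = exp (- k * (y - x)) * W y"
    proof -
      have "exp (k * x) * exp (- k * y) = exp (- k * (y - x))"
        unfolding exp_add[symmetric] by (simp add: algebra_simps)
      then show ?thesis by (metis mult.assoc)
    qed
    finally have 1: "W x \<le> exp (- k * (y - x)) * W y" .
    have "0 < W y"
    proof (rule ccontr)
      assume "\<not> 0 < W y"
      then have "exp (- k * (y - x)) * W y \<le> 0" by (intro mult_nonneg_nonpos) auto
      then show False using 1 W by linarith
    qed
    then have "exp (- k * (y - x)) * W y \<le> 1 * W y" using k y by (intro mult_right_mono) auto
    then have "W x \<le> W y" using 1 by simp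
    also have "W y \<le> J y"
    proof -
      have "2 * (f y \<bullet> g y) \<le> 2 * (cmod (f y) * cmod (g y))" by (intro mult_left_mono norm_cauchy_schwarz) simp
      also have "\<dots> \<le> (cmod (f y))\<^sup>2 + (cmod (g y))\<^sup>2"
        using sum_squares_bound[of "cmod (f y)" "cmod (g y)"] by simp
      finally show ?thesis by (simp add: W_def P_def J_def Qn algebra_simps)
    qed
    finally show False using y(2) by simp
  qed
  have decay: "exp (k * x) * Q x \<le> exp (k * R) * Q R" if "R \<le> x" for x
  proof (rule DERIV_nonpos_imp_nonincreasing[OF that])
    fix t assume "R \<le> t" "t \<le> x"
    then have t: "0 < t" "R \<le> t" using R(1) by auto
    have dE: "((\<lambda>x. exp (k * x)) has_real_derivative k * exp (k * t)) (at t)"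
      by (auto intro!: derivative_eq_intros)
    have "((\<lambda>x. exp (k * x) * Q x) has_real_derivative exp (k * t) * W t) (at t)"
      using DERIV_mult[OF dE dQ[OF t(1)]] by (simp add: W_def algebra_simps)
    moreover have "exp (k * t) * W t \<le> 0" using Wneg[OF t(2)] by (simp add: mult_nonneg_nonpos)
    ultimately show "\<exists>y. ((\<lambda>x. exp (k * x) * Q x) has_real_derivative y) (at t) \<and> y \<le> 0" by blast
  qed
  \<comment> \<open>\<open>Q\<close> is the square of |f|, so f decays at half the rate. The factor
    in \<open>A\<close> makes the bound trivial on (0, R), where |f| \<le> M suffices.\<close>
  define q where "q = k / 2"
  define A where "A = M * exp (q * R)"
  have q: "0 < q" using k by (simp add: q_def)
  have A0: "0 \<le> A" using M0 by (simp add: A_def)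
  have fA: "cmod (f x) \<le> A * exp (- q * x)" if "0 < x" for x
  proof (cases "R \<le> x")
    case True
    have "(exp (q * x) * cmod (f x))\<^sup>2 = exp (k * x) * Q x"
      by (simp add: power_mult_distrib Qn q_def exp_double[symmetric] flip: exp_of_nat_mult)
    also have "\<dots> \<le> exp (k * R) * Q R" by (rule decay[OF True])
    also have "\<dots> \<le> exp (k * R) * M\<^sup>2" unfolding Qn by (intro mult_left_mono power_mono M) auto
    also have "\<dots> = A\<^sup>2" by (simp add: A_def power_mult_distrib q_def flip: exp_of_nat_mult)
    finally have "exp (q * x) * cmod (f x) \<le> A" by (rule power2_le_imp_le[OF _ A0])
    then show ?thesis by (simp add: exp_minus field_simps)
  next
    case False
    have "cmod (f x) \<le> M * 1" using M by simp
    also have "\<dots> \<le> M * exp (q * (R - x))" using False q M0 by (intro mult_left_mono) auto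
    also have "\<dots> = A * exp (- q * x)" by (simp add: A_def algebra_simps flip: exp_add)
    finally show ?thesis .
  qed
  define B where "B = \<omega> + c + M ^ 4"
  have B0: "0 \<le> B" using \<omega> c M0 by (simp add: B_def)
  have hb: "cmod (r x *\<^sub>R f x) \<le> (\<omega> + c / x\<^sup>2 + M ^ 4) * cmod (f x)" if "0 < x" for x
  proof -
    have "cmod (f x) ^ 4 \<le> M ^ 4" by (intro power_mono M) simp
    moreover have "0 \<le> c / x\<^sup>2" "0 \<le> cmod (f x) ^ 4" using c by auto
    ultimately have "\<bar>r x\<bar> \<le> \<omega> + c / x\<^sup>2 + M ^ 4" using \<omega> unfolding r_def by linarith
    then show ?thesis by (simp add: mult_right_mono)
  qed
  \<comment> \<open>For t \<ge> 1 the derivative of g is at most B A exp (- q t), and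
    \<open>D\<close> comes from integrating this to infinity.\<close>
  define D where "D = B * A / q"
  have D0: "0 \<le> D" using B0 A0 q by (simp add: D_def)
  have gD: "cmod (g x) \<le> D * exp (- q * x)" if x: "1 \<le> x" for x
  proof (rule field_le_epsilon)
    fix e :: real assume e: "0 < e"
    \<comment> \<open>As g lies in L2, it is smaller than e at some far point, from which the
      estimate is integrated back to x.\<close>
    obtain y where y: "x \<le> y" "(cmod (g y))\<^sup>2 < e\<^sup>2"
      using integrable_Rpos_small_value[OF L2_integrable[OF L2(2)], of "e\<^sup>2" x] x e by auto
    have "cmod (g y) < e" using y(2) e by (simp add: power2_less_imp_less)
    have "cmod (g y - g x) \<le> - D * exp (- q * y) - (- D * exp (- q * x))"
    proof (rule vector_derivative_dominated[OF y(1)])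
      fix t assume t: "x \<le> t" "t \<le> y"
      then have t1: "1 \<le> t" "0 < t" using x by auto
      show "(g has_vector_derivative r t *\<^sub>R f t) (at t)" using g[OF t1(2)] unfolding r_def .
      show "((\<lambda>s. - D * exp (- q * s)) has_real_derivative B * A * exp (- q * t)) (at t)"
        using q by (auto intro!: derivative_eq_intros simp: D_def)
      have "c / t\<^sup>2 \<le> c" using t1 c by (simp add: divide_le_eq mult_left_le one_le_power mult_le_cancel_left1)
      then have "(\<omega> + c / t\<^sup>2 + M ^ 4) * cmod (f t) \<le> B * (A * exp (- q * t))"
        using fA[OF t1(2)] B0 by (intro mult_mono) (auto simp: B_def)
      with hb[OF t1(2)] show "cmod (r t *\<^sub>R f t) \<le> B * A * exp (- q * t)" by simp
    qed
    also have "\<dots> \<le> D * exp (- q * x)" using D0 by simp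
    finally have "cmod (g y - g x) \<le> D * exp (- q * x)" .
    moreover have "cmod (g x) \<le> cmod (g y) + cmod (g y - g x)"
      using norm_triangle_ineq4[of "g y" "g y - g x"] by simp
    ultimately show "cmod (g x) \<le> D * exp (- q * x) + e" using \<open>cmod (g y) < e\<close> by linarith
  qed
  \<comment> \<open>Near 0 the potential only gives |g'| \<le> B M / t^2, so g may grow like 1 / x;
    the factor x compensates for exactly this.\<close>
  have gS: "cmod (of_real x * g x) \<le> B * M + D" if x: "0 < x" "x < 1" for x
  proof -
    have "cmod (g 1 - g x) \<le> - (B * M) * inverse 1 - (- (B * M) * inverse x)"
    proof (rule vector_derivative_dominated)
      show "x \<le> 1" using x by simp
      fix t assume t: "x \<le> t" "t \<le> 1"
      then have t0: "0 < t" using x by auto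
      show "(g has_vector_derivative r t *\<^sub>R f t) (at t)" using g[OF t0] unfolding r_def .
      show "((\<lambda>s. - (B * M) * inverse s) has_real_derivative B * M * (inverse t * inverse t)) (at t)"
        using DERIV_cmult[OF DERIV_inverse'[OF DERIV_ident, of t], of "- (B * M)"] t0 by simp
      have i1: "1 \<le> inverse t * inverse t"
        using mult_mono[of 1 "inverse t" 1 "inverse t"] t0 t(2) one_le_inverse[OF t0 t(2)] by simp
      have "\<omega> * 1 + c * (inverse t * inverse t) + M ^ 4 * 1 \<le>
          \<omega> * (inverse t * inverse t) + c * (inverse t * inverse t) + M ^ 4 * (inverse t * inverse t)"
        using mult_left_mono[OF i1 less_imp_le[OF \<omega>]] mult_left_mono[OF i1 zero_le_power[OF M0, of 4]] by linarith
      then have "\<omega> + c / t\<^sup>2 + M ^ 4 \<le> B * (inverse t * inverse t)"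
        by (simp add: B_def distrib_right divide_inverse power2_eq_square)
      then have "(\<omega> + c / t\<^sup>2 + M ^ 4) * cmod (f t) \<le> B * (inverse t * inverse t) * M"
        using M[of t] B0 t0 by (intro mult_mono) auto
      then show "cmod (r t *\<^sub>R f t) \<le> B * M * (inverse t * inverse t)" using hb[OF t0] by (simp add: mult_ac)
    qed
    also have "\<dots> \<le> B * M * inverse x" using B0 M0 by simp
    finally have "x * cmod (g 1 - g x) \<le> x * (B * M * inverse x)"
      using x by (intro mult_left_mono) auto
    also have "\<dots> = B * M" using x by simp
    finally have 1: "x * cmod (g 1 - g x) \<le> B * M" .
    have "D * exp (- q * 1) \<le> D * 1" using q D0 by (intro mult_left_mono) auto
    then have "cmod (g 1) \<le> D" using gD[of 1] by simp
    then have 2: "x * cmod (g 1) \<le> D" using mult_mono[of x 1 "cmod (g 1)" D] x D0 by simp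
    have "cmod (g x) \<le> cmod (g 1) + cmod (g 1 - g x)"
      using norm_triangle_ineq4[of "g 1" "g 1 - g x"] by simp
    then have "x * cmod (g x) \<le> x * cmod (g 1) + x * cmod (g 1 - g x)"
      using mult_left_mono[of "cmod (g x)" "cmod (g 1) + cmod (g 1 - g x)" x] x by (simp add: distrib_left)
    then show ?thesis using 1 2 x by (simp add: norm_mult)
  qed
  \<comment> \<open>Half of the rate is given up to absorb the factor x through x \<le> exp (k' x) /
    k'. \<open>E1\<close> serves x \<ge> 1, and \<open>E2\<close> turns the constant bound on (0, 1)
    into an exponential one.\<close>
  define k' where "k' = q / 2"
  define E1 where "E1 = D * (1 / k')"
  define E2 where "E2 = (B * M + D) * exp k'"
  have k': "0 < k'" using q by (simp add: k'_def)
  have E0: "0 \<le> E1" "0 \<le> E2" using D0 k' B0 M0 by (auto simp: E1_def E2_def)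
  show ?thesis
  proof (rule exI[of _ "A + E1 + E2"], rule exI[of _ k'], intro conjI allI impI)
    show "0 < k'" by (rule k')
    show "0 \<le> A + E1 + E2" using A0 E0 by simp
    fix x :: real assume x: "0 < x"
    have e1: "exp (- q * x) \<le> exp (- k' * x)" using x q by (simp add: k'_def)
    have "A * exp (- q * x) \<le> (A + E1 + E2) * exp (- k' * x)"
      using e1 A0 E0 by (intro mult_mono) auto
    then show "cmod (f x) \<le> (A + E1 + E2) * exp (- k' * x)" using fA[OF x] by linarith
    show "cmod (of_real x * g x) \<le> (A + E1 + E2) * exp (- k' * x)"
    proof (cases "x < 1")
      case True
      have "B * M + D \<le> E2 * exp (- k' * x)"
      proof -
        have "(B * M + D) * 1 \<le> (B * M + D) * exp (k' * (1 - x))"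
          using True k' B0 M0 D0 by (intro mult_left_mono) auto
        also have "\<dots> = E2 * exp (- k' * x)" by (simp add: E2_def algebra_simps flip: exp_add)
        finally show ?thesis by simp
      qed
      also have "\<dots> \<le> (A + E1 + E2) * exp (- k' * x)" using A0 E0 by (intro mult_right_mono) auto
      finally show ?thesis using gS[OF x True] by linarith
    next
      case False
      have "k' * x \<le> exp (k' * x)" using exp_ge_add_one_self[of "k' * x"] by linarith
      then have xe: "x \<le> (1 / k') * exp (k' * x)" using k' by (simp add: field_simps)
      have "cmod (of_real x * g x) = x * cmod (g x)" using x by (simp add: norm_mult)
      also have "\<dots> \<le> ((1 / k') * exp (k' * x)) * (D * exp (- q * x))"
        using xe gD[of x] False x k' D0 by (intro mult_mono) auto
      also have "\<dots> = E1 * exp (- k' * x)"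
      proof -
        have "exp (k' * x) * exp (- q * x) = exp (- k' * x)"
          unfolding exp_add[symmetric] k'_def by (simp add: algebra_simps)
        then show ?thesis by (simp add: E1_def mult_ac)
      qed
      also have "\<dots> \<le> (A + E1 + E2) * exp (- k' * x)" using A0 E0 by (intro mult_right_mono) auto
      finally show ?thesis .
    qed
  qed
qed

section \<open>The pseudo-conformal solution\<close>


text \<open>\<open>weak_deriv\<close> is chosen for functions, not for classes modulo null sets, so
  its invariance has to be derived from uniqueness.\<close>

lemma H1_cong_AE:
  assumes u: "u \<in> H1" and v: "v \<in> borel_measurable Rpos" and ae: "AE x in Rpos. u x = v x"
  shows "v \<in> H1" "AE x in Rpos. weak_deriv v x = weak_deriv u x"
    "L2_norm (weak_deriv v) = L2_norm (weak_deriv u)"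
proof -
  have "AE x in Rpos. cmod (v x) \<le> 1 * cmod (u x)" using ae by eventually_elim simp
  then have vL: "v \<in> L2" by (rule L2_bound(1)[OF H1_L2[OF u] v zero_le_one])
  have "has_weak_deriv v (weak_deriv u)"
    unfolding has_weak_deriv_def
  proof
    fix \<psi> assume \<psi>: "\<psi> \<in> test_functions"
    obtain \<psi>' where t: "\<psi>' \<in> test_functions" "\<And>x. (\<psi> has_vector_derivative \<psi>' x) (at x)"
      "\<And>x. vector_derivative \<psi> (at x) = \<psi>' x"
      using test_functionE[OF \<psi>] by metis
    have "(LINT x|Rpos. v x * \<psi>' x) = (LINT x|Rpos. u x * \<psi>' x)"
    proof (rule integral_cong_AE)
      show "AE x in Rpos. v x * \<psi>' x = u x * \<psi>' x" using ae by eventually_elim simp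
    qed (intro borel_measurable_times v L2_measurable[OF H1_L2[OF u]] L2_measurable[OF test_L2[OF t(1)]])+
    then show "(LINT x|Rpos. v x * vector_derivative \<psi> (at x)) = - (LINT x|Rpos. weak_deriv u x * \<psi> x)"
      unfolding t(3) using has_weak_derivD[OF weak_deriv(2)[OF u] \<psi> t(2)] by simp
  qed
  note * = weak_deriv_eqI[OF vL weak_deriv(1)[OF u] this]
  show "v \<in> H1" "AE x in Rpos. weak_deriv v x = weak_deriv u x" "L2_norm (weak_deriv v) = L2_norm (weak_deriv u)"
    by (fact *)+
qed

lemma H1_norm_cong_AE:
  assumes u: "u \<in> H1" and v: "v \<in> borel_measurable Rpos" and ae: "AE x in Rpos. u x = v x"
  shows "H1_norm v = H1_norm u"
  unfolding H1_norm_def H1_cong_AE(3)[OF assms] L2_norm_cong_AE[OF L2_measurable[OF H1_L2[OF u]] v ae] ..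

lemma H10_cong_AE:
  assumes u: "u \<in> H10" and v: "v \<in> borel_measurable Rpos" and ae: "AE x in Rpos. u x = v x"
  shows "v \<in> H10"
proof (rule H10_closed[OF H1_cong_AE(1)[OF H10_H1[OF u] v ae]])
  fix e :: real assume e: "0 < e"
  have "AE x in Rpos. (\<lambda>_. 0) x = v x - u x" using ae by eventually_elim simp
  moreover have "(\<lambda>_. 0) \<in> H1" by (rule test_in_H1[OF test_functions_zero])
  moreover have "(\<lambda>x. v x - u x) \<in> borel_measurable Rpos"
    by (intro borel_measurable_diff v L2_measurable H10_L2 u)
  ultimately have "H1_norm (\<lambda>x. v x - u x) = H1_norm (\<lambda>_. 0)" by (intro H1_norm_cong_AE)
  then show "\<exists>w\<in>H10. H1_norm (\<lambda>x. v x - w x) < e" using e by (intro bexI[OF _ u]) simp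
qed

text \<open>The sequential theorem transferred to a real parameter, with the bounds assumed on a
  neighbourhood only; leaving out the point \<open>t\<close> itself suits difference
  quotients.\<close>

lemma L2_norm_lim_dominated_at:
  fixes t :: real
  assumes T: "open T" "t \<in> T"
    and f: "\<And>\<tau>. \<tau> \<in> T \<Longrightarrow> \<tau> \<noteq> t \<Longrightarrow> f \<tau> \<in> borel_measurable Rpos" and g: "g \<in> borel_measurable Rpos"
    and w: "integrable Rpos (\<lambda>x. (w x)\<^sup>2)"
    and le: "\<And>\<tau> x. \<tau> \<in> T \<Longrightarrow> \<tau> \<noteq> t \<Longrightarrow> 0 < x \<Longrightarrow> cmod (f \<tau> x) \<le> w x"
    and lim: "\<And>x. 0 < x \<Longrightarrow> ((\<lambda>\<tau>. f \<tau> x) \<longlongrightarrow> g x) (at t)"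
  shows "((\<lambda>\<tau>. L2_norm (\<lambda>x. f \<tau> x - g x)) \<longlongrightarrow> 0) (at t)"
proof -
  have "((\<lambda>\<tau>. L2_norm (\<lambda>x. f \<tau> x - g x)) \<longlongrightarrow> 0) (at t within T)"
    unfolding tendsto_at_iff_sequentially
  proof (intro allI impI)
    fix X assume X: "\<forall>i. X i \<in> T - {t}" "X \<longlonglongrightarrow> t"
    have "(\<lambda>i. L2_norm (\<lambda>x. f (X i) x - g x)) \<longlonglongrightarrow> 0"
    proof (rule L2_norm_lim_dominated[OF _ g w])
      show "f (X i) \<in> borel_measurable Rpos" for i using X(1) f by blast
      show "cmod (f (X i) x) \<le> w x" if "0 < x" for i x using X(1) le that by blast
      show "(\<lambda>i. f (X i) x) \<longlonglongrightarrow> g x" if "0 < x" for x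
      proof -
        have "((\<lambda>\<tau>. f \<tau> x) \<longlongrightarrow> g x) (at t within T)" using lim[OF that] at_within_open[OF T(2,1)] by simp
        from this[unfolded tendsto_at_iff_sequentially, rule_format, of X] X show ?thesis by (simp add: o_def)
      qed
    qed
    then show "((\<lambda>\<tau>. L2_norm (\<lambda>x. f \<tau> x - g x)) \<circ> X) \<longlonglongrightarrow> 0" by (simp add: o_def)
  qed
  then show ?thesis unfolding at_within_open[OF T(2,1)] .
qed

lemma L2_norm_lim_norms_at:
  fixes t :: real
  assumes T: "open T" "t \<in> T"
    and f: "\<And>\<tau>. \<tau> \<in> T \<Longrightarrow> f \<tau> \<in> L2" and g: "g \<in> L2"
    and lim: "\<And>x. 0 < x \<Longrightarrow> ((\<lambda>\<tau>. f \<tau> x) \<longlongrightarrow> g x) (at t)"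
    and norms: "((\<lambda>\<tau>. L2_norm (f \<tau>)) \<longlongrightarrow> L2_norm g) (at t)"
  shows "((\<lambda>\<tau>. L2_norm (\<lambda>x. f \<tau> x - g x)) \<longlongrightarrow> 0) (at t)"
proof -
  have "((\<lambda>\<tau>. L2_norm (\<lambda>x. f \<tau> x - g x)) \<longlongrightarrow> 0) (at t within T)"
    unfolding tendsto_at_iff_sequentially
  proof (intro allI impI)
    fix X assume X: "\<forall>i. X i \<in> T - {t}" "X \<longlonglongrightarrow> t"
    have seq1: "(\<lambda>i. f (X i) x) \<longlonglongrightarrow> g x" if "0 < x" for x
    proof -
      have "((\<lambda>\<tau>. f \<tau> x) \<longlongrightarrow> g x) (at t within T)" using lim[OF that] at_within_open[OF T(2,1)] by simp
      from this[unfolded tendsto_at_iff_sequentially, rule_format, of X] X show ?thesis by (simp add: o_def)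
    qed
    have seq2: "(\<lambda>i. L2_norm (f (X i))) \<longlonglongrightarrow> L2_norm g"
    proof -
      have "((\<lambda>\<tau>. L2_norm (f \<tau>)) \<longlongrightarrow> L2_norm g) (at t within T)" using norms at_within_open[OF T(2,1)] by simp
      from this[unfolded tendsto_at_iff_sequentially, rule_format, of X] X show ?thesis by (simp add: o_def)
    qed
    have "(\<lambda>i. L2_norm (\<lambda>x. f (X i) x - g x)) \<longlonglongrightarrow> 0"
      by (rule L2_norm_lim_norms[OF _ g seq1 seq2]) (use X(1) f in blast)
    then show "((\<lambda>\<tau>. L2_norm (\<lambda>x. f \<tau> x - g x)) \<circ> X) \<longlonglongrightarrow> 0" by (simp add: o_def)
  qed
  then show ?thesis unfolding at_within_open[OF T(2,1)] .
qed

section \<open>Exponential majorants and quadratic phases\<close>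

lemma integrable_exp_sq:
  assumes "0 < k" shows "integrable Rpos (\<lambda>x. (C * exp (- k * x))\<^sup>2)"
proof -
  have "(\<lambda>x. exp (- (2 * k) * x)) integrable_on {0..}"
    by (rule integrable_on_exp_minus_to_infinity) (use assms in simp)
  then have "(\<lambda>x. exp (- (2 * k) * x)) absolutely_integrable_on {0..}"
    by (rule nonnegative_absolutely_integrable_1) simp
  then have "(\<lambda>x. exp (- (2 * k) * x)) absolutely_integrable_on {0<..}"
    by (rule set_integrable_subset) auto
  then have "integrable Rpos (\<lambda>x. C\<^sup>2 * exp (- (2 * k) * x))"
    unfolding integrable_Rpos_iff by (rule set_integrable_mult_right)
  moreover have eq: "C\<^sup>2 * exp (- (2 * k) * x) = (C * exp (- k * x))\<^sup>2" for x
    by (simp add: power_mult_distrib exp_double[symmetric])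
  ultimately show ?thesis unfolding eq by (simp only:)
qed

lemma exp_decay_L2:
  assumes "u \<in> borel_measurable Rpos" "0 < k" "\<And>x. 0 < x \<Longrightarrow> cmod (u x) \<le> C * exp (- k * x)"
  shows "u \<in> L2"
proof (rule L2I[OF assms(1)], rule Bochner_Integration.integrable_bound[OF integrable_exp_sq[OF assms(2), of C]])
  show "AE x in Rpos. norm ((cmod (u x))\<^sup>2) \<le> norm ((C * exp (- k * x))\<^sup>2)"
    by (rule AE_I2) (use assms(3) in \<open>auto intro!: power_mono\<close>)
qed (use assms(1) in auto)

lemma has_vector_derivative_exp_i:
  assumes "(\<theta> has_real_derivative \<theta>') (at x)"
  shows "((\<lambda>x. exp (\<i> * of_real (\<theta> x))) has_vector_derivative exp (\<i> * of_real (\<theta> x)) * (\<i> * of_real \<theta>')) (at x)"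
proof -
  have "((\<lambda>x. \<i> * of_real (\<theta> x)) has_vector_derivative \<i> * of_real \<theta>') (at x)"
    by (intro has_vector_derivative_mult_right has_vector_derivative_of_real assms)
  from field_vector_diff_chain_at[OF this DERIV_exp] show ?thesis by (simp add: o_def mult.commute)
qed

text \<open>A complex \<alpha> covers the chirp, the damping factor and their product at once. As m'
  = 2 \<alpha> x m, the algebra generated by m and x is closed under differentiation.\<close>

lemma smooth_gaussian:
  fixes \<alpha> :: complex
  defines "m \<equiv> \<lambda>x::real. exp (\<alpha> * of_real (x\<^sup>2))"
  shows "smooth m" "(m has_vector_derivative 2 * \<alpha> * of_real x * m x) (at x)"
proof -
  have d: "(m has_vector_derivative 2 * \<alpha> * of_real x * m x) (at x)" for x
  proof -
    have "((\<lambda>x. \<alpha> * of_real (x\<^sup>2)) has_vector_derivative \<alpha> * of_real (2 * x)) (at x)"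
      by (intro has_vector_derivative_mult_right has_vector_derivative_of_real)
         (auto intro!: derivative_eq_intros)
    from field_vector_diff_chain_at[OF this DERIV_exp] show ?thesis by (simp add: o_def m_def mult_ac)
  qed
  then show "(m has_vector_derivative 2 * \<alpha> * of_real x * m x) (at x)" .
  show "smooth m"
  proof (rule func_alg_smooth[of "{m, complex_of_real}"])
    show "m \<in> func_alg {m, complex_of_real}" by (rule func_alg.base) simp
    fix h assume h: "h \<in> {m, complex_of_real}"
    have mem: "(\<lambda>x. 2 * \<alpha> * of_real x * m x) \<in> func_alg {m, complex_of_real}"
      by (rule func_alg.mult[OF func_alg.mult[OF func_alg.const func_alg.base] func_alg.base]) auto
    have i: "(complex_of_real has_vector_derivative 1) (at x)" for x
      using has_vector_derivative_of_real[OF DERIV_ident[of "at x"]] by simp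
    show "\<exists>f'\<in>func_alg {m, complex_of_real}. \<forall>x. (h has_vector_derivative f' x) (at x)"
    proof (cases "h = m")
      case True
      show ?thesis unfolding True by (rule bexI[OF _ mem]) (intro allI d)
    next
      case False
      then have hr: "h = complex_of_real" using h by blast
      show ?thesis unfolding hr by (rule bexI[OF _ func_alg.const[of 1]]) (intro allI i)
    qed
  qed
qed

text \<open>The regularising factor \<open>exp (- \<epsilon> x\<^sup>2)\<close> gives the multiplier bounded derivatives.\<close>

lemma H10_mult_chirp:
  fixes u u' :: "real \<Rightarrow> complex" and b :: real
  assumes u: "u \<in> H10" and u': "\<And>x. 0 < x \<Longrightarrow> (u has_vector_derivative u' x) (at x)" "continuous_on {0<..} u'"
    and L: "u' \<in> L2" "(\<lambda>x. of_real x * u x) \<in> L2"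
  shows "(\<lambda>x. exp (\<i> * of_real (- b * x\<^sup>2)) * u x) \<in> H10"
proof -
  define e where "e = (\<lambda>x::real. exp (\<i> * of_real (- b * x\<^sup>2)))"
  \<comment> \<open>The derivative of the product is \<open>e x * v' x\<close>; its second term is
    the reason why x u is assumed to lie in L2.\<close>
  define v' where "v' = (\<lambda>x. u' x - 2 * \<i> * of_real b * (of_real x * u x))"
  have ne: "cmod (e x) = 1" for x unfolding e_def by (rule norm_exp_i_times)
  have eg: "e = (\<lambda>x. exp ((- \<i> * of_real b) * of_real (x\<^sup>2)))" by (simp add: e_def mult.assoc)
  have de: "(e has_vector_derivative 2 * (- \<i> * of_real b) * of_real x * e x) (at x)" for x
    unfolding eg by (rule smooth_gaussian(2))
  have ce: "continuous_on A e" for A unfolding eg by (intro smooth_imp_continuous smooth_gaussian(1))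
  have cu: "continuous_on {0<..} u"
    by (intro continuous_at_imp_continuous_on ballI has_vector_derivative_continuous[OF u'(1)]) simp
  have cv: "continuous_on {0<..} v'" unfolding v'_def by (intro continuous_intros u'(2) cu)
  have v'L: "v' \<in> L2" unfolding v'_def by (intro L2_diff L2_cmult L)
  have eL: "(\<lambda>x. e x * w x) \<in> L2" if "w \<in> L2" for w
    by (rule L2_bound(1)[OF that borel_measurable_times[OF continuous_measurable_Rpos[OF ce] L2_measurable[OF that]] zero_le_one])
       (simp add: norm_mult ne)
  have dv: "((\<lambda>x. e x * u x) has_vector_derivative e x * v' x) (at x)" if "0 < x" for x
    using has_vector_derivative_mult[OF de u'(1)[OF that]] by (simp add: v'_def algebra_simps)
  have wv: "has_weak_deriv (\<lambda>x. e x * u x) (\<lambda>x. e x * v' x)"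
  proof (rule classical_weak_deriv)
    show "((\<lambda>x. e x * u x) has_vector_derivative e x * v' x) (at x)" if "0 < x" for x by (rule dv[OF that])
    show "continuous_on {0<..} (\<lambda>x. e x * v' x)" by (intro continuous_intros ce cv)
  qed
  note v = weak_deriv_eqI[OF eL[OF H10_L2[OF u]] eL[OF v'L] wv]
  define E where "E = (\<lambda>n x. exp (complex_of_real (- (1 / real (Suc n))) * of_real (x\<^sup>2)))"
  have En: "E n x = of_real (exp (- (x\<^sup>2) / real (Suc n)))" for n x
    unfolding E_def by (simp add: exp_of_real[symmetric] del: of_nat_Suc)
  have E1: "cmod (E n x) \<le> 1" for n x unfolding En by simp
  have dE: "(E n has_vector_derivative 2 * complex_of_real (- (1 / real (Suc n))) * of_real x * E n x) (at x)" for n x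
    unfolding E_def by (rule smooth_gaussian(2))
  have cE: "continuous_on A (E n)" for A n unfolding E_def by (intro smooth_imp_continuous smooth_gaussian(1))
  have Elim: "(\<lambda>n. E n x) \<longlonglongrightarrow> 1" for x
  proof -
    have "(\<lambda>n. complex_of_real (exp (- (x\<^sup>2) * inverse (real (Suc n))))) \<longlonglongrightarrow> of_real (exp (- (x\<^sup>2) * 0))"
      by (intro tendsto_of_real tendsto_exp tendsto_mult tendsto_const LIMSEQ_inverse_real_of_nat)
    then show ?thesis unfolding En by (simp add: divide_inverse)
  qed
  \<comment> \<open>After damping, the multiplier has a bounded derivative and
    \<open>H10_mult_smooth\<close> applies, which it does not for the chirp alone.\<close>
  have inH: "(\<lambda>x. (E n x * e x) * u x) \<in> H10" for n
  proof -
    define \<alpha> where "\<alpha> = complex_of_real (- (1 / real (Suc n))) - \<i> * of_real b"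
    have m: "(\<lambda>x. E n x * e x) = (\<lambda>x. exp (\<alpha> * of_real (x\<^sup>2)))"
    proof
      fix x
      have "E n x * e x = exp (complex_of_real (- (1 / real (Suc n))) * of_real (x\<^sup>2) + (- \<i> * of_real b) * of_real (x\<^sup>2))"
        unfolding E_def eg exp_add ..
      also have "complex_of_real (- (1 / real (Suc n))) * of_real (x\<^sup>2) + (- \<i> * of_real b) * of_real (x\<^sup>2) = \<alpha> * of_real (x\<^sup>2)"
        unfolding \<alpha>_def by (simp only: distrib_right[symmetric] diff_conv_add_uminus minus_mult_left)
      finally show "E n x * e x = exp (\<alpha> * of_real (x\<^sup>2))" .
    qed
    obtain m' where m': "smooth m'" "\<And>x. ((\<lambda>x. E n x * e x) has_vector_derivative m' x) (at x)"
      unfolding m using smooth_derivative[OF smooth_gaussian(1)] by blast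
    have m'eq: "m' x = 2 * \<alpha> * of_real x * (E n x * e x)" for x
      using vector_derivative_unique_at[OF m'(2) smooth_gaussian(2)[of \<alpha> x, folded m]] fun_cong[OF m, of x] by simp
    show ?thesis
    proof (rule H10_mult_smooth[OF u _ m'(1,2)])
      show "smooth (\<lambda>x. E n x * e x)" unfolding m by (rule smooth_gaussian(1))
      show "cmod (E n x * e x) \<le> 1" for x using E1 by (simp add: norm_mult ne)
      fix x :: real assume x: "0 < x"
      \<comment> \<open>With z = x^2 / (n + 1) the bound follows from x \<le> x^2 + 1 and z exp (-
        z) \<le> 1; it degenerates as n grows, which is harmless since n is fixed here.\<close>
      have "x * exp (- (x\<^sup>2) / real (Suc n)) \<le> real (Suc n) + 1"
      proof -
        define z where "z = x\<^sup>2 / real (Suc n)"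
        have z: "0 \<le> z" by (simp add: z_def)
        have "x \<le> x\<^sup>2 + 1" using sum_squares_bound[of x 1] x by (simp add: power2_eq_square)
        also have "x\<^sup>2 = real (Suc n) * z" by (simp add: z_def del: of_nat_Suc)
        finally have "x * exp (- z) \<le> (real (Suc n) * z + 1) * exp (- z)" by (intro mult_right_mono) auto
        also have "\<dots> = real (Suc n) * (z * exp (- z)) + exp (- z)" by (simp add: algebra_simps)
        also have "\<dots> \<le> real (Suc n) * 1 + 1"
        proof (intro add_mono mult_left_mono)
          have "z \<le> exp z" using exp_ge_add_one_self[of z] by linarith
          then show "z * exp (- z) \<le> 1" by (simp add: exp_minus field_simps)
        qed (use z in auto)
        finally show ?thesis by (simp add: z_def)
      qed
      then have "cmod (of_real x * (E n x * e x)) \<le> real (Suc n) + 1"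
        unfolding En norm_mult ne using x by (simp del: of_nat_Suc)
      then have "cmod (2 * \<alpha>) * cmod (of_real x * (E n x * e x)) \<le> cmod (2 * \<alpha>) * (real (Suc n) + 1)"
        by (intro mult_left_mono) auto
      then show "cmod (m' x) \<le> cmod (2 * \<alpha>) * (real (Suc n) + 1)"
        unfolding m'eq by (simp add: norm_mult mult.assoc)
    qed
  qed
  \<comment> \<open>The derivative of (E n - 1) e u. The part in which \<open>E n\<close> is
    differentiated carries 2 / (n + 1) times x u and so vanishes in L2; the rest vanishes by
    dominated convergence.\<close>
  define D where "D = (\<lambda>n x. E n x * (e x * v' x) - e x * v' x + (2 * complex_of_real (- (1 / real (Suc n)))) * (e x * (of_real x * (E n x * u x))))"
  have EL: "(\<lambda>x. E n x * w x) \<in> L2" "L2_norm (\<lambda>x. E n x * w x) \<le> L2_norm w" if "w \<in> L2" for w n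
    using L2_bound[OF that borel_measurable_times[OF continuous_measurable_Rpos[OF cE] L2_measurable[OF that]] zero_le_one, of n]
    using mult_right_mono[OF E1 norm_ge_zero] by (auto simp: norm_mult)
  have xEL: "(\<lambda>x. of_real x * (E n x * u x)) \<in> L2" "L2_norm (\<lambda>x. of_real x * (E n x * u x)) \<le> L2_norm (\<lambda>x. of_real x * u x)" for n
    using EL[OF L(2), of n] by (simp_all add: mult.left_commute)
  have DL: "D n \<in> L2" for n
    unfolding D_def by (intro L2_add L2_diff EL(1) eL v'L L2_cmult xEL(1))
  have dD: "((\<lambda>x. E n x * e x * u x - e x * u x) has_vector_derivative D n x) (at x)" if "0 < x" for n x
    using has_vector_derivative_diff[OF has_vector_derivative_mult[OF dE dv[OF that]] dv[OF that], of n]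
    by (simp add: D_def algebra_simps)
  have cD: "continuous_on {0<..} (D n)" for n
    unfolding D_def by (intro continuous_intros cE ce cv cu)
  have dL: "(\<lambda>x. E n x * e x * u x - e x * u x) \<in> L2" for n
    unfolding mult.assoc by (intro L2_diff EL(1) eL H10_L2[OF u])
  have wD: "has_weak_deriv (\<lambda>x. E n x * e x * u x - e x * u x) (D n)" for n
  proof (rule classical_weak_deriv)
    show "((\<lambda>x. E n x * e x * u x - e x * u x) has_vector_derivative D n x) (at x)" if "0 < x" for x
      by (rule dD[OF that])
  qed (rule cD)
  note dw = weak_deriv_eqI[OF dL DL wD]
  have sq: "integrable Rpos (\<lambda>x. (cmod (w x))\<^sup>2)" if "w \<in> L2" for w by (rule L2_integrable[OF that])
  have lim1: "(\<lambda>n. L2_norm (\<lambda>x. E n x * w x - w x)) \<longlonglongrightarrow> 0" if w: "w \<in> L2" for w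
  proof (rule L2_norm_lim_dominated[OF _ L2_measurable[OF w] sq[OF w]])
    show "(\<lambda>x. E n x * w x) \<in> borel_measurable Rpos" for n by (rule L2_measurable[OF EL(1)[OF w]])
    show "cmod (E n x * w x) \<le> cmod (w x)" for n x
      using mult_right_mono[OF E1 norm_ge_zero, of n x "w x"] by (simp add: norm_mult)
    show "(\<lambda>n. E n x * w x) \<longlonglongrightarrow> w x" for x using tendsto_mult[OF Elim tendsto_const[of "w x"]] by simp
  qed
  have "(\<lambda>n. H1_norm (\<lambda>x. E n x * e x * u x - e x * u x)) \<longlonglongrightarrow> 0"
  proof (rule tendsto_sandwich[OF _ _ tendsto_const])
    let ?b = "\<lambda>n. L2_norm (\<lambda>x. E n x * (e x * u x) - e x * u x) + (L2_norm (\<lambda>x. E n x * (e x * v' x) - e x * v' x)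
        + 2 * inverse (real (Suc n)) * L2_norm (\<lambda>x. of_real x * u x))"
    show "\<forall>\<^sub>F n in sequentially. H1_norm (\<lambda>x. E n x * e x * u x - e x * u x) \<le> ?b n"
    proof (intro always_eventually allI)
      fix n
      have "L2_norm (D n) \<le> L2_norm (\<lambda>x. E n x * (e x * v' x) - e x * v' x)
          + L2_norm (\<lambda>x. (2 * complex_of_real (- (1 / real (Suc n)))) * (e x * (of_real x * (E n x * u x))))"
        unfolding D_def by (intro L2_norm_triangle L2_diff EL(1) eL v'L L2_cmult xEL(1))
      also have "L2_norm (\<lambda>x. (2 * complex_of_real (- (1 / real (Suc n)))) * (e x * (of_real x * (E n x * u x))))
          = 2 * inverse (real (Suc n)) * L2_norm (\<lambda>x. of_real x * (E n x * u x))"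
      proof -
        have "cmod (2 * complex_of_real (- (1 / real (Suc n)))) = 2 * inverse (real (Suc n))"
          unfolding norm_mult norm_of_real by (simp add: divide_inverse del: of_nat_Suc)
        moreover have "L2_norm (\<lambda>x. e x * (of_real x * (E n x * u x))) = L2_norm (\<lambda>x. of_real x * (E n x * u x))"
          by (simp add: L2_norm_def norm_mult ne)
        ultimately show ?thesis unfolding L2_norm_cmult by simp
      qed
      also have "\<dots> \<le> 2 * inverse (real (Suc n)) * L2_norm (\<lambda>x. of_real x * u x)"
        by (intro mult_left_mono xEL(2)) simp
      finally show "H1_norm (\<lambda>x. E n x * e x * u x - e x * u x) \<le> ?b n"
        using H1_norm_le[of "\<lambda>x. E n x * e x * u x - e x * u x"] unfolding dw(3) by (simp add: mult.assoc)
    qed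
    have "?b \<longlonglongrightarrow> 0 + (0 + 2 * 0 * L2_norm (\<lambda>x. of_real x * u x))"
      by (intro tendsto_add tendsto_mult tendsto_const lim1 eL H10_L2[OF u] v'L LIMSEQ_inverse_real_of_nat)
    then show "?b \<longlonglongrightarrow> 0" by simp
  qed simp
  note limH = this
  have "(\<lambda>x. e x * u x) \<in> H10"
  proof (rule H10_closed[OF v(1)])
    fix d :: real assume "0 < d"
    from eventually_happens[OF order_tendstoD(2)[OF limH this]]
    obtain n where n: "H1_norm (\<lambda>x. E n x * e x * u x - e x * u x) < d" by auto
    have "H1_norm (\<lambda>x. e x * u x - E n x * e x * u x) < d"
      using n H1_norm_minus_commute[OF v(1) H10_H1[OF inH[of n]]] by simp
    then show "\<exists>w\<in>H10. H1_norm (\<lambda>x. e x * u x - w x) < d" by (intro bexI[OF _ inH[of n]])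
  qed
  then show ?thesis by (simp add: e_def)
qed


lemma has_vector_derivative_quotient:
  fixes f :: "real \<Rightarrow> complex"
  assumes "(f has_vector_derivative f') (at t)"
  shows "((\<lambda>s. (f s - f t) / of_real (s - t)) \<longlongrightarrow> f') (at t)"
proof -
  have 1: "((\<lambda>y. ((f y - f t) - (y - t) *\<^sub>R f') /\<^sub>R norm (y - t)) \<longlongrightarrow> 0) (at t)"
    using assms unfolding has_vector_derivative_def has_derivative_at_within by blast
  have "((\<lambda>y. norm ((f y - f t) / of_real (y - t) - f')) \<longlongrightarrow> 0) (at t)"
  proof (rule Lim_transform_eventually[OF tendsto_norm_zero[OF 1]])
    show "\<forall>\<^sub>F y in at t. norm (((f y - f t) - (y - t) *\<^sub>R f') /\<^sub>R norm (y - t)) = norm ((f y - f t) / of_real (y - t) - f')"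
      using eventually_neq_at_within[of t t UNIV]
    proof eventually_elim
      case (elim y)
      then have "(f y - f t) / of_real (y - t) - f' = ((f y - f t) - (y - t) *\<^sub>R f') / of_real (y - t)"
        by (simp add: diff_divide_distrib scaleR_conv_of_real del: of_real_diff)
      then show ?case by (simp add: norm_divide norm_mult norm_inverse divide_inverse mult.commute del: of_real_diff)
    qed
  qed
  then show ?thesis by (simp only: tendsto_norm_zero_iff LIM_zero_iff)
qed

text \<open>The evolution equation for U divided by its amplitude, with s = S(t), y = x / s, A = a,
  w = \<omega>, F = f(y), G = g(y), N = |f(y)|^4. In order: i times the time derivative, the second
  x-derivative with the stationary equation inserted for g', the potential, the
  nonlinearity.\<close>

lemma nls_identity:
  fixes s y A w c N F G :: complex
  shows "\<i> * (A / (2 * s) * F + \<i> * (w / s\<^sup>2 - A\<^sup>2 * y\<^sup>2 / 4) * F + A * y / s * G)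
    + ((\<i> * (- (A * y / 2))) * (1 / s * G - \<i> * (A * y / 2) * F)
       + (1 / s * (1 / s * ((w - c / y\<^sup>2 - N) * F)) - (\<i> * (A * y / 2) * (1 / s * G) + \<i> * (A * (1 / s) / 2) * F)))
    + c * (F / (s\<^sup>2 * y\<^sup>2)) + N / s\<^sup>2 * F = 0"
proof -
  \<comment> \<open>With \<open>p\<close>, \<open>r\<close> and \<open>B\<close> as free variables
    the identity is polynomial: no inverse is ever cancelled, so the default value of division by
    zero is harmless. The imaginary unit enters only through j * j = -1.\<close>
  define p r B where "p = inverse s" and "r = inverse (y\<^sup>2)" and "B = A / 2"
  have *: "j * (B * p * F + j * (w * p\<^sup>2 - B\<^sup>2 * y\<^sup>2) * F + 2 * B * y * p * G)
    + ((j * (- (B * y))) * (p * G - j * (B * y) * F)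
       + (p * (p * ((w - c * r - N) * F)) - (j * (B * y) * (p * G) + j * (B * p) * F)))
    + c * (F * (p\<^sup>2 * r)) + N * p\<^sup>2 * F = 0" if "j * j = - 1" for j :: complex
    using that by algebra
  have e: "A / (2 * s) = B * p" "w / s\<^sup>2 = w * p\<^sup>2" "A\<^sup>2 * y\<^sup>2 / 4 = B\<^sup>2 * y\<^sup>2" "A * y / s = 2 * B * y * p"
    "A * y / 2 = B * y" "1 / s = p" "c / y\<^sup>2 = c * r" "F / (s\<^sup>2 * y\<^sup>2) = F * (p\<^sup>2 * r)" "N / s\<^sup>2 = N * p\<^sup>2"
    "A * p / 2 = B * p"
    by (simp_all add: p_def r_def B_def) (simp_all add: divide_simps power2_eq_square)
  show ?thesis unfolding e using *[of \<i>] by (simp only: e i_squared)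
qed

text \<open>The weights in \<open>f_bound\<close> and \<open>g_bound\<close> match the terms f, y f,
  y^2 f and y g in the derivatives of U. For g itself only membership in L2 is available, because it
  may be singular at 0.\<close>

locale pseudo_conformal =
  fixes f g :: "real \<Rightarrow> complex" and \<omega> c a C k :: real
  assumes f_cont: "continuous_on UNIV f"
    and f_deriv: "\<And>x. 0 < x \<Longrightarrow> (f has_vector_derivative g x) (at x)"
    and g_deriv: "\<And>x. 0 < x \<Longrightarrow> (g has_vector_derivative (\<omega> - c / x\<^sup>2 - cmod (f x) ^ 4) *\<^sub>R f x) (at x)"
    and f_H10: "f \<in> H10" and g_L2: "g \<in> L2"
    and \<omega>: "0 < \<omega>" and k: "0 < k" and C: "0 \<le> C" and a: "0 < a"
    and f_bound: "\<And>y. 0 < y \<Longrightarrow> (1 + y + y\<^sup>2) * cmod (f y) \<le> C * exp (- k * y)"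
    and g_bound: "\<And>y. 0 < y \<Longrightarrow> cmod (of_real y * g y) \<le> C * exp (- k * y)"
begin

definition S :: "real \<Rightarrow> real" where "S t = 1 - a * t"

definition phase :: "real \<Rightarrow> real \<Rightarrow> real" where
  "phase t x = \<omega> * t / S t - a * x\<^sup>2 / (4 * S t)"

definition amp :: "real \<Rightarrow> real \<Rightarrow> complex" where
  "amp t x = of_real (inverse (sqrt (S t))) * exp (\<i> * of_real (phase t x))"

definition U :: "real \<Rightarrow> real \<Rightarrow> complex" where
  "U t x = amp t x * f (x / S t)"

text \<open>Two terms kept apart on purpose: the first contains g and is controlled through its norm
  only, the second has an exponential majorant.\<close>

definition Ux :: "real \<Rightarrow> real \<Rightarrow> complex" where
  "Ux t x = amp t x * (of_real (1 / S t) * g (x / S t)) - amp t x * (\<i> * of_real (a * (x / S t) / 2) * f (x / S t))"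

definition Ut :: "real \<Rightarrow> real \<Rightarrow> complex" where
  "Ut t x = amp t x * (of_real (a / (2 * S t)) * f (x / S t)
     + \<i> * of_real (\<omega> / (S t)\<^sup>2 - a\<^sup>2 * (x / S t)\<^sup>2 / 4) * f (x / S t) + of_real (a * (x / S t) / S t) * g (x / S t))"

text \<open>The value that the equation prescribes for the second derivative. Proving that it is the
  derivative of \<open>Ux\<close> thus amounts to verifying the equation pointwise.\<close>

definition Uxx :: "real \<Rightarrow> real \<Rightarrow> complex" where
  "Uxx t x = - (\<i> * Ut t x + of_real c * (U t x / of_real (x\<^sup>2)) + nls_power (U t x))"

section \<open>Pointwise calculus for the explicit solution\<close>

lemma S_pos: "t < 1 / a \<Longrightarrow> 0 < S t"
  using a by (simp add: S_def field_simps)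

lemma g_cont: "continuous_on {0<..} g"
  by (intro continuous_at_imp_continuous_on ballI has_vector_derivative_continuous[OF g_deriv]) simp

lemma cmod_amp: "t < 1 / a \<Longrightarrow> cmod (amp t x) = inverse (sqrt (S t))"
  using S_pos[of t] by (simp add: amp_def norm_mult del: of_real_inverse)

lemma amp_deriv_x: "(amp t has_vector_derivative amp t x * (\<i> * of_real (- (a * (x / S t) / 2)))) (at x)"
proof -
  have "phase t = (\<lambda>x. \<omega> * t / S t - a / (4 * S t) * x\<^sup>2)" by (simp add: phase_def fun_eq_iff)
  moreover have "((\<lambda>x. \<omega> * t / S t - a / (4 * S t) * x\<^sup>2) has_real_derivative 0 - a / (4 * S t) * (2 * x)) (at x)"
    by (rule DERIV_diff[OF DERIV_const DERIV_cmult]) (auto intro!: derivative_eq_intros)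
  moreover have "0 - a / (4 * S t) * (2 * x) = - (a * (x / S t) / 2)"
    by (cases "S t = 0") (simp_all add: field_simps)
  ultimately have "(phase t has_real_derivative - (a * (x / S t) / 2)) (at x)" by (simp only:)
  from has_vector_derivative_mult_right[OF has_vector_derivative_exp_i[OF this], of "of_real (inverse (sqrt (S t)))"]
  show ?thesis unfolding amp_def[abs_def] by (simp only: mult.assoc)
qed

lemma S_deriv: "(S has_real_derivative - a) (at t)"
  unfolding S_def[abs_def] by (auto intro!: derivative_eq_intros)

lemma amp_deriv_t:
  assumes t: "t < 1 / a"
  shows "((\<lambda>t. amp t x) has_vector_derivative
    amp t x * (of_real (a / (2 * S t)) + \<i> * of_real (\<omega> / (S t)\<^sup>2 - a\<^sup>2 * (x / S t)\<^sup>2 / 4))) (at t)"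
proof -
  have S: "0 < S t" by (rule S_pos[OF t])
  have dr: "((\<lambda>t. inverse (sqrt (S t))) has_real_derivative a / (2 * S t) * inverse (sqrt (S t))) (at t)"
  proof -
    have ss: "inverse (sqrt (S t)) * inverse (sqrt (S t)) = inverse (S t)"
      using S by (simp add: inverse_mult_distrib[symmetric])
    have "sqrt (S t) \<noteq> 0" using S by simp
    from DERIV_inverse'[OF DERIV_chain2[OF DERIV_real_sqrt[OF S] S_deriv] this]
    have "((\<lambda>t. inverse (sqrt (S t))) has_real_derivative
      - (inverse (sqrt (S t)) * (inverse (sqrt (S t)) / 2 * - a) * inverse (sqrt (S t)))) (at t)" .
    moreover have "- (inverse (sqrt (S t)) * (inverse (sqrt (S t)) / 2 * - a) * inverse (sqrt (S t)))
      = a / 2 * (inverse (sqrt (S t)) * inverse (sqrt (S t))) * inverse (sqrt (S t))" by simp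
    moreover have "a / 2 * inverse (S t) = a / (2 * S t)" using S by (simp add: field_simps)
    ultimately show ?thesis unfolding ss by (simp only:)
  qed
  have dp: "((\<lambda>t. phase t x) has_real_derivative \<omega> / (S t)\<^sup>2 - a\<^sup>2 * (x / S t)\<^sup>2 / 4) (at t)"
  proof -
    have "((\<lambda>t. phase t x) has_real_derivative
       (\<omega> * S t - \<omega> * t * - a) / (S t * S t) - (0 * (4 * S t) - a * x\<^sup>2 * (4 * - a)) / ((4 * S t) * (4 * S t))) (at t)"
      unfolding phase_def
      by (rule DERIV_diff; rule DERIV_divide) (use S S_deriv in \<open>auto intro!: derivative_eq_intros\<close>)
    moreover have e1: "(\<omega> * S t - \<omega> * t * - a) / (S t * S t) = \<omega> / (S t)\<^sup>2"
      by (simp add: S_def power2_eq_square algebra_simps)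
    moreover have e2: "(0 * (4 * S t) - a * x\<^sup>2 * (4 * - a)) / ((4 * S t) * (4 * S t)) = a\<^sup>2 * (x / S t)\<^sup>2 / 4"
      using S by (simp add: field_simps power2_eq_square)
    ultimately show ?thesis by (simp only:)
  qed
  have "((\<lambda>t. complex_of_real (inverse (sqrt (S t))) * exp (\<i> * of_real (phase t x))) has_vector_derivative
    of_real (inverse (sqrt (S t))) * (exp (\<i> * of_real (phase t x)) * (\<i> * of_real (\<omega> / (S t)\<^sup>2 - a\<^sup>2 * (x / S t)\<^sup>2 / 4)))
    + of_real (a / (2 * S t) * inverse (sqrt (S t))) * exp (\<i> * of_real (phase t x))) (at t)"
    by (rule has_vector_derivative_mult[OF has_vector_derivative_of_real[OF dr] has_vector_derivative_exp_i[OF dp]])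
  then show ?thesis unfolding amp_def
    by (rule has_vector_derivative_eq_rhs) (simp only: of_real_mult distrib_left mult_ac add.commute)
qed

lemma f_dilate_deriv:
  assumes "t < 1 / a" "0 < x"
  shows "((\<lambda>x. f (x / S t)) has_vector_derivative of_real (1 / S t) * g (x / S t)) (at x)"
    "((\<lambda>x. g (x / S t)) has_vector_derivative
       of_real (1 / S t) * (of_real (\<omega> - c / (x / S t)\<^sup>2 - cmod (f (x / S t)) ^ 4) * f (x / S t))) (at x)"
    "((\<lambda>t. f (x / S t)) has_vector_derivative of_real (a * (x / S t) / S t) * g (x / S t)) (at t)"
proof -
  have S: "0 < S t" by (rule S_pos[OF assms(1)])
  then have y: "0 < x / S t" using assms(2) by simp
  have dx: "((\<lambda>x. x / S t) has_vector_derivative 1 / S t) (at x)"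
    unfolding has_real_derivative_iff_has_vector_derivative[symmetric] using S by (auto intro!: derivative_eq_intros)
  have "((\<lambda>t. x / S t) has_real_derivative (0 * S t - x * - a) / (S t * S t)) (at t)"
    by (rule DERIV_divide) (use S S_deriv in auto)
  then have dt: "((\<lambda>t. x / S t) has_vector_derivative a * (x / S t) / S t) (at t)"
    unfolding has_real_derivative_iff_has_vector_derivative[symmetric] by (simp add: mult.commute)
  show "((\<lambda>x. f (x / S t)) has_vector_derivative of_real (1 / S t) * g (x / S t)) (at x)"
    using vector_diff_chain_at[OF dx f_deriv[OF y]] unfolding o_def scaleR_conv_of_real .
  show "((\<lambda>x. g (x / S t)) has_vector_derivative
       of_real (1 / S t) * (of_real (\<omega> - c / (x / S t)\<^sup>2 - cmod (f (x / S t)) ^ 4) * f (x / S t))) (at x)"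
    using vector_diff_chain_at[OF dx g_deriv[OF y]] unfolding o_def scaleR_conv_of_real .
  show "((\<lambda>t. f (x / S t)) has_vector_derivative of_real (a * (x / S t) / S t) * g (x / S t)) (at t)"
    using vector_diff_chain_at[OF dt f_deriv[OF y]] unfolding o_def scaleR_conv_of_real .
qed

lemma U_deriv_x:
  assumes "t < 1 / a" "0 < x" shows "(U t has_vector_derivative Ux t x) (at x)"
  using has_vector_derivative_mult[OF amp_deriv_x f_dilate_deriv(1)[OF assms]]
  unfolding U_def[abs_def] by (rule has_vector_derivative_eq_rhs) (simp add: Ux_def algebra_simps)

lemma U_deriv_t:
  assumes "t < 1 / a" "0 < x" shows "((\<lambda>t. U t x) has_vector_derivative Ut t x) (at t)"
  using has_vector_derivative_mult[OF amp_deriv_t[OF assms(1)] f_dilate_deriv(3)[OF assms]]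
  unfolding U_def[abs_def] by (rule has_vector_derivative_eq_rhs) (simp only: Ut_def distrib_left distrib_right mult_ac add_ac)

text \<open>Each term of the equation is written as the amplitude times an expression in y = x /
  S(t); the sum of these expressions is \<open>nls_identity\<close>.\<close>

lemma Ux_deriv_x:
  assumes t: "t < 1 / a" and x: "0 < x" shows "(Ux t has_vector_derivative Uxx t x) (at x)"
proof -
  have S: "0 < S t" by (rule S_pos[OF t])
  define y where "y = x / S t"
  have y: "0 < y" using S x by (simp add: y_def)
  define G where "G = (\<lambda>x. of_real (1 / S t) * g (x / S t) - \<i> * of_real (a * (x / S t) / 2) * f (x / S t))"
  define G' where "G' = of_real (1 / S t) * (of_real (1 / S t) * (of_real (\<omega> - c / y\<^sup>2 - cmod (f y) ^ 4) * f y))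
     - (\<i> * of_real (a * y / 2) * (of_real (1 / S t) * g y) + \<i> * of_real (a * (1 / S t) / 2) * f y)"
  have dl: "((\<lambda>x. \<i> * complex_of_real (a * (x / S t) / 2)) has_vector_derivative \<i> * of_real (a * (1 / S t) / 2)) (at x)"
    by (intro has_vector_derivative_mult_right has_vector_derivative_of_real)
       (use S in \<open>auto intro!: derivative_eq_intros\<close>)
  have dG: "(G has_vector_derivative G') (at x)"
    unfolding G_def G'_def y_def
    by (intro has_vector_derivative_diff has_vector_derivative_mult_right f_dilate_deriv(2)[OF t x]
        has_vector_derivative_mult[OF dl f_dilate_deriv(1)[OF t x]])
  have Ueq: "Ux t = (\<lambda>x. amp t x * G x)" by (simp add: fun_eq_iff Ux_def G_def right_diff_distrib)
  have d: "(Ux t has_vector_derivative amp t x * G' + amp t x * (\<i> * of_real (- (a * (x / S t) / 2))) * G x) (at x)"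
    unfolding Ueq by (rule has_vector_derivative_mult[OF amp_deriv_x dG])
  \<comment> \<open>The fourth power of the amplitude is 1 / S^2, the factor that the dilation also
    puts on the second derivative and on the potential; this match is where the exponent 5
    enters.\<close>
  have np: "nls_power (U t x) = amp t x * (of_real (cmod (f y) ^ 4 / (S t)\<^sup>2) * f y)"
  proof -
    have "inverse (sqrt (S t)) ^ 4 = 1 / (S t)\<^sup>2"
    proof -
      have "inverse (sqrt (S t)) ^ 4 = (inverse (sqrt (S t) ^ 2)) ^ 2" by (simp flip: power_mult add: power_inverse)
      then show ?thesis using S by (simp add: field_simps)
    qed
    then have "cmod (U t x) ^ 4 = cmod (f y) ^ 4 / (S t)\<^sup>2"
      unfolding U_def norm_mult cmod_amp[OF t] power_mult_distrib y_def[symmetric] by simp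
    then show ?thesis unfolding nls_power_def by (simp only: U_def y_def[symmetric] mult_ac)
  qed
  have "\<i> * Ut t x + (amp t x * G' + amp t x * (\<i> * of_real (- (a * (x / S t) / 2))) * G x)
     + of_real c * (U t x / of_real (x\<^sup>2)) + nls_power (U t x)
    = amp t x * (\<i> * (of_real a / (2 * of_real (S t)) * f y + \<i> * (of_real \<omega> / (of_real (S t))\<^sup>2 - (of_real a)\<^sup>2 * (of_real y)\<^sup>2 / 4) * f y + of_real a * of_real y / of_real (S t) * g y)
    + ((\<i> * (- (of_real a * of_real y / 2))) * (1 / of_real (S t) * g y - \<i> * (of_real a * of_real y / 2) * f y)
       + (1 / of_real (S t) * (1 / of_real (S t) * ((of_real \<omega> - of_real c / (of_real y)\<^sup>2 - of_real (cmod (f y) ^ 4)) * f y)) - (\<i> * (of_real a * of_real y / 2) * (1 / of_real (S t) * g y) + \<i> * (of_real a * (1 / of_real (S t)) / 2) * f y)))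
    + of_real c * (f y / ((of_real (S t))\<^sup>2 * (of_real y)\<^sup>2)) + of_real (cmod (f y) ^ 4) / (of_real (S t))\<^sup>2 * f y)"
  proof -
    have xy: "x = S t * y" using S by (simp add: y_def)
    have Uy: "U t x / of_real (x\<^sup>2) = amp t x * (f y / ((of_real (S t))\<^sup>2 * (of_real y)\<^sup>2))"
      unfolding U_def y_def[symmetric] by (simp add: xy power_mult_distrib)
    show ?thesis
      unfolding np Uy Ut_def G_def G'_def y_def[symmetric]
      by (simp add: distrib_left right_diff_distrib mult_ac)
  qed
  also have "\<dots> = 0"
    by (simp only: nls_identity mult_zero_right)
  finally have "amp t x * G' + amp t x * (\<i> * of_real (- (a * (x / S t) / 2))) * G x = Uxx t x"
    unfolding Uxx_def by (simp add: eq_neg_iff_add_eq_0 algebra_simps)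
  then show ?thesis using d by simp
qed

lemma cont_x:
  assumes t: "t < 1 / a"
  shows "continuous_on {0<..} (amp t)" "continuous_on {0<..} (\<lambda>x. f (x / S t))" "continuous_on {0<..} (\<lambda>x. g (x / S t))"
    "continuous_on {0<..} (U t)" "continuous_on {0<..} (Ux t)" "continuous_on {0<..} (Ut t)" "continuous_on {0<..} (Uxx t)"
proof -
  have S: "0 < S t" by (rule S_pos[OF t])
  show 1: "continuous_on {0<..} (amp t)"
    by (intro continuous_at_imp_continuous_on ballI has_vector_derivative_continuous[OF amp_deriv_x])
  show 2: "continuous_on {0<..} (\<lambda>x. f (x / S t))"
    by (intro continuous_at_imp_continuous_on ballI has_vector_derivative_continuous[OF f_dilate_deriv(1)[OF t]]) simp
  show 3: "continuous_on {0<..} (\<lambda>x. g (x / S t))"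
    by (intro continuous_at_imp_continuous_on ballI has_vector_derivative_continuous[OF f_dilate_deriv(2)[OF t]]) simp
  show 4: "continuous_on {0<..} (U t)"
    unfolding U_def[abs_def] by (intro continuous_intros 1 2)
  show "continuous_on {0<..} (Ux t)"
    unfolding Ux_def[abs_def] by (intro continuous_intros 1 2 3) (use S in auto)
  show 5: "continuous_on {0<..} (Ut t)"
    unfolding Ut_def[abs_def] by (intro continuous_intros 1 2 3) (use S in auto)
  show "continuous_on {0<..} (Uxx t)"
    unfolding Uxx_def[abs_def] by (intro continuous_intros continuous_on_nls_power 4 5) auto
qed

text \<open>Majorants that do not depend on the time, as dominated convergence in t requires. The
  lower bound \<open>s1\<close> controls the amplitude and the powers of 1 / S, the upper bound
  \<open>s2\<close> the decay rate k / s2. The term of \<open>Ux\<close> with g is left out.\<close>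

lemma uniform_bounds:
  assumes s: "0 < s1" "s1 \<le> s2"
  shows "\<exists>L q. 0 < q \<and> 0 \<le> L \<and> (\<forall>t x. t < 1 / a \<longrightarrow> s1 \<le> S t \<longrightarrow> S t \<le> s2 \<longrightarrow> 0 < x \<longrightarrow>
     cmod (U t x) \<le> L * exp (- q * x) \<and> cmod (Ut t x) \<le> L * exp (- q * x) \<and>
     cmod (amp t x * (\<i> * of_real (a * (x / S t) / 2) * f (x / S t))) \<le> L * exp (- q * x))"
proof -
  define q where "q = k / s2"
  \<comment> \<open>Sum of the constants of the separate estimates: 1 for \<open>U\<close>, the next
    three for \<open>Ut\<close>, and a / 2 for the second term of \<open>Ux\<close>.\<close>
  define B where "B = 1 + a / (2 * s1) + (\<omega> / s1\<^sup>2 + a\<^sup>2 / 4) + a / s1 + a / 2"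
  define L where "L = inverse (sqrt s1) * (B * C)"
  have q: "0 < q" using k s by (simp add: q_def)
  have B: "0 \<le> B" using a \<omega> s by (simp add: B_def)
  have L: "0 \<le> L" using B C s by (simp add: L_def)
  have main: "cmod (amp t x) * z \<le> L * exp (- q * x)"
    if t: "t < 1 / a" "s1 \<le> S t" "S t \<le> s2" "0 < x" and z: "z \<le> b * (C * exp (- k * (x / S t)))" "b \<le> B" "0 \<le> z" for t x z b :: real
  proof -
    have S: "0 < S t" by (rule S_pos[OF t(1)])
    have "x / s2 \<le> x / S t" using t S s by (intro divide_left_mono) auto
    then have "k * (x / s2) \<le> k * (x / S t)" using k by (intro mult_left_mono) auto
    then have e: "exp (- k * (x / S t)) \<le> exp (- q * x)" by (simp add: q_def)
    have "z \<le> B * (C * exp (- k * (x / S t)))"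
      using z(1) mult_right_mono[OF z(2), of "C * exp (- k * (x / S t))"] C by (meson mult_nonneg_nonneg exp_ge_zero order_trans)
    also have "\<dots> \<le> B * (C * exp (- q * x))" using e B C by (intro mult_left_mono) auto
    finally have z2: "z \<le> B * C * exp (- q * x)" by simp
    have "cmod (amp t x) \<le> inverse (sqrt s1)"
      unfolding cmod_amp[OF t(1)] using s t by (intro le_imp_inverse_le) auto
    then have "cmod (amp t x) * z \<le> inverse (sqrt s1) * (B * C * exp (- q * x))"
      using z2 z(3) s by (intro mult_mono) auto
    then show ?thesis by (simp add: L_def mult_ac)
  qed
  have "cmod (U t x) \<le> L * exp (- q * x) \<and> cmod (Ut t x) \<le> L * exp (- q * x) \<and>
     cmod (amp t x * (\<i> * of_real (a * (x / S t) / 2) * f (x / S t))) \<le> L * exp (- q * x)"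
    if t: "t < 1 / a" "s1 \<le> S t" "S t \<le> s2" "0 < x" for t x :: real
  proof -
    have S: "0 < S t" by (rule S_pos[OF t(1)])
    define y where "y = x / S t"
    have y: "0 < y" using S t by (simp add: y_def)
    define E where "E = C * exp (- k * y)"
    have E: "0 \<le> E" using C by (simp add: E_def)
    have p: "0 \<le> cmod (f y)" "0 \<le> y * cmod (f y)" "0 \<le> y\<^sup>2 * cmod (f y)" using y by auto
    have sum: "cmod (f y) + y * cmod (f y) + y\<^sup>2 * cmod (f y) \<le> E"
      using f_bound[OF y] by (simp add: E_def distrib_right)
    have f0: "cmod (f y) \<le> E" and f1: "y * cmod (f y) \<le> E" and f2: "y\<^sup>2 * cmod (f y) \<le> E"
      using sum p by linarith+
    have g1: "y * cmod (g y) \<le> E" using g_bound[OF y] y by (simp add: E_def norm_mult)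
    have inv: "1 / S t \<le> 1 / s1" using s t by (intro divide_left_mono) auto
    have "a / (2 * S t) \<le> a / (2 * s1)" using s t S a by (intro divide_left_mono) auto
    have b1: "1 \<le> B" using a \<omega> s by (simp add: B_def)
    have "cmod (f y) \<le> 1 * (C * exp (- k * (x / S t)))" using f0 by (simp add: E_def y_def)
    from main[OF t this b1] have r1: "cmod (U t x) \<le> L * exp (- q * x)"
      by (simp add: U_def norm_mult y_def)
    have "cmod (\<i> * of_real (a * y / 2) * f y) = a / 2 * (y * cmod (f y))"
      using a y by (simp add: norm_mult)
    also have "\<dots> \<le> a / 2 * E" using f1 a by (intro mult_left_mono) auto
    finally have 3: "cmod (\<i> * of_real (a * (x / S t) / 2) * f (x / S t)) \<le> a / 2 * (C * exp (- k * (x / S t)))"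
      by (simp only: E_def y_def)
    have b3: "a / 2 \<le> B" using a \<omega> s by (simp add: B_def)
    from main[OF t 3 b3 norm_ge_zero]
    have r3: "cmod (amp t x * (\<i> * of_real (a * (x / S t) / 2) * f (x / S t))) \<le> L * exp (- q * x)"
      by (simp only: norm_mult)
    define Z where "Z = of_real (a / (2 * S t)) * f y + \<i> * of_real (\<omega> / (S t)\<^sup>2 - a\<^sup>2 * y\<^sup>2 / 4) * f y + of_real (a * y / S t) * g y"
    have z1: "cmod (of_real (a / (2 * S t)) * f y) \<le> a / (2 * s1) * E"
    proof -
      have "cmod (of_real (a / (2 * S t)) * f y) = a / (2 * S t) * cmod (f y)" using a S by (simp add: norm_mult norm_divide)
      also have "\<dots> \<le> a / (2 * s1) * E"
        by (intro mult_mono f0 \<open>a / (2 * S t) \<le> a / (2 * s1)\<close>) (use a s in auto)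
      finally show ?thesis .
    qed
    have z2: "cmod (\<i> * of_real (\<omega> / (S t)\<^sup>2 - a\<^sup>2 * y\<^sup>2 / 4) * f y) \<le> (\<omega> / s1\<^sup>2 + a\<^sup>2 / 4) * E"
    proof -
      have "cmod (\<i> * of_real (\<omega> / (S t)\<^sup>2 - a\<^sup>2 * y\<^sup>2 / 4) * f y) = \<bar>\<omega> / (S t)\<^sup>2 - a\<^sup>2 * y\<^sup>2 / 4\<bar> * cmod (f y)"
        unfolding norm_mult norm_ii norm_of_real by simp
      also have "\<dots> \<le> (\<omega> / (S t)\<^sup>2 + a\<^sup>2 * y\<^sup>2 / 4) * cmod (f y)"
        using \<omega> by (intro mult_right_mono) (auto intro: order_trans[OF abs_triangle_ineq4])
      also have "\<dots> = \<omega> / (S t)\<^sup>2 * cmod (f y) + a\<^sup>2 / 4 * (y\<^sup>2 * cmod (f y))" by (simp add: algebra_simps)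
      also have "\<dots> \<le> \<omega> / s1\<^sup>2 * E + a\<^sup>2 / 4 * E"
      proof (intro add_mono mult_mono f0 f2 mult_left_mono)
        show "\<omega> / (S t)\<^sup>2 \<le> \<omega> / s1\<^sup>2" using \<omega> s t S by (intro divide_left_mono power_mono) auto
      qed (use \<omega> s in auto)
      finally show ?thesis by (simp add: distrib_right)
    qed
    have z3: "cmod (of_real (a * y / S t) * g y) \<le> a / s1 * E"
    proof -
      have "cmod (of_real (a * y / S t) * g y) = a / S t * (y * cmod (g y))" using a S y by (simp add: norm_mult norm_divide)
      also have "\<dots> \<le> a / s1 * E"
        using inv a s t S by (intro mult_mono g1 divide_left_mono) (auto intro: mult_nonneg_nonneg less_imp_le[OF y])
      finally show ?thesis .
    qed
    have "cmod Z \<le> a / (2 * s1) * E + (\<omega> / s1\<^sup>2 + a\<^sup>2 / 4) * E + a / s1 * E"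
      unfolding Z_def by (intro norm_triangle_le add_mono z1 z2 z3)
    then have "cmod Z \<le> (a / (2 * s1) + (\<omega> / s1\<^sup>2 + a\<^sup>2 / 4) + a / s1) * (C * exp (- k * (x / S t)))"
      by (simp only: distrib_right E_def y_def)
    from main[OF t this _ norm_ge_zero] have "cmod (amp t x) * cmod Z \<le> L * exp (- q * x)"
      using a by (simp add: B_def)
    then have r2: "cmod (Ut t x) \<le> L * exp (- q * x)"
      unfolding Ut_def norm_mult Z_def y_def .
    show ?thesis using r1 r2 r3 by (intro conjI)
  qed
  then show ?thesis by (intro exI[of _ L] exI[of _ q] conjI allI impI q L) blast+
qed

end


context pseudo_conformal
begin

section \<open>Membership in H10, norms and continuity in time\<close>

lemma xf_bound: assumes "0 < x" shows "cmod (of_real x * f x) \<le> C * exp (- k * x)"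
proof -
  have p: "0 \<le> cmod (f x)" "0 \<le> x\<^sup>2 * cmod (f x)" by simp_all
  have "cmod (f x) + x * cmod (f x) + x\<^sup>2 * cmod (f x) \<le> C * exp (- k * x)"
    using f_bound[OF assms] by (simp add: distrib_right)
  then have "x * cmod (f x) \<le> C * exp (- k * x)" using p by linarith
  then show ?thesis using assms by (simp add: norm_mult)
qed

lemma f_cont_Rpos: "continuous_on {0<..} f"
  by (rule continuous_on_subset[OF f_cont]) simp

lemma xf_L2: "(\<lambda>x. of_real x * f x) \<in> L2"
  by (rule exp_decay_L2[OF continuous_measurable_Rpos k xf_bound]) (intro continuous_intros f_cont_Rpos)

lemma U_H10: assumes t: "t < 1 / a" shows "U t \<in> H10"
proof -
  have S: "0 < S t" by (rule S_pos[OF t])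
  \<comment> \<open>In the variable y = x / S the phase a x^2 / (4 S) becomes a S y^2 / 4. Thus
    \<open>U t\<close> is a constant times a dilation of a chirp times f, and each of these
    operations preserves \<open>H10\<close>.\<close>
  define V where "V = (\<lambda>y. exp (\<i> * of_real (- (a * S t / 4) * y\<^sup>2)) * f y)"
  define z where "z = of_real (inverse (sqrt (S t))) * exp (\<i> * of_real (\<omega> * t / S t))"
  have "V \<in> H10" unfolding V_def
    by (rule H10_mult_chirp[OF f_H10 f_deriv g_cont g_L2 xf_L2])
  then have "(\<lambda>x. z * V (x / S t)) \<in> H10" by (intro H10_cmult H10_dilate S)
  moreover have "(\<lambda>x. z * V (x / S t)) = U t"
  proof
    fix x
    have "\<i> * of_real (\<omega> * t / S t) + \<i> * of_real (- (a * S t / 4) * (x / S t)\<^sup>2) = \<i> * of_real (phase t x)"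
    proof -
      have "- (a * S t / 4) * (x / S t)\<^sup>2 = - (a * x\<^sup>2 / (4 * S t))" using S by (simp add: field_simps power2_eq_square)
      then show ?thesis unfolding phase_def by (simp only: diff_conv_add_uminus of_real_add distrib_left)
    qed
    then show "z * V (x / S t) = U t x"
    proof -
      assume e: "\<i> * of_real (\<omega> * t / S t) + \<i> * of_real (- (a * S t / 4) * (x / S t)\<^sup>2) = \<i> * of_real (phase t x)"
      show ?thesis unfolding z_def V_def U_def amp_def e[symmetric] exp_add by (simp only: mult.assoc)
    qed
  qed
  ultimately show ?thesis by simp
qed

text \<open>The modulus S^(-1/2) of the amplitude is exactly the L2 normalisation of the dilation by
  S.\<close>

lemma amp_L2:
  assumes t: "t < 1 / a" and w: "w \<in> L2"
  shows "(\<lambda>x. amp t x * w (x / S t)) \<in> L2" "L2_norm (\<lambda>x. amp t x * w (x / S t)) = L2_norm w"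
proof -
  have S: "0 < S t" by (rule S_pos[OF t])
  show "(\<lambda>x. amp t x * w (x / S t)) \<in> L2"
  proof (rule L2_bound(1)[OF L2_dilate(1)[OF w S]])
    show "(\<lambda>x. amp t x * w (x / S t)) \<in> borel_measurable Rpos"
      by (intro borel_measurable_times continuous_measurable_Rpos cont_x(1)[OF t] L2_measurable[OF L2_dilate(1)[OF w S]])
    show "AE x in Rpos. cmod (amp t x * w (x / S t)) \<le> inverse (sqrt (S t)) * cmod (w (x / S t))"
      by (rule AE_I2) (simp add: norm_mult cmod_amp[OF t])
    show "0 \<le> inverse (sqrt (S t))" using S by simp
  qed
  have "L2_norm (\<lambda>x. amp t x * w (x / S t)) = L2_norm (\<lambda>x. of_real (inverse (sqrt (S t))) * w (x / S t))"
    unfolding L2_norm_def norm_mult cmod_amp[OF t] norm_of_real using S by simp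
  also have "\<dots> = inverse (sqrt (S t)) * (sqrt (S t) * L2_norm w)"
    unfolding L2_norm_cmult L2_dilate(2)[OF w S] norm_of_real using S by simp
  also have "\<dots> = L2_norm w" using S by simp
  finally show "L2_norm (\<lambda>x. amp t x * w (x / S t)) = L2_norm w" .
qed

lemma Ux_parts:
  "(\<lambda>x. amp t x * (of_real (1 / S t) * g (x / S t))) = (\<lambda>x. of_real (1 / S t) * (amp t x * g (x / S t)))"
  "(\<lambda>x. amp t x * (\<i> * of_real (a * (x / S t) / 2) * f (x / S t)))
     = (\<lambda>x. (\<i> * of_real (a / 2)) * (amp t x * ((\<lambda>y. of_real y * f y) (x / S t))))"
  by (auto simp: fun_eq_iff mult_ac)

lemma Ux_parts_L2:
  assumes t: "t < 1 / a"
  shows "(\<lambda>x. amp t x * (of_real (1 / S t) * g (x / S t))) \<in> L2"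
    "L2_norm (\<lambda>x. amp t x * (of_real (1 / S t) * g (x / S t))) = 1 / S t * L2_norm g"
    "(\<lambda>x. amp t x * (\<i> * of_real (a * (x / S t) / 2) * f (x / S t))) \<in> L2"
    "L2_norm (\<lambda>x. amp t x * (\<i> * of_real (a * (x / S t) / 2) * f (x / S t))) = a / 2 * L2_norm (\<lambda>y. of_real y * f y)"
proof -
  show "(\<lambda>x. amp t x * (of_real (1 / S t) * g (x / S t))) \<in> L2"
    unfolding Ux_parts by (rule L2_cmult[OF amp_L2(1)[OF t g_L2]])
  show "(\<lambda>x. amp t x * (\<i> * of_real (a * (x / S t) / 2) * f (x / S t))) \<in> L2"
    unfolding Ux_parts by (rule L2_cmult[OF amp_L2(1)[OF t xf_L2]])
  show "L2_norm (\<lambda>x. amp t x * (of_real (1 / S t) * g (x / S t))) = 1 / S t * L2_norm g"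
    unfolding Ux_parts L2_norm_cmult amp_L2(2)[OF t g_L2] norm_of_real using S_pos[OF t] by simp
  show "L2_norm (\<lambda>x. amp t x * (\<i> * of_real (a * (x / S t) / 2) * f (x / S t))) = a / 2 * L2_norm (\<lambda>y. of_real y * f y)"
    unfolding Ux_parts L2_norm_cmult amp_L2(2)[OF t xf_L2] norm_mult norm_ii norm_of_real using a by simp
qed

lemma Ux_L2: "t < 1 / a \<Longrightarrow> Ux t \<in> L2"
  unfolding Ux_def[abs_def] by (intro L2_diff Ux_parts_L2)

lemma U_weak_deriv:
  assumes t: "t < 1 / a"
  shows "AE x in Rpos. weak_deriv (U t) x = Ux t x" "L2_norm (weak_deriv (U t)) = L2_norm (Ux t)"
proof -
  have w: "has_weak_deriv (U t) (Ux t)"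
    by (rule classical_weak_deriv[OF U_deriv_x[OF t] cont_x(5)[OF t]])
  note * = weak_deriv_eqI[OF H10_L2[OF U_H10[OF t]] Ux_L2[OF t] w]
  show "AE x in Rpos. weak_deriv (U t) x = Ux t x" "L2_norm (weak_deriv (U t)) = L2_norm (Ux t)"
    by (fact *)+
qed

lemma Ut_L2: assumes t: "t < 1 / a" shows "Ut t \<in> L2"
proof -
  obtain L q where q: "0 < q" and b: "\<forall>s x. s < 1 / a \<longrightarrow> S t \<le> S s \<longrightarrow> S s \<le> S t \<longrightarrow> 0 < x \<longrightarrow>
     cmod (U s x) \<le> L * exp (- q * x) \<and> cmod (Ut s x) \<le> L * exp (- q * x) \<and>
     cmod (amp s x * (\<i> * of_real (a * (x / S s) / 2) * f (x / S s))) \<le> L * exp (- q * x)"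
    using uniform_bounds[OF S_pos[OF t] order_refl] by (elim exE conjE)
  show ?thesis
    by (rule exp_decay_L2[OF continuous_measurable_Rpos[OF cont_x(6)[OF t]] q])
       (use b[rule_format, OF t order_refl order_refl] in blast)
qed

text \<open>The right end is halfway to the blow-up time, where S has dropped to half of S(t); the
  left end t - 1 limits the growth of S to a.\<close>

definition nbhd :: "real \<Rightarrow> real set" where
  "nbhd t = {t - 1<..<(t + 1 / a) / 2}"

lemma nbhd:
  assumes t: "t < 1 / a"
  shows "open (nbhd t)" "t \<in> nbhd t" "\<And>\<tau>. \<tau> \<in> nbhd t \<Longrightarrow> \<tau> < 1 / a"
    "\<And>\<tau>. \<tau> \<in> nbhd t \<Longrightarrow> S t / 2 \<le> S \<tau>" "\<And>\<tau>. \<tau> \<in> nbhd t \<Longrightarrow> S \<tau> \<le> S t + a"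
proof -
  have 2: "t < (t + 1 / a) / 2" "(t + 1 / a) / 2 < 1 / a"
    using less_half_sum[OF t] gt_half_sum[OF t] by (simp_all only: one_add_one)
  show "open (nbhd t)" by (simp add: nbhd_def)
  show "t \<in> nbhd t" using 2(1) by (simp add: nbhd_def)
  fix \<tau> assume "\<tau> \<in> nbhd t"
  then have 1: "t - 1 < \<tau>" "\<tau> < (t + 1 / a) / 2" by (auto simp: nbhd_def)
  show "\<tau> < 1 / a" by (rule less_trans[OF 1(2) 2(2)])
  have "a * \<tau> \<le> a * ((t + 1 / a) / 2)" using 1 a by (intro mult_left_mono) auto
  also have "a * ((t + 1 / a) / 2) = (a * t + 1) / 2" using a by (simp add: distrib_left)
  finally show "S t / 2 \<le> S \<tau>" unfolding S_def by argo
  have "a * (t - 1) \<le> a * \<tau>" using 1 a by (intro mult_left_mono) auto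
  then show "S \<tau> \<le> S t + a" unfolding S_def by (simp add: algebra_simps)
qed

lemma local_bounds:
  assumes t: "t < 1 / a"
  shows "\<exists>L q. 0 < q \<and> (\<forall>\<tau> x. \<tau> \<in> nbhd t \<longrightarrow> 0 < x \<longrightarrow>
     cmod (U \<tau> x) \<le> L * exp (- q * x) \<and> cmod (Ut \<tau> x) \<le> L * exp (- q * x) \<and>
     cmod (amp \<tau> x * (\<i> * of_real (a * (x / S \<tau>) / 2) * f (x / S \<tau>))) \<le> L * exp (- q * x))"
proof -
  have h: "0 < S t / 2" "S t / 2 \<le> S t + a" using S_pos[OF t] a by auto
  obtain L q where q: "0 < q" and b: "\<forall>s x. s < 1 / a \<longrightarrow> S t / 2 \<le> S s \<longrightarrow> S s \<le> S t + a \<longrightarrow> 0 < x \<longrightarrow>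
     cmod (U s x) \<le> L * exp (- q * x) \<and> cmod (Ut s x) \<le> L * exp (- q * x) \<and>
     cmod (amp s x * (\<i> * of_real (a * (x / S s) / 2) * f (x / S s))) \<le> L * exp (- q * x)"
    using uniform_bounds[OF h] by (elim exE conjE)
  show ?thesis
    by (intro exI[of _ L] exI[of _ q] conjI[OF q] allI impI) (rule b[rule_format, OF nbhd(3-5)[OF t]])
qed

text \<open>The mean value inequality bounds the difference quotients by the uniform majorant of
  \<open>Ut\<close>, and dominated convergence applies. The time derivative thus exists even in
  L2.\<close>

lemma U_L2_derivative:
  assumes t: "t < 1 / a"
  shows "((\<lambda>s. L2_norm (\<lambda>x. (U s x - U t x) / of_real (s - t) - Ut t x)) \<longlongrightarrow> 0) (at t)"
proof -
  define T where "T = nbhd t"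
  have oT: "open T" and T: "t \<in> T" "\<And>\<tau>. \<tau> \<in> T \<Longrightarrow> \<tau> < 1 / a" using nbhd[OF t] by (auto simp: T_def)
  obtain L q where q: "0 < q" and bb: "\<forall>\<tau> x. \<tau> \<in> nbhd t \<longrightarrow> 0 < x \<longrightarrow>
     cmod (U \<tau> x) \<le> L * exp (- q * x) \<and> cmod (Ut \<tau> x) \<le> L * exp (- q * x) \<and>
     cmod (amp \<tau> x * (\<i> * of_real (a * (x / S \<tau>) / 2) * f (x / S \<tau>))) \<le> L * exp (- q * x)"
    using local_bounds[OF t] by (elim exE conjE)
  have b: "cmod (Ut \<tau> x) \<le> L * exp (- q * x)" if "\<tau> \<in> T" "0 < x" for \<tau> x
    using bb that unfolding T_def by blast
  have bd: "cmod (U s2 x - U s1 x) \<le> L * exp (- q * x) * s2 - L * exp (- q * x) * s1"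
    if "s1 \<in> T" "s2 \<in> T" "s1 \<le> s2" "0 < x" for s1 s2 x
  proof (rule vector_derivative_dominated[OF that(3)])
    fix s assume "s1 \<le> s" "s \<le> s2"
    then have s: "s \<in> T" using that(1,2) unfolding T_def nbhd_def by auto
    show "((\<lambda>s. U s x) has_vector_derivative Ut s x) (at s)" by (rule U_deriv_t[OF T(2)[OF s] that(4)])
    show "((\<lambda>s. L * exp (- q * x) * s) has_real_derivative L * exp (- q * x)) (at s)"
      using DERIV_cmult[OF DERIV_ident, of "L * exp (- q * x)"] by simp
    show "cmod (Ut s x) \<le> L * exp (- q * x)" by (rule b[OF s that(4)])
  qed
  show ?thesis
  proof (rule L2_norm_lim_dominated_at[OF oT T(1) _ continuous_measurable_Rpos[OF cont_x(6)[OF t]] integrable_exp_sq[OF q, of L]])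
    fix \<tau> assume \<tau>: "\<tau> \<in> T" "\<tau> \<noteq> t"
    show "(\<lambda>x. (U \<tau> x - U t x) / of_real (\<tau> - t)) \<in> borel_measurable Rpos"
      by (intro continuous_measurable_Rpos continuous_intros cont_x(4) T(2) \<tau>(1) t) (use \<tau> in auto)
    fix x :: real assume x: "0 < x"
    have "cmod (U \<tau> x - U t x) \<le> L * exp (- q * x) * \<bar>\<tau> - t\<bar>"
    proof (cases "t \<le> \<tau>")
      case True
      then show ?thesis using bd[OF T(1) \<tau>(1) True x] by (simp add: algebra_simps)
    next
      case False
      then show ?thesis using bd[OF \<tau>(1) T(1) _ x] by (simp add: algebra_simps norm_minus_commute)
    qed
    then show "cmod ((U \<tau> x - U t x) / of_real (\<tau> - t)) \<le> L * exp (- q * x)"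
      using \<tau>(2) unfolding norm_divide norm_of_real by (simp add: divide_le_eq)
  next
    show "((\<lambda>\<tau>. (U \<tau> x - U t x) / of_real (\<tau> - t)) \<longlongrightarrow> Ut t x) (at t)" if "0 < x" for x
      by (rule has_vector_derivative_quotient[OF U_deriv_t[OF t that]])
  qed
qed

lemma time_limits:
  assumes t: "t < 1 / a" and x: "0 < x"
  shows "((\<lambda>\<tau>. U \<tau> x) \<longlongrightarrow> U t x) (at t)" "((\<lambda>\<tau>. amp \<tau> x) \<longlongrightarrow> amp t x) (at t)"
    "((\<lambda>\<tau>. of_real (1 / S \<tau>) * g (x / S \<tau>)) \<longlongrightarrow> of_real (1 / S t) * g (x / S t)) (at t)"
    "((\<lambda>\<tau>. \<i> * of_real (a * (x / S \<tau>) / 2) * f (x / S \<tau>)) \<longlongrightarrow> \<i> * of_real (a * (x / S t) / 2) * f (x / S t)) (at t)"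
proof -
  have S: "0 < S t" by (rule S_pos[OF t])
  have c: "isCont F t \<Longrightarrow> (F \<longlongrightarrow> F t) (at t)" for F :: "real \<Rightarrow> complex" by (simp add: isCont_def)
  show "((\<lambda>\<tau>. U \<tau> x) \<longlongrightarrow> U t x) (at t)"
    by (rule c[OF has_vector_derivative_continuous[OF U_deriv_t[OF t x]]])
  show "((\<lambda>\<tau>. amp \<tau> x) \<longlongrightarrow> amp t x) (at t)"
    by (rule c[OF has_vector_derivative_continuous[OF amp_deriv_t[OF t]]])
  have Sl: "(S \<longlongrightarrow> S t) (at t)" using DERIV_isCont[OF S_deriv] by (simp add: isCont_def)
  have Sn: "S t \<noteq> 0" using S by simp
  have y: "((\<lambda>\<tau>. x / S \<tau>) \<longlongrightarrow> x / S t) (at t)" by (intro tendsto_intros Sl Sn)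
  have "isCont g (x / S t)" by (rule has_vector_derivative_continuous[OF g_deriv]) (use x S in simp)
  from isCont_tendsto_compose[OF this y]
  have gl: "((\<lambda>\<tau>. g (x / S \<tau>)) \<longlongrightarrow> g (x / S t)) (at t)" .
  have "isCont f (x / S t)" by (rule has_vector_derivative_continuous[OF f_deriv]) (use x S in simp)
  from isCont_tendsto_compose[OF this y]
  have fl: "((\<lambda>\<tau>. f (x / S \<tau>)) \<longlongrightarrow> f (x / S t)) (at t)" .
  show "((\<lambda>\<tau>. of_real (1 / S \<tau>) * g (x / S \<tau>)) \<longlongrightarrow> of_real (1 / S t) * g (x / S t)) (at t)"
    by (intro tendsto_mult tendsto_of_real tendsto_divide tendsto_const gl Sl Sn)
  show "((\<lambda>\<tau>. \<i> * of_real (a * (x / S \<tau>) / 2) * f (x / S \<tau>)) \<longlongrightarrow> \<i> * of_real (a * (x / S t) / 2) * f (x / S t)) (at t)"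
    by (intro tendsto_mult tendsto_of_real tendsto_divide tendsto_const fl y Sl Sn) auto
qed

text \<open>\<open>U\<close> and the part \<open>X2\<close> of its derivative are dominated. The
  part \<open>X1\<close> with g is not, but its norm is ||g|| / S(t), continuous in t, and pointwise
  convergence with convergence of norms gives strong convergence.\<close>

lemma U_H1_continuous:
  assumes t: "t < 1 / a"
  shows "((\<lambda>s. H1_norm (\<lambda>x. U s x - U t x)) \<longlongrightarrow> 0) (at t)"
proof -
  define T where "T = nbhd t"
  have oT: "open T" and T: "t \<in> T" "\<And>\<tau>. \<tau> \<in> T \<Longrightarrow> \<tau> < 1 / a" using nbhd[OF t] by (auto simp: T_def)
  obtain L q where q: "0 < q" and bb: "\<forall>\<tau> x. \<tau> \<in> nbhd t \<longrightarrow> 0 < x \<longrightarrow>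
     cmod (U \<tau> x) \<le> L * exp (- q * x) \<and> cmod (Ut \<tau> x) \<le> L * exp (- q * x) \<and>
     cmod (amp \<tau> x * (\<i> * of_real (a * (x / S \<tau>) / 2) * f (x / S \<tau>))) \<le> L * exp (- q * x)"
    using local_bounds[OF t] by (elim exE conjE)
  have b: "cmod (U \<tau> x) \<le> L * exp (- q * x)"
     "cmod (amp \<tau> x * (\<i> * of_real (a * (x / S \<tau>) / 2) * f (x / S \<tau>))) \<le> L * exp (- q * x)" if "\<tau> \<in> T" "0 < x" for \<tau> x
    using bb that unfolding T_def by blast+
  define X1 where "X1 = (\<lambda>\<tau> x. amp \<tau> x * (of_real (1 / S \<tau>) * g (x / S \<tau>)))"
  define X2 where "X2 = (\<lambda>\<tau> x. amp \<tau> x * (\<i> * of_real (a * (x / S \<tau>) / 2) * f (x / S \<tau>)))"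
  have XL: "X1 \<tau> \<in> L2" "L2_norm (X1 \<tau>) = 1 / S \<tau> * L2_norm g" "X2 \<tau> \<in> L2" if "\<tau> < 1 / a" for \<tau>
    unfolding X1_def X2_def using Ux_parts_L2[OF that] by auto
  have l0: "((\<lambda>\<tau>. L2_norm (\<lambda>x. U \<tau> x - U t x)) \<longlongrightarrow> 0) (at t)"
    by (rule L2_norm_lim_dominated_at[OF oT T(1) L2_measurable[OF H10_L2[OF U_H10[OF T(2)]]]
          L2_measurable[OF H10_L2[OF U_H10[OF t]]] integrable_exp_sq[OF q, of L]])
       (use b(1) time_limits(1)[OF t] in auto)
  have l1: "((\<lambda>\<tau>. L2_norm (\<lambda>x. X1 \<tau> x - X1 t x)) \<longlongrightarrow> 0) (at t)"
  proof (rule L2_norm_lim_norms_at[OF oT T(1) XL(1)[OF T(2)] XL(1)[OF t]])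
    show "((\<lambda>\<tau>. X1 \<tau> x) \<longlongrightarrow> X1 t x) (at t)" if "0 < x" for x
      unfolding X1_def by (intro tendsto_mult[OF time_limits(2)[OF t that] time_limits(3)[OF t that]])
    have "(S \<longlongrightarrow> S t) (at t)" using DERIV_isCont[OF S_deriv] by (simp add: isCont_def)
    then have "((\<lambda>\<tau>. 1 / S \<tau> * L2_norm g) \<longlongrightarrow> 1 / S t * L2_norm g) (at t)"
      using S_pos[OF t] by (intro tendsto_intros) auto
    then show "((\<lambda>\<tau>. L2_norm (X1 \<tau>)) \<longlongrightarrow> L2_norm (X1 t)) (at t)"
      unfolding XL(2)[OF t]
    proof (rule Lim_transform_eventually)
      show "\<forall>\<^sub>F \<tau> in at t. 1 / S \<tau> * L2_norm g = L2_norm (X1 \<tau>)"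
        using eventually_at_in_open'[OF oT T(1)] by eventually_elim (simp add: XL(2)[OF T(2)])
    qed
  qed
  have l2: "((\<lambda>\<tau>. L2_norm (\<lambda>x. X2 \<tau> x - X2 t x)) \<longlongrightarrow> 0) (at t)"
  proof (rule L2_norm_lim_dominated_at[OF oT T(1) L2_measurable[OF XL(3)[OF T(2)]]
          L2_measurable[OF XL(3)[OF t]] integrable_exp_sq[OF q, of L]])
    show "cmod (X2 \<tau> x) \<le> L * exp (- q * x)" if "\<tau> \<in> T" "0 < x" for \<tau> x
      unfolding X2_def by (rule b(2)[OF that])
    show "((\<lambda>\<tau>. X2 \<tau> x) \<longlongrightarrow> X2 t x) (at t)" if "0 < x" for x
      unfolding X2_def by (intro tendsto_mult[OF time_limits(2)[OF t that] time_limits(4)[OF t that]])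
  qed
  show ?thesis
  proof (rule tendsto_sandwich[OF _ _ tendsto_const])
    show "((\<lambda>\<tau>. L2_norm (\<lambda>x. U \<tau> x - U t x) + (L2_norm (\<lambda>x. X1 \<tau> x - X1 t x) + L2_norm (\<lambda>x. X2 \<tau> x - X2 t x))) \<longlongrightarrow> 0) (at t)"
      using tendsto_add[OF l0 tendsto_add[OF l1 l2]] by simp
    show "\<forall>\<^sub>F \<tau> in at t. H1_norm (\<lambda>x. U \<tau> x - U t x)
        \<le> L2_norm (\<lambda>x. U \<tau> x - U t x) + (L2_norm (\<lambda>x. X1 \<tau> x - X1 t x) + L2_norm (\<lambda>x. X2 \<tau> x - X2 t x))"
      using eventually_at_in_open'[OF oT T(1)]
    proof eventually_elim
      case (elim \<tau>)
      note \<tau> = T(2)[OF elim]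
      have "L2_norm (weak_deriv (\<lambda>x. U \<tau> x - U t x)) = L2_norm (\<lambda>x. weak_deriv (U \<tau>) x - weak_deriv (U t) x)"
        by (rule H1_diff(3)[OF H10_H1[OF U_H10[OF \<tau>]] H10_H1[OF U_H10[OF t]]])
      also have "\<dots> = L2_norm (\<lambda>x. (X1 \<tau> x - X1 t x) - (X2 \<tau> x - X2 t x))"
      proof (rule L2_norm_cong_AE)
        show "(\<lambda>x. weak_deriv (U \<tau>) x - weak_deriv (U t) x) \<in> borel_measurable Rpos"
          by (intro L2_measurable L2_diff weak_deriv(1) H10_H1 U_H10 \<tau> t)
        show "(\<lambda>x. (X1 \<tau> x - X1 t x) - (X2 \<tau> x - X2 t x)) \<in> borel_measurable Rpos"
          by (intro L2_measurable L2_diff XL \<tau> t)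
        show "AE x in Rpos. weak_deriv (U \<tau>) x - weak_deriv (U t) x = (X1 \<tau> x - X1 t x) - (X2 \<tau> x - X2 t x)"
          using U_weak_deriv(1)[OF \<tau>] U_weak_deriv(1)[OF t]
          by eventually_elim (simp add: Ux_def X1_def X2_def)
      qed
      also have "\<dots> \<le> L2_norm (\<lambda>x. X1 \<tau> x - X1 t x) + L2_norm (\<lambda>x. X2 \<tau> x - X2 t x)"
        by (intro L2_norm_triangle_diff L2_diff XL \<tau> t)
      finally show ?case using H1_norm_le[of "\<lambda>x. U \<tau> x - U t x"] by linarith
    qed
  qed simp
qed

text \<open>Against test functions it is the pointwise equation integrated by parts. The left-hand
  side is bounded in the H1 norm of the test vector, so density carries it over to
  \<open>H10\<close>.\<close>

lemma U_equation:
  assumes t: "t < 1 / a" and v: "v \<in> H10"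
  shows "\<i> * L2_inner (Ut t) v + nls_op c 5 (U t) v = 0"
proof -
  note UH = U_H10[OF t]
  have test: "\<i> * L2_inner (Ut t) \<psi> + nls_op c 5 (U t) \<psi> = 0" if \<psi>: "\<psi> \<in> test_functions" for \<psi>
  proof -
    obtain \<psi>' where \<psi>': "\<psi>' \<in> test_functions" "\<And>x. (\<psi> has_vector_derivative \<psi>' x) (at x)"
      using test_functionE[OF \<psi>] by metis
    note c1 = test_cnj[OF \<psi>] and c2 = test_cnj[OF \<psi>'(1)]
    have "L2_inner (weak_deriv (U t)) (weak_deriv \<psi>) = L2_inner (Ux t) \<psi>'"
      by (rule L2_inner_cong_AE[OF weak_deriv(1)[OF H10_H1[OF UH]] Ux_L2[OF t] weak_deriv(1)[OF test_in_H1[OF \<psi>]]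
            test_L2[OF \<psi>'(1)] U_weak_deriv(1)[OF t] test_H1(2)[OF \<psi> \<psi>']])
    also have "\<dots> = - (LINT x|Rpos. Uxx t x * cnj (\<psi> x))"
    proof -
      have "has_weak_deriv (Ux t) (Uxx t)"
        by (rule classical_weak_deriv[OF Ux_deriv_x[OF t] cont_x(7)[OF t]])
      from has_weak_derivD[OF this c1 has_vector_derivative_cnj[OF \<psi>'(2)]] show ?thesis by (simp add: L2_inner_def)
    qed
    also have "(LINT x|Rpos. Uxx t x * cnj (\<psi> x)) = - (\<i> * L2_inner (Ut t) \<psi>
       + of_real c * L2_inner (\<lambda>x. U t x / of_real x) (\<lambda>x. \<psi> x / of_real x) + L2_inner (\<lambda>x. nls_power (U t x)) \<psi>)"
    proof -
      have "Uxx t x * cnj (\<psi> x) = - (\<i> * (Ut t x * cnj (\<psi> x))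
         + of_real c * (U t x / of_real x * cnj (\<psi> x / of_real x)) + nls_power (U t x) * cnj (\<psi> x))" for x
        by (simp add: Uxx_def algebra_simps power2_eq_square)
      then have "(LINT x|Rpos. Uxx t x * cnj (\<psi> x)) = - (LINT x|Rpos. \<i> * (Ut t x * cnj (\<psi> x))
         + of_real c * (U t x / of_real x * cnj (\<psi> x / of_real x)) + nls_power (U t x) * cnj (\<psi> x))"
        by (simp only: integral_minus)
      moreover note i = integrable_mult_right[OF L2_prod_integrable(3)[OF Ut_L2[OF t] test_L2[OF \<psi>]], of \<i>]
        and j = integrable_mult_right[OF L2_prod_integrable(3)[OF hardy(1)[OF UH] hardy(1)[OF test_H10[OF \<psi>]]], of "of_real c"]
        and l = L2_prod_integrable(3)[OF nls_power_L2[OF UH] test_L2[OF \<psi>]]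
      have "(LINT x|Rpos. \<i> * (Ut t x * cnj (\<psi> x))
         + of_real c * (U t x / of_real x * cnj (\<psi> x / of_real x)) + nls_power (U t x) * cnj (\<psi> x))
         = \<i> * L2_inner (Ut t) \<psi> + of_real c * L2_inner (\<lambda>x. U t x / of_real x) (\<lambda>x. \<psi> x / of_real x)
           + L2_inner (\<lambda>x. nls_power (U t x)) \<psi>"
        unfolding Bochner_Integration.integral_add[OF Bochner_Integration.integrable_add[OF i j] l]
          Bochner_Integration.integral_add[OF i j] integral_mult_right_zero L2_inner_def ..
      ultimately show ?thesis by (simp only:)
    qed
    finally show ?thesis unfolding nls_op_eq by simp
  qed
  obtain K where K: "0 \<le> K" "\<And>v. v \<in> H10 \<Longrightarrow> cmod (nls_op c 5 (U t) v) \<le> K * H1_norm v"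
    using nls_op_bounded[OF UH] by blast
  define G where "G = (\<lambda>v. \<i> * L2_inner (Ut t) v + nls_op c 5 (U t) v)"
  define K' where "K' = L2_norm (Ut t) + K"
  have K': "0 \<le> K'" using K by (simp add: K'_def)
  have "cmod (G v) \<le> 0"
  proof (rule field_le_epsilon)
    fix e :: real assume e: "0 < e"
    obtain \<psi> where \<psi>: "\<psi> \<in> test_functions" "H1_norm (\<lambda>x. v x - \<psi> x) < e / (K' + 1)"
      using H10_approx[OF v, of "e / (K' + 1)"] e K' by auto
    have d: "(\<lambda>x. v x - \<psi> x) \<in> H10" by (rule H10_diff[OF v test_H10[OF \<psi>(1)]])
    have "G v = G (\<lambda>x. v x - \<psi> x) + G \<psi>"
      unfolding G_def nls_op_diff_right[OF UH v test_H10[OF \<psi>(1)]]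
        L2_inner_diff_right[OF Ut_L2[OF t] H10_L2[OF v] test_L2[OF \<psi>(1)]] by (simp add: algebra_simps)
    then have "cmod (G v) = cmod (G (\<lambda>x. v x - \<psi> x))" using test[OF \<psi>(1)] by (simp add: G_def)
    also have "\<dots> \<le> cmod (L2_inner (Ut t) (\<lambda>x. v x - \<psi> x)) + cmod (nls_op c 5 (U t) (\<lambda>x. v x - \<psi> x))"
      unfolding G_def by (rule order_trans[OF norm_triangle_ineq]) (simp add: norm_mult)
    also have "\<dots> \<le> L2_norm (Ut t) * H1_norm (\<lambda>x. v x - \<psi> x) + K * H1_norm (\<lambda>x. v x - \<psi> x)"
      by (intro add_mono K(2) d order_trans[OF L2_inner_bound[OF Ut_L2[OF t] H10_L2[OF d]]] mult_left_mono L2_norm_le_H1_norm L2_norm_nonneg)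
    also have "\<dots> = K' * H1_norm (\<lambda>x. v x - \<psi> x)" by (simp add: K'_def distrib_right)
    also have "\<dots> \<le> K' * (e / (K' + 1))" using \<psi>(2) K' by (intro mult_left_mono) auto
    also have "\<dots> \<le> 0 + e" using e K' by (simp add: field_simps)
    finally show "cmod (G v) \<le> 0 + e" .
  qed
  then show ?thesis by (simp add: G_def)
qed

lemma time_interval_U: "t \<in> time_interval \<infinity> (ereal (1 / a)) \<longleftrightarrow> t < 1 / a"
  by (simp add: time_interval_def)

lemma U_solution: "nls_solution c 5 U \<infinity> (ereal (1 / a))"
  unfolding nls_solution_def time_interval_U
proof (intro conjI ballI)
  show "0 < ereal (1 / a)" using a by simp
  fix t assume "t \<in> time_interval \<infinity> (ereal (1 / a))"
  then have t: "t < 1 / a" by (simp add: time_interval_U)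
  show "U t \<in> H10" by (rule U_H10[OF t])
  show "((\<lambda>s. H1_norm (\<lambda>x. U s x - U t x)) \<longlongrightarrow> 0) (at t)" by (rule U_H1_continuous[OF t])
  show "\<exists>F. has_Hm1_derivative U F t \<and> (\<forall>v\<in>H10. \<i> * F v + nls_op c 5 (U t) v = 0)"
  proof (intro exI[of _ "L2_inner (Ut t)"] conjI ballI U_equation[OF t])
    have ev: "\<forall>\<^sub>F s in at t. s \<in> {..<1 / a}"
      by (rule eventually_at_in_open') (use t in auto)
    show "has_Hm1_derivative U (L2_inner (Ut t)) t"
      unfolding has_Hm1_derivative_def
    proof (rule tendsto_sandwich[OF _ _ tendsto_const])
      have "((\<lambda>s. ennreal (L2_norm (\<lambda>x. (U s x - U t x) / of_real (s - t) - Ut t x))) \<longlongrightarrow> ennreal 0) (at t)"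
        by (rule tendsto_ennrealI[OF U_L2_derivative[OF t]])
      then show "((\<lambda>s. ennreal (L2_norm (\<lambda>x. (U s x - U t x) / of_real (s - t) - Ut t x))) \<longlongrightarrow> 0) (at t)" by simp
      \<comment> \<open>On the unit ball of H1 the L2 norm is at most 1, so the H^-1 norm of an L2
        function is at most its L2 norm.\<close>
      show "\<forall>\<^sub>F s in at t. Hm1_norm (\<lambda>v. (L2_inner (U s) v - L2_inner (U t) v) / of_real (s - t) - L2_inner (Ut t) v)
          \<le> ennreal (L2_norm (\<lambda>x. (U s x - U t x) / of_real (s - t) - Ut t x))"
        using ev
      proof eventually_elim
        case (elim s)
        then have s: "s < 1 / a" by simp
        note L = H10_L2[OF U_H10[OF s]] H10_L2[OF U_H10[OF t]]
        define q where "q = (\<lambda>x. of_real (1 / (s - t)) * (U s x - U t x) - Ut t x)"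
        have q: "q \<in> L2" unfolding q_def by (intro L2_diff L2_cmult L Ut_L2 t)
        have qe: "(\<lambda>x. (U s x - U t x) / of_real (s - t) - Ut t x) = q" by (simp add: q_def fun_eq_iff)
        show "Hm1_norm (\<lambda>v. (L2_inner (U s) v - L2_inner (U t) v) / of_real (s - t) - L2_inner (Ut t) v)
          \<le> ennreal (L2_norm (\<lambda>x. (U s x - U t x) / of_real (s - t) - Ut t x))"
          unfolding Hm1_norm_def qe
        proof (rule SUP_least)
          fix v assume "v \<in> {v \<in> H10. H1_norm v \<le> 1}"
          then have v: "v \<in> L2" "H1_norm v \<le> 1" using H10_L2 by auto
          have "(L2_inner (U s) v - L2_inner (U t) v) / of_real (s - t) - L2_inner (Ut t) v = L2_inner q v"
            unfolding q_def L2_inner_diff_left[OF L2_cmult[OF L2_diff[OF L]] Ut_L2[OF t] v(1)] L2_inner_cmult_left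
              L2_inner_diff_left[OF L v(1)] by simp
          also have "cmod \<dots> \<le> L2_norm q * L2_norm v" by (rule L2_inner_bound[OF q v(1)])
          also have "\<dots> \<le> L2_norm q * 1"
            using v(2) L2_norm_le_H1_norm[of v] by (intro mult_left_mono) auto
          finally show "ennreal (cmod ((L2_inner (U s) v - L2_inner (U t) v) / of_real (s - t) - L2_inner (Ut t) v)) \<le> ennreal (L2_norm q)"
            by (intro ennreal_leI) simp
        qed
      qed
    qed simp
  qed
qed simp

text \<open>In the x-derivative the term with g has norm ||g|| / S(t), which tends to infinity,
  while the other term has a norm that is constant in time.\<close>

lemma U_blow_up:
  assumes g: "0 < L2_norm g"
  shows "filterlim (\<lambda>t. L2_norm (weak_deriv (U t))) at_top (at_left (1 / a))"
proof (rule filterlim_at_top_mono)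
  define B where "B = a / 2 * L2_norm (\<lambda>y. of_real y * f y)"
  have "filterlim S (at_right 0) (at_left (1 / a))"
    unfolding filterlim_at
  proof
    have "(S \<longlongrightarrow> S (1 / a)) (at_left (1 / a))"
      using DERIV_isCont[OF S_deriv, of "1 / a"] by (auto simp: isCont_def intro: tendsto_within_subset)
    then show "(S \<longlongrightarrow> 0) (at_left (1 / a))" using a by (simp add: S_def)
    show "\<forall>\<^sub>F t in at_left (1 / a). S t \<in> {0<..} \<and> S t \<noteq> 0"
      by (auto simp: eventually_at_filter intro!: always_eventually dest: S_pos)
  qed
  then have "filterlim (\<lambda>t. inverse (S t)) at_top (at_left (1 / a))"
    by (rule filterlim_compose[OF filterlim_inverse_at_top_right])
  then have "filterlim (\<lambda>t. L2_norm g * inverse (S t)) at_top (at_left (1 / a))"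
    by (rule filterlim_tendsto_pos_mult_at_top[OF tendsto_const g])
  then show "filterlim (\<lambda>t. - B + L2_norm g * inverse (S t)) at_top (at_left (1 / a))"
    by (rule filterlim_tendsto_add_at_top[OF tendsto_const])
  show "\<forall>\<^sub>F t in at_left (1 / a). - B + L2_norm g * inverse (S t) \<le> L2_norm (weak_deriv (U t))"
    unfolding eventually_at_filter
  proof (intro always_eventually allI impI)
    fix t assume "t \<in> {..<1 / a}"
    then have t: "t < 1 / a" by simp
    note p = Ux_parts_L2[OF t]
    have "1 / S t * L2_norm g - B \<le> L2_norm (Ux t)"
      unfolding Ux_def[abs_def] B_def using L2_norm_abs_diff[OF p(1,3)] unfolding p(2,4) by linarith
    then show "- B + L2_norm g * inverse (S t) \<le> L2_norm (weak_deriv (U t))"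
      unfolding U_weak_deriv(2)[OF t] by (simp add: inverse_eq_divide)
  qed
qed

end

section \<open>Blow-up\<close>


context pseudo_conformal
begin

text \<open>A solution is continuous in H1 at 1 / a and hence bounded in H1 nearby, whereas the
  derivative of U is unbounded from the left. The fact is used both for the maximality of U and to
  limit the lifespan of any other solution.\<close>

lemma U_no_extension:
  assumes g: "0 < L2_norm g" and w: "nls_solution c 5 w Smin Smax" and mem: "1 / a \<in> time_interval Smin Smax"
    and eq: "\<And>t. t \<in> time_interval Smin Smax \<Longrightarrow> t < 1 / a \<Longrightarrow> AE x in Rpos. w t x = U t x"
  shows False
proof -
  have wH: "w s \<in> H10" if "s \<in> time_interval Smin Smax" for s using w that by (auto simp: nls_solution_def)
  have "((\<lambda>s. H1_norm (\<lambda>x. w s x - w (1 / a) x)) \<longlongrightarrow> 0) (at (1 / a))"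
    using w mem by (auto simp: nls_solution_def)
  then have "\<forall>\<^sub>F s in at (1 / a). H1_norm (\<lambda>x. w s x - w (1 / a) x) < 1"
    by (rule order_tendstoD(2)) simp
  then have "\<forall>\<^sub>F s in at (1 / a). s \<in> time_interval Smin Smax \<and> H1_norm (w s) \<le> H1_norm (w (1 / a)) + 1"
    using eventually_time_interval[OF mem]
  proof eventually_elim
    case (elim s)
    then show ?case using H1_norm_abs_diff[OF H10_H1[OF wH[OF elim(2)]] H10_H1[OF wH[OF mem]]] by linarith
  qed
  then have 1: "\<forall>\<^sub>F s in at_left (1 / a). s \<in> time_interval Smin Smax \<and> H1_norm (w s) \<le> H1_norm (w (1 / a)) + 1"
    by (rule filter_leD[OF at_le, rotated]) simp
  have 2: "\<forall>\<^sub>F s in at_left (1 / a). H1_norm (w (1 / a)) + 1 < L2_norm (weak_deriv (U s))"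
    using U_blow_up[OF g] by (simp add: filterlim_at_top_dense)
  have 3: "\<forall>\<^sub>F s in at_left (1 / a). s < 1 / a"
    by (simp add: eventually_at_filter)
  have "\<forall>\<^sub>F s in at_left (1 / a). False"
    using 1 2 3
  proof eventually_elim
    case (elim s)
    then have s: "s \<in> time_interval Smin Smax" and b: "H1_norm (w s) \<le> H1_norm (w (1 / a)) + 1" by auto
    have "L2_norm (weak_deriv (w s)) = L2_norm (weak_deriv (U s))"
      by (rule H1_cong_AE(3)[OF H10_H1[OF U_H10[OF elim(3)]] L2_measurable[OF H10_L2[OF wH[OF s]]]])
         (use eq[OF s elim(3)] in eventually_elim, simp)
    then show ?case using elim(2) b L2_norm_weak_deriv_le[of "w s"] by linarith
  qed
  then show False by (simp add: trivial_limit_at_left_real)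
qed

lemma U_maximal:
  assumes g: "0 < L2_norm g"
  shows "maximal_nls_solution c 5 (U 0) U \<infinity> (ereal (1 / a))"
  unfolding maximal_nls_solution_def
proof (intro conjI allI impI U_solution)
  show "AE x in Rpos. U 0 x = U 0 x" by simp
  fix w Smin Smax
  assume w: "nls_solution c 5 w Smin Smax" and S: "\<infinity> \<le> Smin" "ereal (1 / a) \<le> Smax"
    and eq: "\<forall>t\<in>time_interval \<infinity> (ereal (1 / a)). AE x in Rpos. w t x = U t x"
  show Smin: "Smin = \<infinity>" using S(1) by simp
  show "Smax = ereal (1 / a)"
  proof (rule ccontr)
    assume "Smax \<noteq> ereal (1 / a)"
    then have "1 / a \<in> time_interval Smin Smax" using S Smin by (auto simp: time_interval_def)
    from U_no_extension[OF g w this] eq show False by (auto simp: time_interval_U)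
  qed
qed

text \<open>By uniqueness u agrees with U before 1 / a, and it cannot pass that time. So U extends
  u, maximality makes their intervals equal, and u inherits the blow-up.\<close>

lemma maximal_blows_up:
  assumes g: "0 < L2_norm g" and max: "maximal_nls_solution c 5 (U 0) u Tmin Tmax"
  shows "blows_up_at u Tmax"
proof -
  have u: "nls_solution c 5 u Tmin Tmax" and u0: "AE x in Rpos. u 0 x = U 0 x"
    and ext: "\<And>w Smin Smax. nls_solution c 5 w Smin Smax \<Longrightarrow> Tmin \<le> Smin \<Longrightarrow> Tmax \<le> Smax \<Longrightarrow>
        (\<And>t. t \<in> time_interval Tmin Tmax \<Longrightarrow> AE x in Rpos. w t x = u t x) \<Longrightarrow> Smin = Tmin \<and> Smax = Tmax"
    using max by (auto simp: maximal_nls_solution_def)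
  have pos: "0 < Tmin" "0 < Tmax" using u by (auto simp: nls_solution_def)
  have eq: "AE x in Rpos. u t x = U t x" if "t \<in> time_interval Tmin Tmax" "t < 1 / a" for t
    by (rule nls_unique[OF u U_solution that(1) _ u0]) (simp add: time_interval_U that(2))
  have le: "Tmax \<le> ereal (1 / a)"
  proof (rule ccontr)
    assume "\<not> Tmax \<le> ereal (1 / a)"
    moreover have "- Tmin < ereal (1 / a)"
    proof -
      have "- Tmin < 0" using pos by (simp add: ereal_uminus_less_reorder)
      also have "0 < ereal (1 / a)" using a by simp
      finally show ?thesis .
    qed
    ultimately have "1 / a \<in> time_interval Tmin Tmax" by (simp add: time_interval_def)
    from U_no_extension[OF g u this eq] show False .
  qed
  have "\<infinity> = Tmin \<and> ereal (1 / a) = Tmax"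
  proof (rule ext[OF U_solution _ le])
    fix t assume t: "t \<in> time_interval Tmin Tmax"
    then have "ereal t < Tmax" by (simp add: time_interval_def)
    then have "ereal t < ereal (1 / a)" using le by (rule less_le_trans)
    then have "t < 1 / a" by simp
    from eq[OF t this] show "AE x in Rpos. U t x = u t x" by eventually_elim simp
  qed simp
  then have T: "Tmin = \<infinity>" "Tmax = ereal (1 / a)" by auto
  have uH: "u t \<in> H10" if "t < 1 / a" for t
    using u that unfolding T nls_solution_def by (simp add: time_interval_U)
  have "filterlim (\<lambda>t. L2_norm (weak_deriv (u t))) at_top (at_left (1 / a))"
  proof (rule filterlim_cong[THEN iffD1, OF refl refl _ U_blow_up[OF g]])
    show "\<forall>\<^sub>F t in at_left (1 / a). L2_norm (weak_deriv (U t)) = L2_norm (weak_deriv (u t))"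
      unfolding eventually_at_filter
    proof (intro always_eventually allI impI)
      fix t assume "t \<in> {..<1 / a}"
      then have t: "t < 1 / a" by simp
      then have "AE x in Rpos. u t x = U t x" by (intro eq) (simp_all add: T time_interval_U)
      then show "L2_norm (weak_deriv (U t)) = L2_norm (weak_deriv (u t))"
        by (rule H1_cong_AE(3)[OF H10_H1[OF uH[OF t]] L2_measurable[OF H10_L2[OF U_H10[OF t]]]])
    qed
  qed
  then show ?thesis unfolding blows_up_at_def T by simp
qed

end

text \<open>Half of the rate pays for the polynomial: with h = k / 2, the Taylor bound 1 + z + z^2 /
  2 \<le> exp z at z = h x produces the three summands 1, 1 / h and 2 / h^2.\<close>

lemma polynomial_exp_bound:
  fixes k :: real
  assumes k: "0 < k"
  obtains D where "0 \<le> D" "\<And>x. 0 < x \<Longrightarrow> (1 + x + x\<^sup>2) * exp (- k * x) \<le> D * exp (- (k / 2) * x)"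
proof
  define h where "h = k / 2"
  have h: "0 < h" using k by (simp add: h_def)
  show "0 \<le> 1 + 1 / h + 2 / h\<^sup>2" using h by simp
  fix x :: real assume x: "0 < x"
  define z where "z = h * x"
  have z: "0 < z" using h x by (simp add: z_def)
  have e: "1 + z + z\<^sup>2 / 2 \<le> exp z" using exp_lower_Taylor_quadratic[of z] z by simp
  have "0 \<le> z\<^sup>2 / 2" by simp
  then have "1 \<le> exp z" "z \<le> exp z" "z\<^sup>2 / 2 \<le> exp z" using e z by linarith+
  have "1 + x + x\<^sup>2 = 1 + 1 / h * z + 2 / h\<^sup>2 * (z\<^sup>2 / 2)"
    using h by (simp add: z_def power_mult_distrib)
  also have "\<dots> \<le> exp z + 1 / h * exp z + 2 / h\<^sup>2 * exp z"
    using \<open>1 \<le> exp z\<close> \<open>z \<le> exp z\<close> \<open>z\<^sup>2 / 2 \<le> exp z\<close> h by (intro add_mono mult_left_mono) auto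
  also have "\<dots> = (1 + 1 / h + 2 / h\<^sup>2) * exp z" by (simp add: distrib_right)
  finally have "(1 + x + x\<^sup>2) * exp (- k * x) \<le> (1 + 1 / h + 2 / h\<^sup>2) * exp z * exp (- k * x)"
    by (rule mult_right_mono) simp
  also have "\<dots> = (1 + 1 / h + 2 / h\<^sup>2) * exp (- (k / 2) * x)"
  proof -
    have "exp z * exp (- k * x) = exp (- (k / 2) * x)"
      unfolding exp_add[symmetric] z_def h_def by (simp add: field_simps)
    then show ?thesis by (simp only: mult.assoc)
  qed
  finally show "(1 + x + x\<^sup>2) * exp (- k * x) \<le> (1 + 1 / h + 2 / h\<^sup>2) * exp (- (k / 2) * x)" .
qed

theorem theorem4p3:
  fixes c \<omega> p :: real and \<phi> :: "real \<Rightarrow> complex"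
  assumes "0 < c" and "c < 1/4" and "0 < \<omega>" and "p = 5"
    and "\<phi> \<in> H10" and "\<not> (AE x in Rpos. \<phi> x = 0)"
    and "stationary_solution c p \<omega> \<phi>"
  shows "unstable_by_blow_up c p (standing_wave \<omega> \<phi>)"
proof -
  note \<phi> = \<open>\<phi> \<in> H10\<close>
  obtain f g where f: "continuous_on UNIV f" "AE x in Rpos. \<phi> x = f x" "AE x in Rpos. weak_deriv \<phi> x = g x"
    "\<And>x. 0 < x \<Longrightarrow> (f has_vector_derivative g x) (at x)"
    "\<And>x. 0 < x \<Longrightarrow> (g has_vector_derivative (\<omega> - c / x\<^sup>2 - cmod (f x) ^ 4) *\<^sub>R f x) (at x)"
    "\<And>x. cmod (f x) \<le> H1_norm \<phi>" "(f \<longlongrightarrow> 0) at_top"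
    using stationary_classical[of c \<omega> \<phi>] assms(4,7) by blast
  have cf: "continuous_on {0<..} f" by (rule continuous_on_subset[OF f(1)]) simp
  have cg: "continuous_on {0<..} g"
    by (intro continuous_at_imp_continuous_on ballI has_vector_derivative_continuous[OF f(5)]) simp
  have fH: "f \<in> H10" by (rule H10_cong_AE[OF \<phi> continuous_measurable_Rpos[OF cf] f(2)])
  have gL: "g \<in> L2" "L2_norm g = L2_norm (weak_deriv \<phi>)"
  proof -
    have "AE x in Rpos. cmod (g x) \<le> 1 * cmod (weak_deriv \<phi> x)" using f(3) by eventually_elim simp
    from L2_bound(1)[OF weak_deriv(1)[OF H10_H1[OF \<phi>]] continuous_measurable_Rpos[OF cg] zero_le_one this]
    show "g \<in> L2" .
    show "L2_norm g = L2_norm (weak_deriv \<phi>)"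
      by (rule L2_norm_cong_AE[symmetric, OF L2_measurable[OF weak_deriv(1)[OF H10_H1[OF \<phi>]]] continuous_measurable_Rpos[OF cg] f(3)])
  qed
  \<comment> \<open>The blow-up rate is ||g|| / S, so g must not vanish; Hardy's inequality turns a
    vanishing derivative into a vanishing \<phi>.\<close>
  have gpos: "0 < L2_norm g"
  proof (rule ccontr)
    assume "\<not> 0 < L2_norm g"
    then have "L2_norm (weak_deriv \<phi>) = 0" using L2_norm_nonneg[of g] gL(2) by linarith
    then have "L2_norm (\<lambda>x. \<phi> x / of_real x) = 0"
      using hardy(2)[OF \<phi>] L2_norm_nonneg[of "\<lambda>x. \<phi> x / of_real x"] by linarith
    then have "AE x in Rpos. \<phi> x / of_real x = 0" using L2_norm_eq_0_iff[OF hardy(1)[OF \<phi>]] by simp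
    then have "AE x in Rpos. \<phi> x = 0" unfolding AE_Rpos_iff by eventually_elim auto
    with assms(6) show False ..
  qed
  have "\<exists>C k. 0 < k \<and> 0 \<le> C \<and> (\<forall>x>0. cmod (f x) \<le> C * exp (- k * x)) \<and>
      (\<forall>x>0. cmod (of_real x * g x) \<le> C * exp (- k * x))"
    by (rule stationary_decay[OF assms(3) less_imp_le[OF assms(1)] f(4,5,6,7) H10_L2[OF fH] gL(1)])
  then obtain C0 k0 where k0: "0 < k0" "0 \<le> C0" "\<forall>x>0. cmod (f x) \<le> C0 * exp (- k0 * x)"
    "\<forall>x>0. cmod (of_real x * g x) \<le> C0 * exp (- k0 * x)"
    by (elim exE conjE)
  obtain D where D: "0 \<le> D" "\<And>x. 0 < x \<Longrightarrow> (1 + x + x\<^sup>2) * exp (- k0 * x) \<le> D * exp (- (k0 / 2) * x)"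
    using polynomial_exp_bound[OF k0(1)] by blast
  define k where "k = k0 / 2"
  have kpos: "0 < k" using k0(1) by (simp add: k_def)
  have fb: "(1 + y + y\<^sup>2) * cmod (f y) \<le> (C0 * D) * exp (- k * y)" if "0 < y" for y
  proof -
    have "(1 + y + y\<^sup>2) * cmod (f y) \<le> (1 + y + y\<^sup>2) * (C0 * exp (- k0 * y))"
      using that by (intro mult_left_mono k0(3)[rule_format]) auto
    also have "\<dots> = C0 * ((1 + y + y\<^sup>2) * exp (- k0 * y))" by (simp only: mult_ac)
    also have "\<dots> \<le> C0 * (D * exp (- (k0 / 2) * y))" by (intro mult_left_mono D(2) that k0(2))
    finally show ?thesis by (simp only: k_def mult_ac)
  qed
  have gb: "cmod (of_real y * g y) \<le> (C0 * D) * exp (- k * y)" if "0 < y" for y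
  proof -
    have "1 * exp (- k0 * y) \<le> (1 + y + y\<^sup>2) * exp (- k0 * y)"
      using that by (intro mult_right_mono) auto
    also have "\<dots> \<le> D * exp (- k * y)" using D(2)[OF that] by (simp only: k_def)
    finally have "C0 * exp (- k0 * y) \<le> C0 * (D * exp (- k * y))" using k0(2) by (intro mult_left_mono) auto
    then show ?thesis using k0(4)[rule_format, OF that] by simp
  qed
  \<comment> \<open>The constants do not depend on a, so one set of bounds serves all members of the
    family.\<close>
  have pc: "pseudo_conformal f g \<omega> c a (C0 * D) k" if "0 < a" for a
    by (rule pseudo_conformal.intro[OF f(1) f(4) f(5) fH gL(1) assms(3) kpos mult_nonneg_nonneg[OF k0(2) D(1)] that fb gb])
  have xf: "(\<lambda>x. of_real x * f x) \<in> L2" by (rule pseudo_conformal.xf_L2[OF pc[OF zero_less_one]])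
  define e where "e = (\<lambda>a x. exp (\<i> * complex_of_real (- (a * x\<^sup>2 / 4))))"
  define v where "v = (\<lambda>a x. e a x * g x - g x - \<i> * of_real (a / 2) * (e a x * (of_real x * f x)))"
  have ne: "cmod (e a x) = 1" for a x unfolding e_def by (rule norm_exp_i_times)
  have ce: "continuous_on A (e a)" for a A unfolding e_def by (intro continuous_intros) auto
  have eL: "(\<lambda>x. e a x * w x) \<in> L2" "L2_norm (\<lambda>x. e a x * w x) = L2_norm w" if w: "w \<in> L2" for w a
  proof -
    show "(\<lambda>x. e a x * w x) \<in> L2"
      by (rule L2_bound(1)[OF w borel_measurable_times[OF continuous_measurable_Rpos[OF ce] L2_measurable[OF w]] zero_le_one])
         (simp add: norm_mult ne)
    show "L2_norm (\<lambda>x. e a x * w x) = L2_norm w" by (simp add: L2_norm_def norm_mult ne)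
  qed
  have U0: "pseudo_conformal.U f \<omega> a 0 x = e a x * f x" if "0 < a" for a x
    unfolding pseudo_conformal.U_def[OF pc[OF that]] pseudo_conformal.amp_def[OF pc[OF that]]
      pseudo_conformal.phase_def[OF pc[OF that]] pseudo_conformal.S_def[OF pc[OF that]] e_def by simp
  \<comment> \<open>The chirp multiplies f and g by a unimodular factor close to 1, and its own
    derivative contributes a / 2 times x f; each summand tends to 0 with a.\<close>
  have dist: "H1_norm (\<lambda>x. pseudo_conformal.U f \<omega> a 0 x - \<phi> x)
      \<le> L2_norm (\<lambda>x. e a x * f x - f x) + (L2_norm (\<lambda>x. e a x * g x - g x) + a / 2 * L2_norm (\<lambda>x. of_real x * f x))"
    if a: "0 < a" for a
  proof -
    interpret pseudo_conformal f g \<omega> c a "C0 * D" k by (rule pc[OF a])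
    have t: "0 < 1 / a" using a by simp
    have Ux0: "Ux 0 x = e a x * g x - \<i> * of_real (a / 2) * (e a x * (of_real x * f x))" for x
      unfolding Ux_def amp_def phase_def S_def e_def by (simp add: mult_ac)
    have m: "(\<lambda>x. e a x * f x - f x) \<in> L2" by (intro L2_diff eL(1) H10_L2[OF fH])
    have "L2_norm (\<lambda>x. U 0 x - \<phi> x) = L2_norm (\<lambda>x. e a x * f x - f x)"
    proof (rule L2_norm_cong_AE[OF _ L2_measurable[OF m]])
      show "(\<lambda>x. U 0 x - \<phi> x) \<in> borel_measurable Rpos" by (intro L2_measurable L2_diff H10_L2 U_H10 t \<phi>)
      show "AE x in Rpos. U 0 x - \<phi> x = e a x * f x - f x" using f(2) by eventually_elim (simp add: U0[OF a])
    qed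
    moreover have "L2_norm (weak_deriv (\<lambda>x. U 0 x - \<phi> x)) = L2_norm (v a)"
    proof -
      have vL: "v a \<in> L2" unfolding v_def by (intro L2_diff L2_cmult eL(1) gL(1) xf)
      have "L2_norm (weak_deriv (\<lambda>x. U 0 x - \<phi> x)) = L2_norm (\<lambda>x. weak_deriv (U 0) x - weak_deriv \<phi> x)"
        by (rule H1_diff(3)[OF H10_H1[OF U_H10[OF t]] H10_H1[OF \<phi>]])
      also have "\<dots> = L2_norm (v a)"
      proof (rule L2_norm_cong_AE[OF _ L2_measurable[OF vL]])
        show "(\<lambda>x. weak_deriv (U 0) x - weak_deriv \<phi> x) \<in> borel_measurable Rpos"
          by (intro L2_measurable L2_diff weak_deriv(1) H10_H1 U_H10 t \<phi>)
        show "AE x in Rpos. weak_deriv (U 0) x - weak_deriv \<phi> x = v a x"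
          using U_weak_deriv(1)[OF t] f(3) by eventually_elim (simp add: Ux0 v_def)
      qed
      finally show ?thesis .
    qed
    moreover have "L2_norm (v a) \<le> L2_norm (\<lambda>x. e a x * g x - g x) + a / 2 * L2_norm (\<lambda>x. of_real x * f x)"
    proof -
      have "L2_norm (v a) \<le> L2_norm (\<lambda>x. e a x * g x - g x) + L2_norm (\<lambda>x. (\<i> * of_real (a / 2)) * (e a x * (of_real x * f x)))"
        unfolding v_def by (intro L2_norm_triangle_diff L2_diff L2_cmult eL(1) gL(1) xf)
      also have "L2_norm (\<lambda>x. (\<i> * of_real (a / 2)) * (e a x * (of_real x * f x))) = a / 2 * L2_norm (\<lambda>x. of_real x * f x)"
        unfolding L2_norm_cmult eL(2)[OF xf] norm_mult norm_ii norm_of_real using a by simp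
      finally show ?thesis .
    qed
    ultimately show ?thesis using H1_norm_le[of "\<lambda>x. U 0 x - \<phi> x"] by linarith
  qed
  define A where "A = (\<lambda>n. inverse (real (Suc n)))"
  have A: "0 < A n" for n by (simp add: A_def)
  have Al: "A \<longlonglongrightarrow> 0" unfolding A_def by (rule LIMSEQ_inverse_real_of_nat)
  have lim: "(\<lambda>n. L2_norm (\<lambda>x. e (A n) x * w x - w x)) \<longlonglongrightarrow> 0" if w: "w \<in> L2" for w
  proof (rule L2_norm_lim_dominated[OF L2_measurable[OF eL(1)[OF w]] L2_measurable[OF w] L2_integrable[OF w]])
    show "cmod (e (A n) x * w x) \<le> cmod (w x)" for n x by (simp add: norm_mult ne)
    have "(\<lambda>n. e (A n) x) \<longlonglongrightarrow> exp (\<i> * complex_of_real (- (0 * x\<^sup>2 / 4)))" for x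
      unfolding e_def by (intro tendsto_intros Al) auto
    then have "(\<lambda>n. e (A n) x * w x) \<longlonglongrightarrow> 1 * w x" for x by (intro tendsto_mult tendsto_const) simp
    then show "(\<lambda>n. e (A n) x * w x) \<longlonglongrightarrow> w x" for x by simp
  qed
  have "(\<lambda>n. L2_norm (\<lambda>x. e (A n) x * f x - f x) + (L2_norm (\<lambda>x. e (A n) x * g x - g x) + A n / 2 * L2_norm (\<lambda>x. of_real x * f x)))
      \<longlonglongrightarrow> 0 + (0 + 0 / 2 * L2_norm (\<lambda>x. of_real x * f x))"
    by (intro tendsto_add tendsto_mult tendsto_divide tendsto_const lim H10_L2[OF fH] gL(1) Al) simp
  then have lim0: "(\<lambda>n. L2_norm (\<lambda>x. e (A n) x * f x - f x) + (L2_norm (\<lambda>x. e (A n) x * g x - g x) + A n / 2 * L2_norm (\<lambda>x. of_real x * f x)))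
      \<longlonglongrightarrow> 0" by simp
  have sw: "standing_wave \<omega> \<phi> 0 = \<phi>" by (simp add: standing_wave_def fun_eq_iff)
  show ?thesis
    unfolding unstable_by_blow_up_def sw \<open>p = 5\<close>
  proof (intro allI impI)
    fix \<epsilon> :: real assume "0 < \<epsilon>"
    from eventually_happens[OF order_tendstoD(2)[OF lim0 this]]
    obtain n where n: "L2_norm (\<lambda>x. e (A n) x * f x - f x) + (L2_norm (\<lambda>x. e (A n) x * g x - g x) + A n / 2 * L2_norm (\<lambda>x. of_real x * f x)) < \<epsilon>"
      by auto
    interpret pseudo_conformal f g \<omega> c "A n" "C0 * D" k by (rule pc[OF A])
    show "\<exists>u0\<in>H10. H1_norm (\<lambda>x. u0 x - \<phi> x) < \<epsilon> \<and>
        (\<exists>u Tmin Tmax. maximal_nls_solution c 5 u0 u Tmin Tmax) \<and>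
        (\<forall>u Tmin Tmax. maximal_nls_solution c 5 u0 u Tmin Tmax \<longrightarrow> blows_up_at u Tmax)"
    proof (rule bexI[of _ "U 0"], intro conjI allI impI)
      show "U 0 \<in> H10" by (rule U_H10) (simp add: A)
      show "H1_norm (\<lambda>x. U 0 x - \<phi> x) < \<epsilon>" using dist[OF A[of n]] n by linarith
      show "\<exists>u Tmin Tmax. maximal_nls_solution c 5 (U 0) u Tmin Tmax" using U_maximal[OF gpos] by blast
      show "blows_up_at u Tmax" if "maximal_nls_solution c 5 (U 0) u Tmin Tmax" for u Tmin Tmax
        by (rule maximal_blows_up[OF gpos that])
    qed
  qed
qed

end
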